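(* Let $N\ge1$ be an integer, $p,q>0$ and $\alpha\in(0,N)$. Consider the problem $$(P)\qquad\begin{cases}\dfrac{\partial^2u}{\partial t^2}-\Delta u\ \ge\ (|x|^{-\alpha}\ast|u|^p)|u|^q & \text{in }\mathbb R^{N+1}_+=\mathbb R^N\times(0,\infty),\\[2mm] u(x,0)=u_0(x),\quad \dfrac{\partial u}{\partial t}(x,0)=u_1(x) & \text{in }\mathbb R^N.\end{cases}$$ (i) If $q\ge1$, then $(P)$ admits (for suitable initial data) positive solutions $u\in C^2(\mathbb R^{N+1}_+)$ which satisfy $\frac{\partial u}{\partial t}(\cdot,0)<0$ in $\mathbb R^N$. (ii) If $0<\alpha<\min\{N,3/2\}$ and $$2<p+q\le\frac{2N+1}{N+\alpha-1},$$ then $(P)$ has no nontrivial weak solutions whose initial velocity $u_1=\frac{\partial u}{\partial t}(\cdot,0)$ satisfies $$\text{either}\quad u_1\ge0\ \text{ in }\mathbb R^N,\qquad\text{or}\qquad u_1\in L^1(\mathbb R^N)\ \text{ and }\ \int_{\mathbb R^N}u_1(x)\,dx>0 .$$ (iii) If $N>2$ and $$\min\{p,q\}>\frac{N-\alpha}{N-2}\quad\text{and}\quad p+q>\frac{2N-\alpha}{N-2},$$ then $(P)$ admits (for suitable initial data) positive solutions which satisfy $\frac{\partial u}{\partial t}(\cdot,0)>0$ in $\mathbb R^N$.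
   Context: Write $\mathbb R^{N+1}_+=\mathbb R^N\times(0,\infty)$. The convolution is $(|x|^{-\alpha}\ast|u|^p)(x,t)=\int_{\mathbb R^N}|x-y|^{-\alpha}|u(y,t)|^p\,dy$, required to be finite for almost all $(x,t)\in\mathbb R^{N+1}_+$. Weak solution: given $u_0,u_1\in L^1_{\rm loc}(\mathbb R^N)$, a weak solution of $(P)$ is a function $u\in L^p_{\rm loc}$ such that $(|x|^{-\alpha}\ast|u|^p)|u|^q\in L^1_{\rm loc}$ (local integrability being understood on $\mathbb R^N\times[0,\infty)$) and, for every nonnegative $\varphi\in C_c^\infty(\mathbb R^N\times\mathbb R)$, $$-\int_{\mathbb R^N}u_1(x)\varphi(x,0)\,dx+\int_{\mathbb R^N}u_0(x)\frac{\partial\varphi}{\partial t}(x,0)\,dx+\int_{\mathbb R^{N+1}_+}u\Big[\frac{\partial^2\varphi}{\partial t^2}-\Delta\varphi\Big]dx\,dt\ \ge\ \int_{\mathbb R^{N+1}_+}(|x|^{-\alpha}\ast|u|^p)|u|^q\varphi\,dx\,dt,$$ with the integrals in this inequality well defined. Nontrivial means not identically zero (a.e.). Any classical solution is a weak solution. *)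

theory Defs
  imports "HOL-Analysis.Analysis"
begin

text \<open>
  Space-time is the Euclidean space \<open>'a \<times> real\<close>: a point \<open>(x, t)\<close> has space part
  \<open>x\<close> and time \<open>t\<close>.
\<close>

definition upper_half :: "('a::euclidean_space \<times> real) set" where
  "upper_half = UNIV \<times> {0<..}"

definition closed_upper_half :: "('a::euclidean_space \<times> real) set" where
  "closed_upper_half = UNIV \<times> {0..}"

definition partial_deriv :: "'a::euclidean_space \<Rightarrow> ('a \<Rightarrow> real) \<Rightarrow> 'a \<Rightarrow> real" where
  "partial_deriv v f z = deriv (\<lambda>s. f (z + s *\<^sub>R v)) 0"

definition time_deriv :: "('a::euclidean_space \<times> real \<Rightarrow> real) \<Rightarrow> 'a \<times> real \<Rightarrow> real" where
  "time_deriv = partial_deriv (0, 1)"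

definition laplacian :: "('a::euclidean_space \<times> real \<Rightarrow> real) \<Rightarrow> 'a \<times> real \<Rightarrow> real" where
  "laplacian f z = (\<Sum>b\<in>Basis. partial_deriv (b, 0) (partial_deriv (b, 0) f) z)"

definition wave_operator :: "('a::euclidean_space \<times> real \<Rightarrow> real) \<Rightarrow> 'a \<times> real \<Rightarrow> real" where
  "wave_operator f z = time_deriv (time_deriv f) z - laplacian f z"

text \<open>The following is the class \<open>C\<^sup>k(S)\<close> only for open \<open>S\<close>.\<close>

primrec C_k_on :: "nat \<Rightarrow> 'a::euclidean_space set \<Rightarrow> ('a \<Rightarrow> real) \<Rightarrow> bool" where
  "C_k_on 0 S f \<longleftrightarrow> continuous_on S f"
| "C_k_on (Suc k) S f \<longleftrightarrow>
     f differentiable_on S \<and> (\<forall>b\<in>Basis. C_k_on k S (partial_deriv b f))"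

definition test_function :: "('a::euclidean_space \<Rightarrow> real) \<Rightarrow> bool" where
  "test_function \<phi> \<longleftrightarrow> (\<forall>k. C_k_on k UNIV \<phi>) \<and> compact (closure {z. \<phi> z \<noteq> 0})"

definition locally_integrable_on :: "'a::euclidean_space set \<Rightarrow> ('a \<Rightarrow> real) \<Rightarrow> bool" where
  "locally_integrable_on S f \<longleftrightarrow>
     (\<forall>K. compact K \<and> K \<subseteq> S \<longrightarrow> f absolutely_integrable_on K)"

text \<open>
  Measurability of \<open>u\<close> is a separate requirement, since integrability of \<open>\<bar>u\<bar>\<^sup>p\<close> only gives
  measurability of \<open>\<bar>u\<bar>\<close>.
\<close>

definition Lp_loc_on :: "real \<Rightarrow> 'a::euclidean_space set \<Rightarrow> ('a \<Rightarrow> real) \<Rightarrow> bool" where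
  "Lp_loc_on p S u \<longleftrightarrow>
     u \<in> borel_measurable (lebesgue_on S) \<and> locally_integrable_on S (\<lambda>z. \<bar>u z\<bar> powr p)"

text \<open>
  The Bochner integral defining \<open>riesz_conv\<close> is \<open>0\<close> when it diverges, so finiteness of the
  convolution at a point is always required separately, through \<open>riesz_conv_finite\<close>.
\<close>

definition riesz_conv ::
    "real \<Rightarrow> real \<Rightarrow> ('a::euclidean_space \<times> real \<Rightarrow> real) \<Rightarrow> 'a \<times> real \<Rightarrow> real" where
  "riesz_conv \<alpha> p u = (\<lambda>(x, t). LINT y|lebesgue. norm (x - y) powr (- \<alpha>) * \<bar>u (y, t)\<bar> powr p)"

definition riesz_conv_finite ::
    "real \<Rightarrow> real \<Rightarrow> ('a::euclidean_space \<times> real \<Rightarrow> real) \<Rightarrow> 'a \<times> real \<Rightarrow> bool" where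
  "riesz_conv_finite \<alpha> p u =
     (\<lambda>(x, t). integrable lebesgue (\<lambda>y. norm (x - y) powr (- \<alpha>) * \<bar>u (y, t)\<bar> powr p))"

definition weak_solution ::
    "real \<Rightarrow> real \<Rightarrow> real \<Rightarrow> ('a::euclidean_space \<Rightarrow> real) \<Rightarrow> ('a \<Rightarrow> real) \<Rightarrow>
     ('a \<times> real \<Rightarrow> real) \<Rightarrow> bool" where
  "weak_solution \<alpha> p q u0 u1 u \<longleftrightarrow>
     locally_integrable_on UNIV u0 \<and>
     locally_integrable_on UNIV u1 \<and>
     Lp_loc_on p closed_upper_half u \<and>
     (AE z in lebesgue. z \<in> upper_half \<longrightarrow> riesz_conv_finite \<alpha> p u z) \<and>
     locally_integrable_on closed_upper_half (\<lambda>z. riesz_conv \<alpha> p u z * \<bar>u z\<bar> powr q) \<and>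
     (\<forall>\<phi>. test_function \<phi> \<and> (\<forall>z. \<phi> z \<ge> 0) \<longrightarrow>
        integrable lebesgue (\<lambda>x. u1 x * \<phi> (x, 0)) \<and>
        integrable lebesgue (\<lambda>x. u0 x * time_deriv \<phi> (x, 0)) \<and>
        set_integrable lebesgue upper_half (\<lambda>z. u z * wave_operator \<phi> z) \<and>
        set_integrable lebesgue upper_half (\<lambda>z. riesz_conv \<alpha> p u z * \<bar>u z\<bar> powr q * \<phi> z) \<and>
        - (LINT x|lebesgue. u1 x * \<phi> (x, 0)) + (LINT x|lebesgue. u0 x * time_deriv \<phi> (x, 0))
          + (LINT z:upper_half|lebesgue. u z * wave_operator \<phi> z)
        \<ge> (LINT z:upper_half|lebesgue. riesz_conv \<alpha> p u z * \<bar>u z\<bar> powr q * \<phi> z))"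

text \<open>
  Pointwise solutions of class \<open>C\<^sup>2\<close> in the open half-space for which \<open>u\<close> and its time
  derivative are continuous up to \<open>t = 0\<close>, with boundary values \<open>u0\<close> and \<open>u1\<close>.
\<close>

definition classical_solution ::
    "real \<Rightarrow> real \<Rightarrow> real \<Rightarrow> ('a::euclidean_space \<Rightarrow> real) \<Rightarrow> ('a \<Rightarrow> real) \<Rightarrow>
     ('a \<times> real \<Rightarrow> real) \<Rightarrow> bool" where
  "classical_solution \<alpha> p q u0 u1 u \<longleftrightarrow>
     C_k_on 2 upper_half u \<and>
     (\<forall>z\<in>upper_half. riesz_conv_finite \<alpha> p u z \<and>
        wave_operator u z \<ge> riesz_conv \<alpha> p u z * \<bar>u z\<bar> powr q) \<and>
     continuous_on closed_upper_half u \<and>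
     (\<forall>x. u (x, 0) = u0 x) \<and>
     (\<forall>x. ((\<lambda>t. u (x, t)) has_real_derivative u1 x) (at 0 within {0..})) \<and>
     (\<forall>x. (time_deriv u \<longlongrightarrow> u1 x) (at (x, 0) within upper_half))"

end

theory Submission
  imports Defs "HOL-Computational_Algebra.Polynomial"
begin

text \<open>
  (i) For \<open>q \<ge> 1\<close> the nonlinearity is at most linear in small \<open>u\<close>, so the fast decaying function
  \<open>exp (- l t) (1 + \<bar>x\<bar>\<^sup>2) powr (- k)\<close> is a supersolution once \<open>l\<close> is large.

  (iii) The function \<open>u = e (1 + \<bar>x\<bar>\<^sup>2 + \<delta> (t - 1)\<^sup>2) powr (- k)\<close> with \<open>2k = N - 2 - 2\<delta>\<close> satisfies
  \<open>u\<^sub>t\<^sub>t - \<Delta>u \<ge> c e (\<dots>) powr (- k - 1)\<close>. The hypotheses say that the nonlinear term decays at least as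
  fast when \<open>\<delta>\<close> is small, and \<open>p + q > 1\<close> absorbs the constants when \<open>e\<close> is small. The velocity is
  positive at \<open>t = 0\<close> because the time profile peaks at \<open>t = 1\<close>.

  (ii) Let \<open>r = (p + q) / 2\<close> and test with a cutoff \<open>\<phi>\<close> at scale \<open>R\<close>. Since \<open>\<bar>x - y\<bar> \<le> 4R\<close> on its support,
  the Cauchy--Schwarz inequality bounds the nonlinear term from below by
  \<open>(4R) powr (- \<alpha>)\<close> times \<open>K = \<integral>(\<integral>\<bar>u\<bar> powr r \<phi> dx)\<^sup>2 dt\<close>, while Young's inequality in \<open>x\<close> and then in \<open>t\<close>
  bounds the linear term by \<open>K\<close> over the region \<open>\<bar>(x, t)\<bar> \<ge> R\<close>, where \<open>\<phi>\<close> is not constant. The condition on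
  \<open>p + q\<close> is what keeps the remaining term bounded as \<open>R \<rightarrow> \<infinity>\<close>. This makes \<open>K\<close> bounded, hence its
  tail small, hence \<open>K = 0\<close>.
\<close>

section \<open>Smooth functions\<close>

text \<open>The convolution acts on each time slice separately, so testing controls the time
  integral of the square of a space integral. The linear term has to be compared with the same mixed
  quantity: hence one use of Young's inequality with exponent \<open>r\<close> in space and one with
  exponent 2 in time. The first needs a cutoff whose wave operator is bounded by a multiple of
  \<open>\<phi> powr (1 / r)\<close> up to the edge of the support. Derivatives of
  \<open>exp (- 1 / s)\<close> lose only an arbitrarily small part of the exponent, and the cutoff
  is built from that function. It is radial in space-time, so its time derivative vanishes at
  \<open>t = 0\<close> and \<open>u0\<close> drops out; the condition on \<open>u1\<close> disposes
  of the other boundary term at large scales. The two Young parameters leave a family of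
  inequalities \<open>K \<le> \<eta> * tail + D * \<eta> powr (- 1 / (2 * r - 1))\<close>, uniform
  in \<open>R \<ge> 1\<close>. A small \<open>\<eta>\<close> bounds \<open>K\<close>, a large one
  makes it vanish, and equality in the exponent condition is covered by the same argument. Both
  explicit solutions are smooth across \<open>t = 0\<close>, so one application of Green's identity
  serves as the passage to the weak formulation.\<close>

lemma has_derivative_line:
  assumes "f differentiable (at (z + s *\<^sub>R v))"
  shows "((\<lambda>s. f (z + s *\<^sub>R v)) has_real_derivative partial_deriv v f (z + s *\<^sub>R v)) (at s)"
proof -
  let ?w = "z + s *\<^sub>R v"
  from assms obtain f' where f': "(f has_derivative f') (at ?w)"
    by (auto simp: differentiable_def)
  have lin: "f' (c *\<^sub>R v) = c * f' v" for c
    using has_derivative_linear[OF f'] by (simp add: linear_cmul)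
  \<comment> \<open>\<open>gen\<close> is used twice: on the given line at parameter
    \<open>s\<close>, and on the line based at \<open>?w\<close> at parameter 0, which is the one in
    the definition of \<open>partial_deriv\<close>.\<close>
  have gen: "((\<lambda>s. f (y + s *\<^sub>R v)) has_real_derivative f' v) (at a)"
    if "y + a *\<^sub>R v = ?w" for y a
  proof -
    have "((\<lambda>s. f (y + s *\<^sub>R v)) has_derivative (\<lambda>h. f' (h *\<^sub>R v))) (at a)"
      by (rule has_derivative_compose[where g = f and f = "\<lambda>s. y + s *\<^sub>R v", unfolded that])
        (use f' that in \<open>auto intro!: derivative_eq_intros\<close>)
    then show ?thesis
      by (simp add: has_field_derivative_def lin mult_commute_abs)
  qed
  have "partial_deriv v f ?w = f' v"
    unfolding partial_deriv_def by (rule DERIV_imp_deriv, rule gen) simp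
  with gen[of z s] show ?thesis by simp
qed

lemma partial_derivI:
  "((\<lambda>s. f (z + s *\<^sub>R v)) has_real_derivative D) (at 0) \<Longrightarrow> partial_deriv v f z = D"
  unfolding partial_deriv_def by (rule DERIV_imp_deriv)

lemma has_partial_deriv:
  "f differentiable (at z) \<Longrightarrow>
    ((\<lambda>s. f (z + s *\<^sub>R v)) has_real_derivative partial_deriv v f z) (at 0)"
  using has_derivative_line[of f z 0 v] by simp

lemma partial_deriv_add:
  assumes "f differentiable (at z)" "g differentiable (at z)"
  shows "partial_deriv v (\<lambda>z. f z + g z) z = partial_deriv v f z + partial_deriv v g z"
  by (rule partial_derivI) (intro DERIV_add has_partial_deriv assms)

lemma partial_deriv_diff:
  assumes "f differentiable (at z)" "g differentiable (at z)"
  shows "partial_deriv v (\<lambda>z. f z - g z) z = partial_deriv v f z - partial_deriv v g z"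
  by (rule partial_derivI) (intro DERIV_diff has_partial_deriv assms)

lemma partial_deriv_mult:
  assumes "f differentiable (at z)" "g differentiable (at z)"
  shows "partial_deriv v (\<lambda>z. f z * g z) z = partial_deriv v f z * g z + f z * partial_deriv v g z"
  by (rule partial_derivI)
    (use DERIV_mult[OF has_partial_deriv[OF assms(1)] has_partial_deriv[OF assms(2)]] in
      \<open>simp add: algebra_simps\<close>)

lemma partial_deriv_compose:
  assumes "Q differentiable (at z)" "(g has_real_derivative g') (at (Q z))"
  shows "partial_deriv v (\<lambda>z. g (Q z)) z = g' * partial_deriv v Q z"
proof (rule partial_derivI)
  show "((\<lambda>s. g (Q (z + s *\<^sub>R v))) has_real_derivative g' * partial_deriv v Q z) (at 0)"
    using DERIV_chain2[of g g' "\<lambda>s. Q (z + s *\<^sub>R v)" 0, OF _ has_partial_deriv[OF assms(1)]]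
      assms(2) by simp
qed

lemma partial_deriv_const [simp]: "partial_deriv v (\<lambda>z. c) = (\<lambda>z. 0)"
  by (intro ext partial_derivI) (auto intro!: derivative_eq_intros)

lemma C_k_on_subset: "C_k_on k S f \<Longrightarrow> T \<subseteq> S \<Longrightarrow> C_k_on k T f"
  by (induction k arbitrary: f) (auto intro: continuous_on_subset differentiable_on_subset)

lemma C_k_on_SucD: "C_k_on (Suc k) S f \<Longrightarrow> C_k_on k S f"
proof (induction k arbitrary: f)
  case 0 then show ?case by (auto intro: differentiable_imp_continuous_on)
next
  case (Suc k)
  then show ?case unfolding C_k_on.simps(2)[of "Suc k"] by (auto simp: Suc.IH)
qed

definition smooth :: "('a::euclidean_space \<Rightarrow> real) \<Rightarrow> bool" where
  "smooth f \<longleftrightarrow> (\<forall>k. C_k_on k UNIV f)"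

lemma smoothI:
  assumes "f differentiable_on UNIV" "\<And>b. b \<in> Basis \<Longrightarrow> smooth (partial_deriv b f)"
  shows "smooth f"
  unfolding smooth_def
proof
  fix k show "C_k_on k UNIV f"
    using assms by (cases k) (auto simp: smooth_def differentiable_imp_continuous_on)
qed

lemma smooth_differentiable_on: "smooth f \<Longrightarrow> f differentiable_on UNIV"
  unfolding smooth_def by (auto dest: spec[of _ "Suc 0"])

lemma smooth_differentiable: "smooth f \<Longrightarrow> f differentiable (at z)"
  using smooth_differentiable_on[of f] by (simp add: differentiable_on_def)

lemma smooth_partial: "smooth f \<Longrightarrow> b \<in> Basis \<Longrightarrow> smooth (partial_deriv b f)"
  unfolding smooth_def by (metis C_k_on.simps(2))

lemma smooth_continuous: "smooth f \<Longrightarrow> continuous_on S f"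
  by (meson continuous_on_subset differentiable_imp_continuous_on smooth_differentiable_on subset_UNIV)

lemma C_k_on_add:
  "C_k_on k UNIV f \<Longrightarrow> C_k_on k UNIV g \<Longrightarrow> C_k_on k UNIV (\<lambda>z. f z + g z)"
proof (induction k arbitrary: f g)
  case 0 then show ?case by (auto intro: continuous_intros)
next
  case (Suc k)
  then have "partial_deriv b (\<lambda>z. f z + g z) = (\<lambda>z. partial_deriv b f z + partial_deriv b g z)" for b
    by (intro ext partial_deriv_add) (auto simp: differentiable_on_def)
  with Suc show ?case by (auto intro!: derivative_intros differentiable_on_add)
qed

lemma C_k_on_mult:
  "C_k_on k UNIV f \<Longrightarrow> C_k_on k UNIV g \<Longrightarrow> C_k_on k UNIV (\<lambda>z. f z * g z)"
proof (induction k arbitrary: f g)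
  case 0 then show ?case by (auto intro: continuous_intros)
next
  case (Suc k)
  then have eq: "partial_deriv b (\<lambda>z. f z * g z) =
      (\<lambda>z. partial_deriv b f z * g z + f z * partial_deriv b g z)" for b
    by (intro ext partial_deriv_mult) (auto simp: differentiable_on_def)
  have "C_k_on k UNIV f" "C_k_on k UNIV g" using Suc.prems by (auto intro: C_k_on_SucD)
  with Suc show ?case
    by (auto simp: eq differentiable_on_def intro!: C_k_on_add Suc.IH differentiable_mult)
qed

lemma smooth_const: "smooth (\<lambda>z. c)"
proof -
  have "C_k_on k UNIV (\<lambda>z::'a. c)" for k c by (induction k arbitrary: c) auto
  then show ?thesis by (simp add: smooth_def)
qed

lemma smooth_add: "smooth f \<Longrightarrow> smooth g \<Longrightarrow> smooth (\<lambda>z. f z + g z)"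
  by (simp add: smooth_def C_k_on_add)

lemma smooth_mult: "smooth f \<Longrightarrow> smooth g \<Longrightarrow> smooth (\<lambda>z. f z * g z)"
  by (simp add: smooth_def C_k_on_mult)

lemma smooth_diff: "smooth f \<Longrightarrow> smooth g \<Longrightarrow> smooth (\<lambda>z. f z - g z)"
  using smooth_add[OF _ smooth_mult[OF smooth_const[of "-1"]]] by fastforce

lemma smooth_sum: "finite I \<Longrightarrow> (\<And>i. i \<in> I \<Longrightarrow> smooth (f i)) \<Longrightarrow> smooth (\<lambda>z. \<Sum>i\<in>I. f i z)"
  by (induction I rule: finite_induct) (auto intro: smooth_const smooth_add)

lemma smooth_inner: "smooth (\<lambda>z. z \<bullet> c)"
proof (rule smoothI)
  show "(\<lambda>z. z \<bullet> c) differentiable_on UNIV"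
    by (auto simp: differentiable_on_def)
  have "partial_deriv b (\<lambda>z. z \<bullet> c) = (\<lambda>z. b \<bullet> c)" for b
    by (intro ext partial_derivI) (auto intro!: derivative_eq_intros simp: inner_left_distrib)
  then show "smooth (partial_deriv b (\<lambda>z. z \<bullet> c))" for b
    by (simp add: smooth_const)
qed

text \<open>An invariant replaces the iterated chain rule: \<open>F\<close> is closed under
  differentiation along the range of \<open>Q\<close>, so the first derivatives are again members of
  \<open>F\<close> composed with \<open>Q\<close>, times derivatives of \<open>Q\<close>. Real
  powers on the positive axis, \<open>exp\<close> and the family \<open>flat\<close> are of this
  kind.\<close>

lemma smooth_compose:
  assumes Q: "smooth Q" and g: "g \<in> F"
    and F: "\<And>g. g \<in> F \<Longrightarrow> \<exists>g'\<in>F. \<forall>z. (g has_real_derivative g' (Q z)) (at (Q z))"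
  shows "smooth (\<lambda>z. g (Q z))"
proof -
  have diff: "(\<lambda>z. g (Q z)) differentiable_on UNIV" if "g \<in> F" for g
    unfolding differentiable_on_def
  proof
    fix z
    from F[OF that] obtain g' where "(g has_real_derivative g' (Q z)) (at (Q z))" by blast
    then show "(\<lambda>z. g (Q z)) differentiable (at z)"
      using differentiable_chain_at[of Q z g] smooth_differentiable[OF Q, of z]
      by (auto simp: o_def real_differentiable_def)
  qed
  have "C_k_on k UNIV (\<lambda>z. g (Q z))" if "g \<in> F" for k g
    using that
  proof (induction k arbitrary: g)
    case 0 then show ?case using diff by (auto intro: differentiable_imp_continuous_on)
  next
    case (Suc k)
    from F[OF Suc.prems] obtain g' where g': "g' \<in> F"
      "\<And>z. (g has_real_derivative g' (Q z)) (at (Q z))" by blast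
    have "partial_deriv b (\<lambda>z. g (Q z)) = (\<lambda>z. g' (Q z) * partial_deriv b Q z)" for b
      by (intro ext partial_deriv_compose smooth_differentiable Q g')
    then show ?case
      using diff[OF Suc.prems] Suc.IH[OF g'(1)] smooth_partial[OF Q]
      by (auto intro!: C_k_on_mult simp: smooth_def)
  qed
  with g show ?thesis by (simp add: smooth_def)
qed

lemma smooth_powr:
  assumes "smooth Q" "\<And>z. Q z > 0"
  shows "smooth (\<lambda>z. Q z powr a)"
proof -
  have "smooth (\<lambda>z. (\<lambda>x. x powr a) (Q z))"
  proof (rule smooth_compose[OF assms(1), where F = "{\<lambda>x. c * x powr a | c a. True}"])
    show "(\<lambda>x. x powr a) \<in> {\<lambda>x. c * x powr a | c a. True}"
      by (intro CollectI exI[of _ 1] exI[of _ a]) simp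
    fix g :: "real \<Rightarrow> real" assume "g \<in> {\<lambda>x. c * x powr a | c a. True}"
    then obtain c a where g: "g = (\<lambda>x. c * x powr a)" by auto
    have "(g has_real_derivative c * a * Q z powr (a - 1)) (at (Q z))" for z
      unfolding g using assms(2)[of z] by (auto intro!: derivative_eq_intros)
    then show "\<exists>g'\<in>{\<lambda>x. c * x powr a | c a. True}. \<forall>z. (g has_real_derivative g' (Q z)) (at (Q z))"
      by (intro bexI[of _ "\<lambda>x. (c * a) * x powr (a - 1)"]) auto
  qed
  then show ?thesis .
qed

lemma partial_deriv_cmult:
  "smooth f \<Longrightarrow> partial_deriv v (\<lambda>z. c * f z) z = c * partial_deriv v f z"
  using partial_deriv_mult[OF smooth_differentiable[OF smooth_const] smooth_differentiable, of f v c z]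
  by simp

lemma smooth_exp: "smooth Q \<Longrightarrow> smooth (\<lambda>z. exp (Q z))"
  using smooth_compose[of Q exp "{exp}"] DERIV_exp by fastforce

lemma smooth_scale:
  assumes "smooth f"
  shows "smooth (\<lambda>z. f (c *\<^sub>R z))"
    and "partial_deriv v (\<lambda>z. f (c *\<^sub>R z)) = (\<lambda>z. c * partial_deriv v f (c *\<^sub>R z))"
proof -
  \<comment> \<open>Stated for functions that are only differentiable, because the induction below
    applies it to functions of finite order of smoothness.\<close>
  have pd: "partial_deriv v (\<lambda>z. f (c *\<^sub>R z)) = (\<lambda>z. c * partial_deriv v f (c *\<^sub>R z))"
    if "f differentiable_on UNIV" for f :: "'a \<Rightarrow> real" and v
  proof (intro ext partial_derivI)
    fix z
    have "f differentiable (at (c *\<^sub>R z))" using that by (simp add: differentiable_on_def)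
    then have "((\<lambda>s. f (c *\<^sub>R z + s *\<^sub>R v)) has_real_derivative partial_deriv v f (c *\<^sub>R z)) (at (c * 0))"
      using has_partial_deriv by simp
    moreover have "((\<lambda>s. c * s) has_real_derivative c) (at 0)"
      by (auto intro!: derivative_eq_intros)
    ultimately have "((\<lambda>s. f (c *\<^sub>R z + (c * s) *\<^sub>R v)) has_real_derivative
        partial_deriv v f (c *\<^sub>R z) * c) (at 0)"
      by (rule DERIV_chain2)
    then show "((\<lambda>s. f (c *\<^sub>R (z + s *\<^sub>R v))) has_real_derivative c * partial_deriv v f (c *\<^sub>R z)) (at 0)"
      by (simp add: scaleR_add_right mult.commute)
  qed
  have "C_k_on k UNIV (\<lambda>z. f (c *\<^sub>R z))" if "C_k_on k UNIV f" for k and f :: "'a \<Rightarrow> real"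
    using that
  proof (induction k arbitrary: f)
    case 0 then show ?case
      by (auto intro!: continuous_on_compose2[of UNIV f UNIV "\<lambda>z. c *\<^sub>R z"] continuous_intros)
  next
    case (Suc k)
    have "(\<lambda>z. f (c *\<^sub>R z)) differentiable_on UNIV"
      using Suc.prems differentiable_compose[of f "\<lambda>z. c *\<^sub>R z"] by (auto simp: differentiable_on_def)
    then show ?case using Suc
      using smooth_const[of c] by (auto simp: pd smooth_def intro!: C_k_on_mult)
  qed
  then show "smooth (\<lambda>z. f (c *\<^sub>R z))" using assms by (simp add: smooth_def)
  show "partial_deriv v (\<lambda>z. f (c *\<^sub>R z)) = (\<lambda>z. c * partial_deriv v f (c *\<^sub>R z))"
    using pd smooth_differentiable_on[OF assms] by blast
qed

section \<open>Green's identity and smooth solutions\<close>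

lemma integrable_compact_support:
  fixes f :: "'a::euclidean_space \<Rightarrow> real"
  assumes "continuous_on UNIV f" "\<And>z. norm z > r \<Longrightarrow> f z = 0"
  shows "integrable lborel f" and "integrable lebesgue f"
proof -
  have "integrable lborel (\<lambda>z. indicator (cball 0 r) z *\<^sub>R f z)"
    by (rule borel_integrable_compact) (use assms in \<open>auto intro: continuous_on_subset\<close>)
  moreover have "(\<lambda>z. indicator (cball 0 r) z *\<^sub>R f z) = f"
    using assms(2) by (auto simp: fun_eq_iff indicator_def not_le)
  ultimately show "integrable lborel f" by simp
  then show "integrable lebesgue f"
    by (subst integrable_completion) (use assms in \<open>auto intro: borel_measurable_continuous_onI\<close>)
qed

lemma upper_half_sets [measurable]: "upper_half \<in> sets borel"
  unfolding upper_half_def by (intro borel_open open_Times) auto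

lemma indicator_upper_half [simp]: "indicator upper_half (x, t) = (indicator {0<..} t :: real)"
  by (auto simp: upper_half_def indicator_def)

lemma LINT_upper_half:
  fixes f :: "'a::euclidean_space \<times> real \<Rightarrow> real"
  assumes "f \<in> borel_measurable borel"
  shows "(LINT z:upper_half|lebesgue. f z) = (LINT z|lborel. indicator upper_half z * f z)"
proof -
  have "(\<lambda>z. indicator upper_half z *\<^sub>R f z) \<in> borel_measurable lborel"
    using assms by (intro borel_measurable_scaleR borel_measurable_indicator) auto
  then show ?thesis
    unfolding set_lebesgue_integral_def by (subst integral_completion) auto
qed

lemma integrable_upper_half:
  fixes f :: "'a::euclidean_space \<times> real \<Rightarrow> real"
  shows "integrable lborel f \<Longrightarrow> integrable lborel (\<lambda>z. indicator upper_half z * f z)"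
  using integrable_mult_indicator[of upper_half lborel f] by simp

lemma partial_deriv_locally_const:
  assumes "open S" "z \<in> S" "\<And>w. w \<in> S \<Longrightarrow> f w = c"
  shows "partial_deriv v f z = 0"
proof (rule partial_derivI)
  have "((\<lambda>s. z + s *\<^sub>R v) \<longlongrightarrow> z + 0 *\<^sub>R v) (nhds 0)"
    by (intro tendsto_intros filterlim_ident)
  then have "eventually (\<lambda>s. z + s *\<^sub>R v \<in> S) (nhds 0)"
    using assms(1,2) by (auto dest: topological_tendstoD)
  then have "eventually (\<lambda>s. f (z + s *\<^sub>R v) = c) (nhds 0)"
    by eventually_elim (rule assms(3))
  then show "((\<lambda>s. f (z + s *\<^sub>R v)) has_real_derivative 0) (at 0)"
    by (subst DERIV_cong_ev[where g = "\<lambda>s. c"]) auto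
qed

lemma partial_deriv_zero:
  assumes "\<And>z. norm z > r \<Longrightarrow> f z = 0" "norm z > r"
  shows "partial_deriv v f z = 0"
  by (rule partial_deriv_locally_const[where S = "{z. norm z > r}"])
    (use assms in \<open>auto intro!: open_Collect_less continuous_intros\<close>)

text \<open>The half-space is invariant under horizontal translations, so the integrals of the
  difference quotients of \<open>g\<close> vanish.\<close>

lemma integral_horizontal_derivative:
  fixes g :: "'a::euclidean_space \<times> real \<Rightarrow> real"
  assumes diff: "\<And>z. g differentiable (at z)"
    and cont: "continuous_on UNIV (partial_deriv (b, 0) g)"
    and supp: "\<And>z. norm z > r \<Longrightarrow> g z = 0"
  shows "(LINT z|lborel. indicator upper_half z * partial_deriv (b, 0) g z) = 0"
proof -
  define v :: "'a \<times> real" where "v = (b, 0)"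
  define s where "s n = 1 / real (Suc n)" for n
  have s: "0 < s n" "s n \<le> 1" for n by (auto simp: s_def)
  have g_cont: "continuous_on UNIV g"
    using diff by (auto intro!: differentiable_imp_continuous_on simp: differentiable_on_def)
  have [measurable]: "g \<in> borel_measurable borel" "partial_deriv v g \<in> borel_measurable borel"
    using g_cont cont by (auto intro: borel_measurable_continuous_onI simp: v_def)
  have int_g: "integrable lborel (\<lambda>z. indicator upper_half z * g z)"
    by (intro integrable_upper_half integrable_compact_support(1)[OF g_cont supp])
  let ?G = "\<lambda>z. indicator upper_half z * g z"
  have shift: "integrable lborel (\<lambda>z. indicator upper_half z * g (z + c *\<^sub>R v))"
    "(LINT z|lborel. indicator upper_half z * g (z + c *\<^sub>R v)) = (LINT z|lborel. ?G z)" for c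
  proof -
    have eq: "(\<lambda>z. indicator upper_half z * g (z + c *\<^sub>R v)) = (\<lambda>z. ?G (c *\<^sub>R v + z))"
      by (auto simp: fun_eq_iff v_def indicator_def upper_half_def add.commute)
    have "integrable (distr lborel borel ((+) (c *\<^sub>R v))) ?G"
      using int_g by (simp add: lborel_distr_plus)
    then show "integrable lborel (\<lambda>z. indicator upper_half z * g (z + c *\<^sub>R v))"
      unfolding eq by (subst (asm) integrable_distr_eq) auto
    have "(LINT z|lborel. ?G z) = (LINT z|distr lborel borel ((+) (c *\<^sub>R v)). ?G z)"
      by (simp add: lborel_distr_plus)
    also have "\<dots> = (LINT z|lborel. ?G (c *\<^sub>R v + z))"
      by (subst integral_distr) auto
    finally show "(LINT z|lborel. indicator upper_half z * g (z + c *\<^sub>R v)) = (LINT z|lborel. ?G z)"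
      by (simp add: eq)
  qed
  define D where "D n z = indicator upper_half z * ((g (z + s n *\<^sub>R v) - g z) / s n)" for n z
  have D_eq: "D n = (\<lambda>z. (indicator upper_half z * g (z + s n *\<^sub>R v) - ?G z) / s n)" for n
    by (auto simp: D_def fun_eq_iff right_diff_distrib diff_divide_distrib)
  have D_int: "integral\<^sup>L lborel (D n) = 0" for n
    unfolding D_eq using shift[of "s n"] int_g by simp
  \<comment> \<open>The mean value theorem evaluates the derivative at a point within
    \<open>norm v\<close> of \<open>z\<close>. If \<open>norm z > r + norm v\<close>, both values in
    the quotient vanish, so the derivative has to be bounded up to radius
    \<open>r + 2 * norm v\<close> only.\<close>
  have "compact (partial_deriv v g ` cball 0 (r + 2 * norm v))"
    by (intro compact_continuous_image continuous_on_subset[OF cont[folded v_def]]) auto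
  then have "bounded (partial_deriv v g ` cball 0 (r + 2 * norm v))"
    by (rule compact_imp_bounded)
  then obtain B where "\<forall>z\<in>cball 0 (r + 2 * norm v). \<bar>partial_deriv v g z\<bar> \<le> B"
    by (auto simp: bounded_iff)
  then have B: "\<bar>partial_deriv v g z\<bar> \<le> B" if "norm z \<le> r + 2 * norm v" for z
    using that by auto
  have D_bound: "norm (D n z) \<le> indicator (cball 0 (r + norm v)) z * B" for n z
  proof (cases "norm z \<le> r + norm v")
    case True
    have "\<exists>c. 0 < c \<and> c < s n \<and>
        g (z + s n *\<^sub>R v) - g (z + 0 *\<^sub>R v) = (s n - 0) * partial_deriv v g (z + c *\<^sub>R v)"
      by (rule MVT2[OF s(1)]) (rule has_derivative_line[OF diff])
    then obtain c where c: "0 < c" "c < s n"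
      "g (z + s n *\<^sub>R v) - g z = s n * partial_deriv v g (z + c *\<^sub>R v)" by auto
    have "norm (z + c *\<^sub>R v) \<le> norm z + c * norm v"
      using c(1) norm_triangle_ineq[of z "c *\<^sub>R v"] by simp
    also have "c * norm v \<le> 1 * norm v"
      using c s[of n] by (intro mult_right_mono) auto
    finally have "\<bar>partial_deriv v g (z + c *\<^sub>R v)\<bar> \<le> B"
      using True by (intro B) auto
    then show ?thesis
      using True c s[of n] by (auto simp: D_def indicator_def)
  next
    case False
    have "norm (s n *\<^sub>R v) \<le> 1 * norm v"
      using s[of n] by (simp add: mult_left_le_one_le)
    then have "norm (z + s n *\<^sub>R v) > r"
      using False norm_diff_ineq[of z "s n *\<^sub>R v"] by linarith
    moreover have "norm z > r" using False norm_ge_zero[of v] by linarith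
    ultimately show ?thesis using False by (simp add: D_def supp)
  qed
  have lim: "(\<lambda>n. D n z) \<longlonglongrightarrow> indicator upper_half z * partial_deriv v g z" for z
  proof -
    have "(\<lambda>h. (g (z + h *\<^sub>R v) - g z) / h) \<midarrow>0\<rightarrow> partial_deriv v g z"
      using has_partial_deriv[OF diff, of z v] by (simp add: DERIV_def)
    moreover have "filterlim s (at 0) sequentially"
      using LIMSEQ_inverse_real_of_nat unfolding s_def
      by (auto simp: filterlim_at inverse_eq_divide intro!: always_eventually)
    ultimately have "(\<lambda>n. (g (z + s n *\<^sub>R v) - g z) / s n) \<longlonglongrightarrow> partial_deriv v g z"
      by (rule filterlim_compose)
    then show ?thesis unfolding D_def by (intro tendsto_intros)
  qed
  have "(\<lambda>n. integral\<^sup>L lborel (D n)) \<longlonglongrightarrow> (LINT z|lborel. indicator upper_half z * partial_deriv v g z)"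
  proof (rule integral_dominated_convergence[where w = "\<lambda>z. indicator (cball 0 (r + norm v)) z * B"])
    show "D n \<in> borel_measurable lborel" for n unfolding D_def by measurable
    show "integrable lborel (\<lambda>z. indicator (cball 0 (r + norm v)) z * B)"
      by (intro integrable_mult_left integrable_real_indicator emeasure_compact_finite) auto
  qed (use lim D_bound in auto)
  then have "(LINT z|lborel. indicator upper_half z * partial_deriv v g z) = 0"
    by (simp add: D_int LIMSEQ_const_iff)
  then show ?thesis by (simp add: v_def)
qed

text \<open>Fubini reduces this to the fundamental theorem of calculus on each vertical half-line,
  where compact support leaves only the value at \<open>t = 0\<close>.\<close>

lemma integral_vertical_derivative:
  fixes g :: "'a::euclidean_space \<times> real \<Rightarrow> real"
  assumes diff: "\<And>z. g differentiable (at z)"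
    and cont: "continuous_on UNIV (partial_deriv (0, 1) g)"
    and supp: "\<And>z. norm z > r \<Longrightarrow> g z = 0"
  shows "(LINT z|lborel. indicator upper_half z * partial_deriv (0, 1) g z) = - (LINT x|lborel. g (x, 0))"
proof -
  let ?h = "partial_deriv (0, 1) g"
  have [measurable]: "?h \<in> borel_measurable borel"
    using cont by (auto intro: borel_measurable_continuous_onI)
  have "integrable lborel (\<lambda>z. ?h z * indicator upper_half z)"
    by (rule integrable_real_mult_indicator[OF _ integrable_compact_support(1)[OF cont partial_deriv_zero[OF supp]]]) auto
  then have int: "integrable (lborel \<Otimes>\<^sub>M lborel) (\<lambda>z. ?h z * indicator upper_half z)"
    by (simp add: lborel_prod)
  have inner: "(LINT t|lborel. ?h (x, t) * indicator {0<..} t) = - g (x, 0)" for x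
  proof -
    define T where "T = \<bar>r\<bar> + 1"
    have big: "norm (x, t) > r" if "t \<ge> T" for t
      using that norm_snd_le[of t x] by (auto simp: T_def)
    have zero: "?h (x, t) = 0" if "t \<ge> T" for t
      by (rule partial_deriv_zero[OF supp big[OF that]])
    have line: "((\<lambda>t. g (x, t)) has_real_derivative ?h (x, t)) (at t)" for t
      using has_derivative_line[of g "(x, 0)" t "(0, 1)"] diff by simp
    have hc: "continuous_on UNIV (\<lambda>t. ?h (x, t))"
      by (rule continuous_on_compose2[OF cont]) (auto intro!: continuous_intros)
    \<comment> \<open>The two indicators differ at the null point 0 and beyond \<open>T\<close>,
      where the derivative vanishes.\<close>
    have "(LINT t|lborel. ?h (x, t) * indicator {0<..} t) = (LINT t|lborel. ?h (x, t) * indicator {0..T} t)"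
    proof (rule integral_cong_AE)
      show "AE t in lborel. ?h (x, t) * indicator {0<..} t = ?h (x, t) * indicator {0..T} t"
        using AE_lborel_singleton[of "0::real"]
      proof eventually_elim
        case (elim t)
        then show ?case
          using zero[of t] by (auto simp: indicator_def)
      qed
    qed (use hc in \<open>auto intro!: borel_measurable_times borel_measurable_continuous_onI\<close>)
    also have "\<dots> = g (x, T) - g (x, 0)"
      by (rule integral_FTC_Icc_real)
        (use line hc in \<open>auto simp: T_def continuous_on_eq_continuous_at\<close>)
    also have "g (x, T) = 0" by (rule supp[OF big]) simp
    finally show ?thesis by simp
  qed
  have "(LINT z|lborel. ?h z * indicator upper_half z)
      = (LINT x|lborel. LINT t|lborel. ?h (x, t) * indicator upper_half (x, t))"
    using lborel_pair.integral_fst'[OF int] by (simp add: lborel_prod)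
  also have "\<dots> = - (LINT x|lborel. g (x, 0))"
    by (simp add: inner)
  finally show ?thesis by (simp add: mult.commute)
qed

lemma Basis_pair: "b \<in> Basis \<Longrightarrow> (b, 0) \<in> Basis" "(0, 1::real) \<in> Basis"
  by (auto simp: Basis_prod_def)

lemma smooth_wave_operator:
  fixes f :: "'a::euclidean_space \<times> real \<Rightarrow> real"
  shows "smooth f \<Longrightarrow> smooth (wave_operator f)"
  unfolding wave_operator_def[abs_def] time_deriv_def laplacian_def[abs_def]
  by (intro smooth_diff smooth_sum smooth_partial Basis_pair) auto

lemma smooth_time_deriv:
  fixes f :: "'a::euclidean_space \<times> real \<Rightarrow> real"
  shows "smooth f \<Longrightarrow> smooth (time_deriv f)"
  unfolding time_deriv_def by (intro smooth_partial Basis_pair)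

lemma wave_operator_zero:
  assumes "\<And>z. norm z > r \<Longrightarrow> f z = 0" "norm z > r"
  shows "wave_operator f z = 0"
  unfolding wave_operator_def time_deriv_def laplacian_def
  by (simp add: partial_deriv_zero[OF partial_deriv_zero[OF assms(1)] assms(2)])

lemma test_function_smooth: "test_function \<phi> \<Longrightarrow> smooth \<phi>"
  by (simp add: test_function_def smooth_def)

lemma test_function_support:
  assumes "test_function \<phi>"
  obtains r where "\<And>z. norm z > r \<Longrightarrow> \<phi> z = 0"
proof -
  have "bounded (closure {z. \<phi> z \<noteq> 0})"
    using assms by (auto simp: test_function_def compact_imp_bounded)
  then obtain r where "\<And>z. z \<in> closure {z. \<phi> z \<noteq> 0} \<Longrightarrow> norm z \<le> r"
    by (auto simp: bounded_iff)
  then have "\<And>z. \<phi> z \<noteq> 0 \<Longrightarrow> norm z \<le> r"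
    using closure_subset[of "{z. \<phi> z \<noteq> 0}"] by blast
  then show ?thesis by (intro that[of r]) (meson not_le)
qed

text \<open>For each coordinate direction \<open>v\<close>, the product of \<open>u\<close> with the
  second derivative of \<open>\<phi>\<close> minus the product of \<open>\<phi>\<close> with that of
  \<open>u\<close> is the \<open>v\<close>-derivative of \<open>g v\<close>. Horizontal derivatives
  integrate to zero over the half-space; the vertical one leaves the traces at \<open>t = 0\<close>,
  which become the initial data terms of the weak formulation.\<close>

lemma wave_green:
  fixes u \<phi> :: "'a::euclidean_space \<times> real \<Rightarrow> real"
  assumes u: "smooth u" and \<phi>: "smooth \<phi>" and supp: "\<And>z. norm z > r \<Longrightarrow> \<phi> z = 0"
  shows "(LINT z|lborel. indicator upper_half z * (u z * wave_operator \<phi> z))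
    = (LINT z|lborel. indicator upper_half z * (\<phi> z * wave_operator u z))
      + (LINT x|lborel. time_deriv u (x, 0) * \<phi> (x, 0)) - (LINT x|lborel. u (x, 0) * time_deriv \<phi> (x, 0))"
proof -
  define g where "g v z = u z * partial_deriv v \<phi> z - \<phi> z * partial_deriv v u z" for v z
  let ?dg = "\<lambda>v z. partial_deriv v (g v) z"
  let ?U = "\<lambda>z. indicator upper_half z :: real"
  have g_smooth: "smooth (g v)" if "v \<in> Basis" for v
    unfolding g_def[abs_def] using that by (intro smooth_diff smooth_mult smooth_partial u \<phi>)
  have g_supp: "g v z = 0" if "norm z > r" for v z
    using supp[OF that] partial_deriv_zero[OF supp that] by (simp add: g_def)
  have dg: "?dg v z = u z * partial_deriv v (partial_deriv v \<phi>) z - \<phi> z * partial_deriv v (partial_deriv v u) z"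
    if "v \<in> Basis" for v z
  proof -
    note d = smooth_differentiable[OF u] smooth_differentiable[OF \<phi>]
      smooth_differentiable[OF smooth_partial[OF u that]] smooth_differentiable[OF smooth_partial[OF \<phi> that]]
    show ?thesis
      unfolding g_def[abs_def]
      by (subst partial_deriv_diff) (auto simp: partial_deriv_mult d intro!: differentiable_mult)
  qed
  have cont: "continuous_on UNIV (?dg v)" if "v \<in> Basis" for v
    by (intro smooth_continuous smooth_partial g_smooth that)
  have dg_int: "integrable lborel (\<lambda>z. ?U z * ?dg v z)" if "v \<in> Basis" for v
    using integrable_compact_support(1)[OF cont partial_deriv_zero[OF g_supp]] that
    by (intro integrable_upper_half) auto
  have w_int: "integrable lborel (\<lambda>z. ?U z * (\<phi> z * wave_operator u z))"
    by (intro integrable_upper_half integrable_compact_support(1)[where r = r])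
      (auto simp: supp intro!: smooth_continuous smooth_mult smooth_wave_operator u \<phi>)
  have pt: "u z * wave_operator \<phi> z = \<phi> z * wave_operator u z + ?dg (0, 1) z - (\<Sum>b\<in>Basis. ?dg (b, 0) z)" for z
    by (simp add: dg Basis_pair wave_operator_def time_deriv_def laplacian_def sum_subtractf
        sum_distrib_left algebra_simps)
  have "(LINT z|lborel. ?U z * (u z * wave_operator \<phi> z))
      = (LINT z|lborel. ?U z * (\<phi> z * wave_operator u z) + ?U z * ?dg (0, 1) z - (\<Sum>b\<in>Basis. ?U z * ?dg (b, 0) z))"
    by (simp add: pt algebra_simps sum_distrib_left)
  also have "\<dots> = (LINT z|lborel. ?U z * (\<phi> z * wave_operator u z)) + (LINT z|lborel. ?U z * ?dg (0, 1) z)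
      - (\<Sum>b\<in>Basis. LINT z|lborel. ?U z * ?dg (b, 0) z)"
    by (subst Bochner_Integration.integral_diff, intro Bochner_Integration.integrable_add w_int dg_int Basis_pair,
        intro Bochner_Integration.integrable_sum dg_int Basis_pair, assumption,
        subst Bochner_Integration.integral_add[OF w_int dg_int[OF Basis_pair(2)]],
        subst Bochner_Integration.integral_sum, intro dg_int Basis_pair, assumption, rule refl)
  also have "(\<Sum>b\<in>Basis. LINT z|lborel. ?U z * ?dg (b, 0) z) = 0"
    by (intro sum.neutral ballI integral_horizontal_derivative[where r = r])
      (auto simp: g_supp intro!: cont Basis_pair smooth_differentiable g_smooth)
  also have "(LINT z|lborel. ?U z * ?dg (0, 1) z) = - (LINT x|lborel. g (0, 1) (x, 0))"
    by (rule integral_vertical_derivative[where r = r])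
      (auto simp: g_supp intro!: cont Basis_pair smooth_differentiable g_smooth)
  also have "(LINT x|lborel. g (0, 1) (x, 0))
      = (LINT x|lborel. u (x, 0) * time_deriv \<phi> (x, 0)) - (LINT x|lborel. time_deriv u (x, 0) * \<phi> (x, 0))"
  proof -
    have trace: "integrable lborel (\<lambda>x. f (x, 0) * h (x, 0))"
      if "smooth f" "smooth h" "\<And>z. norm z > r \<Longrightarrow> h z = 0" for f h :: "'a \<times> real \<Rightarrow> real"
    proof (rule integrable_compact_support(1)[where r = r])
      show "continuous_on UNIV (\<lambda>x. f (x, 0) * h (x, 0))"
        by (intro continuous_on_mult continuous_on_compose2[OF smooth_continuous[OF that(1), of UNIV]]
            continuous_on_compose2[OF smooth_continuous[OF that(2), of UNIV]]) (auto intro!: continuous_intros)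
    qed (simp add: that(3))
    show ?thesis
      unfolding g_def time_deriv_def
      using trace[OF u smooth_partial[OF \<phi> Basis_pair(2)] partial_deriv_zero[OF supp]]
        trace[OF smooth_partial[OF u Basis_pair(2)] \<phi> supp]
      by (simp add: mult.commute)
  qed
  finally show ?thesis by simp
qed

text \<open>\<open>riesz_conv\<close> integrates over the completed measure, whereas measurability
  of a parameter integral comes from the Borel product. The integrand is Borel in \<open>y\<close>,
  so \<open>integral_completion\<close> identifies the two integrals.\<close>

lemma riesz_conv_measurable:
  fixes u :: "'a::euclidean_space \<times> real \<Rightarrow> real"
  assumes u: "continuous_on UNIV u"
  shows "riesz_conv \<alpha> p u \<in> borel_measurable borel"
proof -
  have meas: "(\<lambda>y. norm (x - y) powr (- \<alpha>) * \<bar>u (y, t)\<bar> powr p) \<in> borel_measurable lborel" for x t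
    by (intro borel_measurable_times powr_real_measurable borel_measurable_const)
      (auto intro!: borel_measurable_continuous_onI continuous_on_compose2[OF u] continuous_intros)
  have "(\<lambda>w. norm (fst (fst w) - snd w) powr (- \<alpha>) * \<bar>u (snd w, snd (fst w))\<bar> powr p)
      \<in> borel_measurable ((borel :: ('a \<times> real) measure) \<Otimes>\<^sub>M (borel :: 'a measure))"
    unfolding borel_prod
    by (intro borel_measurable_times powr_real_measurable borel_measurable_const)
      (auto intro!: borel_measurable_continuous_onI continuous_on_compose2[OF u] continuous_intros)
  also have "borel_measurable ((borel :: ('a \<times> real) measure) \<Otimes>\<^sub>M (borel :: 'a measure))
      = borel_measurable ((borel :: ('a \<times> real) measure) \<Otimes>\<^sub>M lborel)"
    by (intro measurable_cong_sets sets_pair_measure_cong) auto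
  finally have "(\<lambda>z. LINT y|lborel. norm (fst z - y) powr (- \<alpha>) * \<bar>u (y, snd z)\<bar> powr p) \<in> borel_measurable borel"
    by (intro lborel.borel_measurable_lebesgue_integral) (simp add: split_beta')
  moreover have "riesz_conv \<alpha> p u = (\<lambda>z. LINT y|lborel. norm (fst z - y) powr (- \<alpha>) * \<bar>u (y, snd z)\<bar> powr p)"
    unfolding riesz_conv_def by (auto simp: fun_eq_iff split_beta' intro!: integral_completion meas)
  ultimately show ?thesis by simp
qed

lemma riesz_conv_nonneg: "riesz_conv \<alpha> p u z \<ge> 0"
  by (auto simp: riesz_conv_def split_beta)

lemma continuous_imp_locally_integrable_on:
  fixes f :: "'a::euclidean_space \<Rightarrow> real"
  assumes "continuous_on UNIV f"
  shows "locally_integrable_on S f"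
  unfolding locally_integrable_on_def
proof (intro allI impI)
  fix K assume K: "compact K \<and> K \<subseteq> S"
  then have "integrable lborel (\<lambda>x. indicator K x *\<^sub>R f x)"
    using assms by (intro borel_integrable_compact) (auto intro: continuous_on_subset)
  then show "f absolutely_integrable_on K"
    unfolding set_integrable_def
    by (subst integrable_completion) auto
qed

lemma closed_upper_half_sets [measurable]: "closed_upper_half \<in> sets borel"
  unfolding closed_upper_half_def by (intro borel_closed closed_Times) auto

lemma upper_half_subset: "upper_half \<subseteq> closed_upper_half"
  by (auto simp: upper_half_def closed_upper_half_def)

text \<open>The pointwise inequality also controls the local integrability of the nonlinear term.\<close>

lemma smooth_weak_solution:
  fixes u :: "'a::euclidean_space \<times> real \<Rightarrow> real"
  assumes u: "smooth u" and p: "p > 0" and q: "q > 0"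
    and fin: "\<And>z. z \<in> closed_upper_half \<Longrightarrow> riesz_conv_finite \<alpha> p u z"
    and ineq: "\<And>z. z \<in> closed_upper_half \<Longrightarrow> riesz_conv \<alpha> p u z * \<bar>u z\<bar> powr q \<le> wave_operator u z"
  shows "weak_solution \<alpha> p q (\<lambda>x. u (x, 0)) (\<lambda>x. time_deriv u (x, 0)) u"
proof -
  let ?N = "\<lambda>z. riesz_conv \<alpha> p u z * \<bar>u z\<bar> powr q"
  have cu: "continuous_on UNIV u" and cw: "continuous_on UNIV (wave_operator u)"
    and cut: "continuous_on UNIV (time_deriv u)"
    by (intro smooth_continuous u smooth_wave_operator smooth_time_deriv)+
  have trace: "continuous_on UNIV (\<lambda>x::'a. f (x, 0::real))" if "continuous_on UNIV f" for f :: "'a \<times> real \<Rightarrow> real"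
    by (rule continuous_on_compose2[OF that]) (auto intro!: continuous_intros)
  have N_meas [measurable]: "?N \<in> borel_measurable borel"
    using riesz_conv_measurable[OF cu] borel_measurable_continuous_onI[OF cu]
    by (intro borel_measurable_times powr_real_measurable borel_measurable_const borel_measurable_abs)
  have N_nonneg: "?N z \<ge> 0" for z by (simp add: riesz_conv_nonneg)
  have Lp: "Lp_loc_on p closed_upper_half u"
    unfolding Lp_loc_on_def
  proof
    show "u \<in> borel_measurable (lebesgue_on closed_upper_half)"
      using borel_measurable_continuous_onI[OF cu]
      by (intro measurable_restrict_space1 measurable_completion) auto
    show "locally_integrable_on closed_upper_half (\<lambda>z. \<bar>u z\<bar> powr p)"
      using p by (intro continuous_imp_locally_integrable_on continuous_on_powr' continuous_intros cu) auto
  qed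
  have N_loc: "locally_integrable_on closed_upper_half ?N"
    unfolding locally_integrable_on_def
  proof (intro allI impI)
    fix K :: "('a \<times> real) set" assume K: "compact K \<and> K \<subseteq> closed_upper_half"
    then have [measurable]: "K \<in> sets borel" by (auto intro: borel_compact)
    have "integrable lborel (\<lambda>z. indicator K z *\<^sub>R wave_operator u z)"
      using K by (intro borel_integrable_compact continuous_on_subset[OF cw]) auto
    then have "integrable lborel (\<lambda>z. indicator K z *\<^sub>R ?N z)"
    proof (rule Bochner_Integration.integrable_bound)
      have "norm (indicator K z *\<^sub>R ?N z) \<le> norm (indicator K z *\<^sub>R wave_operator u z)" for z
        using ineq[of z] N_nonneg[of z] K by (auto simp: indicator_def)
      then show "AE z in lborel. norm (indicator K z *\<^sub>R ?N z) \<le> norm (indicator K z *\<^sub>R wave_operator u z)"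
        by simp
    qed measurable
    then show "?N absolutely_integrable_on K"
      unfolding set_integrable_def by (subst integrable_completion) auto
  qed
  have "integrable lebesgue (\<lambda>x. time_deriv u (x, 0) * \<phi> (x, 0)) \<and>
        integrable lebesgue (\<lambda>x. u (x, 0) * time_deriv \<phi> (x, 0)) \<and>
        set_integrable lebesgue upper_half (\<lambda>z. u z * wave_operator \<phi> z) \<and>
        set_integrable lebesgue upper_half (\<lambda>z. ?N z * \<phi> z) \<and>
        - (LINT x|lebesgue. time_deriv u (x, 0) * \<phi> (x, 0)) + (LINT x|lebesgue. u (x, 0) * time_deriv \<phi> (x, 0))
          + (LINT z:upper_half|lebesgue. u z * wave_operator \<phi> z)
        \<ge> (LINT z:upper_half|lebesgue. ?N z * \<phi> z)"
    if test: "test_function \<phi>" and pos: "\<And>z. \<phi> z \<ge> 0" for \<phi>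
  proof -
    obtain r where supp: "\<And>z. norm z > r \<Longrightarrow> \<phi> z = 0"
      using test_function_support[OF test] by blast
    note \<phi> = test_function_smooth[OF test]
    have c\<phi>: "continuous_on UNIV \<phi>" and ct\<phi>: "continuous_on UNIV (time_deriv \<phi>)"
      and cw\<phi>: "continuous_on UNIV (wave_operator \<phi>)"
      by (intro smooth_continuous smooth_time_deriv smooth_wave_operator \<phi>)+
    have t\<phi>0: "time_deriv \<phi> z = 0" if "norm z > r" for z
      using partial_deriv_zero[OF supp that] by (simp add: time_deriv_def)
    have c1: "continuous_on UNIV (\<lambda>x. time_deriv u (x, 0) * \<phi> (x, 0))"
      and c2: "continuous_on UNIV (\<lambda>x. u (x, 0) * time_deriv \<phi> (x, 0))"
      and c3: "continuous_on UNIV (\<lambda>z. u z * wave_operator \<phi> z)"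
      and c4: "continuous_on UNIV (\<lambda>z. \<phi> z * wave_operator u z)"
      by (intro continuous_on_mult trace cu cut c\<phi> ct\<phi> cw cw\<phi>)+
    have i12: "integrable lebesgue (\<lambda>x. time_deriv u (x, 0) * \<phi> (x, 0))"
      "integrable lebesgue (\<lambda>x. u (x, 0) * time_deriv \<phi> (x, 0))"
      by (rule integrable_compact_support(2)[OF c1, where r = r], simp add: supp,
          rule integrable_compact_support(2)[OF c2, where r = r], simp add: t\<phi>0)
    have i3: "integrable lborel (\<lambda>z. indicator upper_half z * (u z * wave_operator \<phi> z))"
      by (intro integrable_upper_half integrable_compact_support(1)[OF c3, where r = r])
        (simp add: wave_operator_zero[OF supp])
    have i4: "integrable lborel (\<lambda>z. indicator upper_half z * (\<phi> z * wave_operator u z))"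
      by (intro integrable_upper_half integrable_compact_support(1)[OF c4, where r = r])
        (simp add: supp)
    have [measurable]: "\<phi> \<in> borel_measurable borel" by (rule borel_measurable_continuous_onI[OF c\<phi>])
    have le: "indicator upper_half z * (?N z * \<phi> z) \<le> indicator upper_half z * (\<phi> z * wave_operator u z)" for z
      using mult_right_mono[OF ineq pos, of z z] upper_half_subset by (auto simp: indicator_def mult.commute)
    have i5: "integrable lborel (\<lambda>z. indicator upper_half z * (?N z * \<phi> z))"
    proof (rule Bochner_Integration.integrable_bound[OF i4])
      have "norm (indicator upper_half z * (?N z * \<phi> z)) \<le> norm (indicator upper_half z * (\<phi> z * wave_operator u z))" for z
        using le[of z] N_nonneg[of z] pos[of z] by (auto simp: indicator_def)
      then show "AE z in lborel. norm (indicator upper_half z * (?N z * \<phi> z))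
          \<le> norm (indicator upper_half z * (\<phi> z * wave_operator u z))" by simp
    qed measurable
    have [measurable]: "(\<lambda>z. u z * wave_operator \<phi> z) \<in> borel_measurable borel"
      by (rule borel_measurable_continuous_onI[OF c3])
    have s: "set_integrable lebesgue upper_half (\<lambda>z. u z * wave_operator \<phi> z)"
      "set_integrable lebesgue upper_half (\<lambda>z. ?N z * \<phi> z)"
      unfolding set_integrable_def using i3 i5 by (auto simp: integrable_completion)
    have e: "(LINT x|lebesgue. time_deriv u (x, 0) * \<phi> (x, 0)) = (LINT x|lborel. time_deriv u (x, 0) * \<phi> (x, 0))"
      "(LINT x|lebesgue. u (x, 0) * time_deriv \<phi> (x, 0)) = (LINT x|lborel. u (x, 0) * time_deriv \<phi> (x, 0))"
      using borel_measurable_continuous_onI[OF c1] borel_measurable_continuous_onI[OF c2]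
      by (auto intro!: integral_completion)
    have l: "(LINT z:upper_half|lebesgue. u z * wave_operator \<phi> z)
        = (LINT z|lborel. indicator upper_half z * (u z * wave_operator \<phi> z))"
      "(LINT z:upper_half|lebesgue. ?N z * \<phi> z) = (LINT z|lborel. indicator upper_half z * (?N z * \<phi> z))"
      by (intro LINT_upper_half; measurable)+
    \<comment> \<open>By \<open>wave_green\<close> the initial data terms cancel, so the weak
      inequality is this integrated form of the pointwise one.\<close>
    have "(LINT z|lborel. indicator upper_half z * (?N z * \<phi> z))
        \<le> (LINT z|lborel. indicator upper_half z * (\<phi> z * wave_operator u z))"
      by (intro integral_mono i4 i5 le)
    then show ?thesis
      using i12 s wave_green[OF u \<phi> supp] by (simp add: e l)
  qed
  moreover have "AE z in lebesgue. z \<in> upper_half \<longrightarrow> riesz_conv_finite \<alpha> p u z"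
    using fin upper_half_subset by (intro AE_I2) auto
  ultimately show ?thesis
    unfolding weak_solution_def
    using Lp N_loc by (auto intro!: continuous_imp_locally_integrable_on trace cu cut)
qed

lemma smooth_classical_solution:
  fixes u :: "'a::euclidean_space \<times> real \<Rightarrow> real"
  assumes u: "smooth u"
    and fin: "\<And>z. z \<in> upper_half \<Longrightarrow> riesz_conv_finite \<alpha> p u z"
    and ineq: "\<And>z. z \<in> upper_half \<Longrightarrow> riesz_conv \<alpha> p u z * \<bar>u z\<bar> powr q \<le> wave_operator u z"
  shows "classical_solution \<alpha> p q (\<lambda>x. u (x, 0)) (\<lambda>x. time_deriv u (x, 0)) u"
proof -
  have "C_k_on 2 upper_half u"
    using u C_k_on_subset[of 2 UNIV u upper_half] by (simp add: smooth_def)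
  moreover have "((\<lambda>t. u (x, t)) has_real_derivative time_deriv u (x, 0)) (at 0 within {0..})" for x
    using has_partial_deriv[OF smooth_differentiable[OF u], of "(x, 0)" "(0, 1)"]
    by (auto simp: time_deriv_def intro: has_field_derivative_at_within)
  moreover have "(time_deriv u \<longlongrightarrow> time_deriv u (x, 0)) (at (x, 0) within upper_half)" for x
    using smooth_continuous[OF smooth_time_deriv[OF u], of UNIV]
    by (meson UNIV_I continuous_on_def subset_UNIV tendsto_within_subset)
  ultimately show ?thesis
    unfolding classical_solution_def using fin ineq smooth_continuous[OF u] by auto
qed

section \<open>Riesz potentials of power weights\<close>

text \<open>Both singularities are summed over dyadic balls of radius \<open>\<rho> 2\<^sup>k\<close>.\<close>

lemma nn_integral_truncated_power:
  fixes a b :: real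
  assumes a: "0 \<le> a" "a < DIM('a)" and ab: "DIM('a) < a + b" and b: "0 \<le> b"
  obtains C where "C > 0" "\<And>\<rho>. \<rho> > 0 \<Longrightarrow>
    (\<integral>\<^sup>+z. ennreal (norm (z::'a::euclidean_space) powr (-a) * max (norm z) \<rho> powr (-b)) \<partial>lborel)
      \<le> ennreal (C * \<rho> powr (DIM('a) - a - b))"
proof -
  define N where "N = real DIM('a)"
  define V where "V = unit_ball_vol (real DIM('a))"
  have V: "V > 0" by (simp add: V_def)
  \<comment> \<open>Geometric ratios of the two dyadic sums: \<open>a < N\<close> gives
    \<open>x < 1\<close> for the balls shrinking to the origin, and \<open>a + b > N\<close> gives
    \<open>y < 1\<close> for the growing ones.\<close>
  define x where "x = 2 powr (a - N)"
  define y where "y = 2 powr (N - a - b)"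
  have x: "0 < x" "x < 1" and y: "0 < y" "y < 1"
    using a ab by (auto simp: x_def y_def N_def powr_less_one)
  define C where "C = V * (2 powr a / (1 - x) + 2 powr N / (1 - y))"
  have "C > 0" using V x y by (simp add: C_def add_pos_pos)
  moreover have "(\<integral>\<^sup>+z. ennreal (norm (z::'a) powr (-a) * max (norm z) \<rho> powr (-b)) \<partial>lborel)
      \<le> ennreal (C * \<rho> powr (N - a - b))" if \<rho>: "\<rho> > 0" for \<rho>
  proof -
    \<comment> \<open>\<open>A n\<close> bounds the integrand where \<open>norm z\<close> lies
      between \<open>\<rho> / 2 ^ (n + 1)\<close> and \<open>\<rho> / 2 ^ n\<close>, and
      \<open>B n\<close> where it lies between \<open>\<rho> * 2 ^ n\<close> and
      \<open>\<rho> * 2 ^ (n + 1)\<close>. The shells are enlarged to balls of radii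
      \<open>r n\<close> and \<open>s n\<close>.\<close>
    define A where "A n = \<rho> powr (-a-b) * 2 powr ((real n + 1) * a)" for n
    define B where "B n = \<rho> powr (-a-b) * 2 powr (- real n * (a + b))" for n
    define r where "r n = \<rho> * 2 powr (- real n)" for n
    define s where "s n = \<rho> * 2 powr (real n + 1)" for n
    have rs: "r n > 0" "s n > 0" for n using \<rho> by (auto simp: r_def s_def)
    define T where "T n z = ennreal (A n) * indicator (cball 0 (r n)) z
        + ennreal (B n) * indicator (cball 0 (s n)) z" for n and z :: 'a
    have meas: "(\<lambda>z::'a. ennreal c * indicator (cball 0 d) z) \<in> borel_measurable lborel" for c d
    proof -
      have [measurable]: "cball (0::'a) d \<in> sets borel" by (intro borel_closed closed_cball)
      show ?thesis by measurable
    qed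
    have T_int: "integral\<^sup>N lborel (T n) = ennreal (\<rho> powr (N - a - b) * V * (2 powr a * x ^ n + 2 powr N * y ^ n))" for n
    proof -
      have "integral\<^sup>N lborel (T n) = ennreal (A n) * ennreal (V * r n ^ DIM('a)) + ennreal (B n) * ennreal (V * s n ^ DIM('a))"
        unfolding T_def V_def using rs[of n]
        by (simp add: nn_integral_add[OF meas meas] nn_integral_cmult_indicator emeasure_cball)
      also have "\<dots> = ennreal (A n * (V * r n ^ DIM('a)) + B n * (V * s n ^ DIM('a)))"
        using V rs[of n] by (simp add: A_def B_def ennreal_plus ennreal_mult del: ennreal_plus[symmetric])
      also have "r n ^ DIM('a) = \<rho> powr N * 2 powr (- real n * N)"
        using \<rho> by (simp add: r_def power_mult_distrib powr_realpow[symmetric] N_def powr_power mult.commute powr_powr)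
      also have "s n ^ DIM('a) = \<rho> powr N * 2 powr ((real n + 1) * N)"
        using \<rho> by (simp add: s_def power_mult_distrib powr_realpow[symmetric] N_def powr_power mult.commute powr_powr)
      also have "A n * (V * (\<rho> powr N * 2 powr (- real n * N))) = \<rho> powr (N - a - b) * V * (2 powr a * x ^ n)"
      proof -
        have "x ^ n = 2 powr ((a - N) * n)" by (simp add: x_def powr_power mult.commute)
        moreover have "\<rho> powr (-a-b) * \<rho> powr N = \<rho> powr (N - a - b)"
          by (simp add: powr_add[symmetric] algebra_simps)
        moreover have "2 powr ((real n + 1) * a) * 2 powr (- real n * N) = 2 powr a * 2 powr ((a - N) * n)"
          by (simp add: powr_add[symmetric] algebra_simps)
        ultimately show ?thesis unfolding A_def by (metis (no_types, lifting) mult.assoc mult.left_commute)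
      qed
      also have "B n * (V * (\<rho> powr N * 2 powr ((real n + 1) * N))) = \<rho> powr (N - a - b) * V * (2 powr N * y ^ n)"
      proof -
        have "y ^ n = 2 powr ((N - a - b) * n)" by (simp add: y_def powr_power mult.commute)
        moreover have "\<rho> powr (-a-b) * \<rho> powr N = \<rho> powr (N - a - b)"
          by (simp add: powr_add[symmetric] algebra_simps)
        moreover have "2 powr (- real n * (a + b)) * 2 powr ((real n + 1) * N) = 2 powr N * 2 powr ((N - a - b) * n)"
          by (simp add: powr_add[symmetric] algebra_simps)
        ultimately show ?thesis unfolding B_def by (metis (no_types, lifting) mult.assoc mult.left_commute)
      qed
      finally show ?thesis by (simp add: algebra_simps)
    qed
    have pt: "ennreal (norm z powr (-a) * max (norm z) \<rho> powr (-b)) \<le> (\<Sum>n. T n z)" for z :: 'a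
    \<comment> \<open>At the origin the left side is 0, since \<open>0 powr (- a) = 0\<close>;
      elsewhere the logarithm selects the dyadic shell.\<close>
    proof (cases "z = 0")
      case False
      have term_le: "T n z \<le> (\<Sum>n. T n z)" for n
        using sum_le_suminf[of "\<lambda>n. T n z" "{n}"] by (simp add: summableI)
      define k where "k = \<lfloor>log 2 (norm z / \<rho>)\<rfloor>"
      have pos: "norm z / \<rho> > 0" using False \<rho> by simp
      have k: "2 powr k \<le> norm z / \<rho>" "norm z / \<rho> < 2 powr (k + 1)"
        using pos by (auto simp: k_def le_log_iff[symmetric] log_less_iff[symmetric])
      have prod: "\<rho> powr (-a) * \<rho> powr (-b) = \<rho> powr (-a-b)"
        by (simp add: powr_add[symmetric])
      show ?thesis
      proof (cases "k \<ge> 0")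
        case True
        define n where "n = nat k"
        have n: "real n = k" using True by (simp add: n_def)
        have lo: "\<rho> * 2 powr n \<le> norm z" and hi: "norm z \<le> s n"
          using k \<rho> by (auto simp: n s_def field_simps)
        have "\<rho> \<le> \<rho> * 2 powr n" using \<rho> by (simp add: ge_one_powr_ge_zero)
        then have "max (norm z) \<rho> = norm z" using lo by simp
        then have "norm z powr (-a) * max (norm z) \<rho> powr (-b) = norm z powr (- (a + b))"
          by (simp add: powr_add[symmetric])
        also have "\<dots> \<le> (\<rho> * 2 powr n) powr (- (a + b))"
          using lo \<rho> a b by (intro powr_mono2') auto
        also have "\<dots> = B n"
          using \<rho> by (simp add: B_def powr_mult powr_powr algebra_simps)
        finally have "ennreal (norm z powr (-a) * max (norm z) \<rho> powr (-b)) \<le> T n z"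
          using hi by (simp add: T_def ennreal_leI add_increasing)
        then show ?thesis using term_le[of n] by (rule order_trans)
      next
        case False
        \<comment> \<open>In units of \<open>\<rho>\<close> the shell reaches from
          \<open>2 powr k\<close> to \<open>2 powr (k + 1)\<close>. For \<open>k < 0\<close> its
          outer radius is \<open>r n\<close> with \<open>n = - k - 1\<close>, so the count starts at
          0.\<close>
        define n where "n = nat (- k - 1)"
        have n: "real n = - k - 1" using False by (simp add: n_def)
        have lo: "\<rho> * 2 powr (- (real n + 1)) \<le> norm z" and hi: "norm z \<le> r n"
          using k \<rho> by (auto simp: n r_def field_simps)
        have "r n \<le> \<rho>" using \<rho> powr_mono[of "- real n" 0 2] by (simp add: r_def)
        then have "max (norm z) \<rho> = \<rho>" using hi by simp
        then have "norm z powr (-a) * max (norm z) \<rho> powr (-b)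
            \<le> (\<rho> * 2 powr (- (real n + 1))) powr (-a) * \<rho> powr (-b)"
          using lo \<rho> a b by (simp add: mult_right_mono powr_mono2')
        also have "\<dots> = A n"
          using \<rho> by (simp add: A_def powr_mult powr_powr prod[symmetric] algebra_simps)
        finally have "ennreal (norm z powr (-a) * max (norm z) \<rho> powr (-b)) \<le> T n z"
          using hi by (simp add: T_def ennreal_leI add_increasing2)
        then show ?thesis using term_le[of n] by (rule order_trans)
      qed
    qed simp
    have sums: "(\<lambda>n. \<rho> powr (N - a - b) * V * (2 powr a * x ^ n + 2 powr N * y ^ n)) sums (C * \<rho> powr (N - a - b))"
    proof -
      have "(\<lambda>n. \<rho> powr (N - a - b) * V * (2 powr a * x ^ n + 2 powr N * y ^ n)) sums
          (\<rho> powr (N - a - b) * V * (2 powr a * (1 / (1 - x)) + 2 powr N * (1 / (1 - y))))"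
        using x y by (intro sums_mult sums_add geometric_sums) auto
      then show ?thesis by (simp add: C_def mult_ac)
    qed
    have "(\<integral>\<^sup>+z. ennreal (norm (z::'a) powr (-a) * max (norm z) \<rho> powr (-b)) \<partial>lborel) \<le> (\<integral>\<^sup>+z. (\<Sum>n. T n z) \<partial>lborel)"
      by (intro nn_integral_mono pt)
    also have "\<dots> = (\<Sum>n. integral\<^sup>N lborel (T n))"
      by (intro nn_integral_suminf) (unfold T_def, intro borel_measurable_add meas)
    also have "\<dots> = ennreal (C * \<rho> powr (N - a - b))"
      unfolding T_int using V x y sums by (intro suminf_ennreal_eq) auto
    finally show ?thesis .
  qed
  ultimately show ?thesis using that by (simp add: N_def)
qed

text \<open>By the triangle inequality, \<open>\<bar>x - y\<bar>\<close> or \<open>(s + \<bar>y\<bar>\<^sup>2)\<^bsup>1/2\<^esup>\<close> is at least half of \<open>(s + \<bar>x\<bar>\<^sup>2)\<^bsup>1/2\<^esup>\<close>.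
  This reduces the convolution to two truncated powers.\<close>

lemma nn_integral_riesz_bound:
  fixes \<alpha> m :: real
  assumes \<alpha>: "0 < \<alpha>" "\<alpha> < DIM('a)" and m: "DIM('a) - \<alpha> < m" "m < DIM('a)"
  obtains C where "C > 0" "\<And>s (x::'a::euclidean_space). s > 0 \<Longrightarrow>
    (\<integral>\<^sup>+y. ennreal (norm (x - y) powr (-\<alpha>) * (s + y \<bullet> y) powr (- m / 2)) \<partial>lborel)
      \<le> ennreal (C * (s + x \<bullet> x) powr ((DIM('a) - \<alpha> - m) / 2))"
proof -
  define N where "N = real DIM('a)"
  obtain C1 where C1: "C1 > 0" "\<And>\<rho>. \<rho> > 0 \<Longrightarrow>
    (\<integral>\<^sup>+z. ennreal (norm (z::'a) powr (-\<alpha>) * max (norm z) \<rho> powr (-m)) \<partial>lborel)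
      \<le> ennreal (C1 * \<rho> powr (N - \<alpha> - m))"
    using nn_integral_truncated_power[where 'a = 'a, of \<alpha> m] \<alpha> m by (auto simp: N_def)
  \<comment> \<open>The exponents exchange their roles: now the singularity sits at
    \<open>y = 0\<close>, and \<open>m < DIM('a)\<close> makes it integrable.\<close>
  obtain C2 where C2: "C2 > 0" "\<And>\<rho>. \<rho> > 0 \<Longrightarrow>
    (\<integral>\<^sup>+z. ennreal (norm (z::'a) powr (-m) * max (norm z) \<rho> powr (-\<alpha>)) \<partial>lborel)
      \<le> ennreal (C2 * \<rho> powr (N - m - \<alpha>))"
    using nn_integral_truncated_power[where 'a = 'a, of m \<alpha>] \<alpha> m by (auto simp: N_def)
  define C where "C = (C1 + C2) * 2 powr (m + \<alpha> - N)"
  have "C > 0" using C1 C2 by (simp add: C_def)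
  moreover have "(\<integral>\<^sup>+y. ennreal (norm (x - y) powr (-\<alpha>) * (s + y \<bullet> y) powr (- m / 2)) \<partial>lborel)
      \<le> ennreal (C * (s + x \<bullet> x) powr ((N - \<alpha> - m) / 2))" if s: "s > 0" for s and x :: 'a
  proof -
    define \<rho> where "\<rho> = sqrt (s + x \<bullet> x) / 2"
    have sx: "s + x \<bullet> x > 0" using s by (simp add: add_pos_nonneg)
    then have \<rho>: "\<rho> > 0" by (simp add: \<rho>_def)
    let ?F = "\<lambda>z::'a. norm z powr (-\<alpha>) * max (norm z) \<rho> powr (-m)"
    let ?G = "\<lambda>y::'a. norm y powr (-m) * max (norm y) \<rho> powr (-\<alpha>)"
    \<comment> \<open>\<open>y = 0\<close> is excluded because \<open>0 powr (- m) = 0\<close> makes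
      \<open>?G 0\<close> vanish. At \<open>y = x\<close> the left side is 0 by the same
      convention.\<close>
    have pt: "norm (x - y) powr (-\<alpha>) * (s + y \<bullet> y) powr (- m / 2) \<le> ?F (x - y) + ?G y"
      if y: "y \<noteq> 0" for y
    proof (cases "x = y")
      case False
      define A B where "A = norm (x - y)" and "B = sqrt (s + y \<bullet> y)"
      have sy: "s + y \<bullet> y > 0" using s by (simp add: add_pos_nonneg)
      then have B: "B > 0" by (simp add: B_def)
      have A: "A > 0" using False by (simp add: A_def)
      have By: "norm y \<le> B" using s by (simp add: B_def norm_eq_sqrt_inner)
      \<comment> \<open>The parameter \<open>s\<close> is treated as the square of an extra
        coordinate; this is the triangle inequality in \<open>real \<times> 'a\<close>.\<close>
      have "norm (sqrt s, x) \<le> norm (sqrt s, y) + norm (0::real, x - y)"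
        using norm_triangle_ineq[of "(sqrt s, y)" "(0, x - y)"] by simp
      then have AB: "2 * \<rho> \<le> A + B"
        using s by (simp add: norm_Pair A_def B_def \<rho>_def dot_square_norm)
      have "(s + y \<bullet> y) powr (- m / 2) = B powr (-m)"
        using sy by (simp add: B_def powr_half_sqrt[symmetric] powr_powr)
      moreover have "A powr (-\<alpha>) * B powr (-m) \<le> ?F (x - y) + ?G y"
      \<comment> \<open>The larger of \<open>A\<close> and \<open>B\<close> is at least
        \<open>\<rho>\<close>. Its power is compared with that of \<open>max A \<rho>\<close> in the
        first case and of \<open>max (norm y) \<rho>\<close> in the second, where
        \<open>norm y \<le> B\<close> is used as well.\<close>
      proof (cases "A \<le> B")
        case True
        then have "B powr (-m) \<le> max A \<rho> powr (-m)"
          using AB A \<alpha> m by (intro powr_mono2') auto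
        then have "A powr (-\<alpha>) * B powr (-m) \<le> ?F (x - y)"
          by (auto simp: A_def intro!: mult_left_mono)
        then show ?thesis by (simp add: add_increasing2)
      next
        case False
        have "A powr (-\<alpha>) \<le> max (norm y) \<rho> powr (-\<alpha>)"
          using AB By False \<rho> \<alpha> by (intro powr_mono2') auto
        moreover have "B powr (-m) \<le> norm y powr (-m)"
          using By y \<alpha> m by (intro powr_mono2') auto
        ultimately have "A powr (-\<alpha>) * B powr (-m) \<le> ?G y"
          by (subst mult.commute) (intro mult_mono; simp)
        then show ?thesis by (simp add: add_increasing)
      qed
      ultimately show ?thesis by (simp add: A_def)
    qed simp
    have "(\<integral>\<^sup>+y. ennreal (norm (x - y) powr (-\<alpha>) * (s + y \<bullet> y) powr (- m / 2)) \<partial>lborel)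
        \<le> (\<integral>\<^sup>+y. ennreal (?F (x - y)) + ennreal (?G y) \<partial>lborel)"
    proof (rule nn_integral_mono_AE)
      show "AE y in lborel. ennreal (norm (x - y) powr (-\<alpha>) * (s + y \<bullet> y) powr (- m / 2))
          \<le> ennreal (?F (x - y)) + ennreal (?G y)"
        using AE_lborel_singleton[of "0::'a"]
      proof eventually_elim
        case (elim y)
        then show ?case using ennreal_leI[OF pt[of y]] by (subst ennreal_plus[symmetric]) auto
      qed
    qed
    also have "\<dots> = (\<integral>\<^sup>+y. ennreal (?F (x - y)) \<partial>lborel) + (\<integral>\<^sup>+y. ennreal (?G y) \<partial>lborel)"
      by (intro nn_integral_add) measurable
    also have "(\<integral>\<^sup>+y. ennreal (?F (x - y)) \<partial>lborel) = (\<integral>\<^sup>+y. ennreal (?F (- x + y)) \<partial>lborel)"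
      by (simp add: norm_minus_commute)
    also have "\<dots> = (\<integral>\<^sup>+y. ennreal (?F y) \<partial>distr lborel borel ((+) (-x)))"
      by (subst nn_integral_distr) auto
    also have "\<dots> = (\<integral>\<^sup>+y. ennreal (?F y) \<partial>lborel)" by (simp only: lborel_distr_plus)
    also have "\<dots> + (\<integral>\<^sup>+y. ennreal (?G y) \<partial>lborel)
        \<le> ennreal (C1 * \<rho> powr (N - \<alpha> - m)) + ennreal (C2 * \<rho> powr (N - m - \<alpha>))"
      by (intro add_mono C1 C2 \<rho>)
    also have "\<dots> = ennreal ((C1 + C2) * \<rho> powr (N - \<alpha> - m))"
      using C1 C2 by (simp flip: ennreal_plus add: distrib_right) (simp add: algebra_simps)
    also have "\<rho> powr (N - \<alpha> - m) = (s + x \<bullet> x) powr ((N - \<alpha> - m) / 2) * 2 powr (m + \<alpha> - N)"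
    proof -
      have "\<rho> powr (N - \<alpha> - m) = (sqrt (s + x \<bullet> x)) powr (N - \<alpha> - m) * 2 powr (- (N - \<alpha> - m))"
        unfolding \<rho>_def using sx powr_minus_divide[of 2 "N - \<alpha> - m"] by (subst powr_divide) auto
      also have "(sqrt (s + x \<bullet> x)) powr (N - \<alpha> - m) = (s + x \<bullet> x) powr ((N - \<alpha> - m) / 2)"
        using sx by (simp add: powr_half_sqrt[symmetric] powr_powr)
      finally show ?thesis by (simp add: algebra_simps)
    qed
    finally show ?thesis by (simp add: C_def mult_ac)
  qed
  ultimately show ?thesis using that by (simp add: N_def)
qed

text \<open>\<open>C\<close> is fixed before \<open>s\<close>, \<open>u\<close>, \<open>p\<close>
  and \<open>K\<close>, so one constant serves all times: the time part of a quadratic weight is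
  absorbed into \<open>s\<close>, and \<open>K\<close> carries the amplitude of \<open>u\<close>.
  Estimating the nonnegative integral yields finiteness together with the bound.\<close>

lemma riesz_conv_bound:
  fixes \<alpha> m :: real
  assumes "0 < \<alpha>" "\<alpha> < DIM('a)" "DIM('a) - \<alpha> < m" "m < DIM('a)"
  obtains C where "C > 0" "\<And>(u :: 'a::euclidean_space \<times> real \<Rightarrow> real) p s K x t.
    continuous_on UNIV u \<Longrightarrow> s > 0 \<Longrightarrow> K \<ge> 0 \<Longrightarrow>
    (\<And>y. \<bar>u (y, t)\<bar> powr p \<le> K * (s + y \<bullet> y) powr (- m / 2)) \<Longrightarrow>
    riesz_conv_finite \<alpha> p u (x, t) \<and>
    riesz_conv \<alpha> p u (x, t) \<le> K * C * (s + x \<bullet> x) powr ((DIM('a) - \<alpha> - m) / 2)"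
proof -
  obtain C where C: "C > 0" "\<And>s (x::'a::euclidean_space). s > 0 \<Longrightarrow>
    (\<integral>\<^sup>+y. ennreal (norm (x - y) powr (-\<alpha>) * (s + y \<bullet> y) powr (- m / 2)) \<partial>lborel)
      \<le> ennreal (C * (s + x \<bullet> x) powr ((DIM('a) - \<alpha> - m) / 2))"
    using nn_integral_riesz_bound[where 'a = 'a, OF assms] by blast
  show ?thesis
  proof (rule that[OF C(1)])
    fix u :: "'a \<times> real \<Rightarrow> real" and p s K t :: real and x :: 'a
    assume u: "continuous_on UNIV u" and s: "s > 0" and K: "K \<ge> 0"
      and le: "\<And>y. \<bar>u (y, t)\<bar> powr p \<le> K * (s + y \<bullet> y) powr (- m / 2)"
    let ?f = "\<lambda>y. norm (x - y) powr (- \<alpha>) * \<bar>u (y, t)\<bar> powr p"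
    let ?b = "K * C * (s + x \<bullet> x) powr ((DIM('a) - \<alpha> - m) / 2)"
    have meas [measurable]: "?f \<in> borel_measurable borel"
      by (intro borel_measurable_times powr_real_measurable borel_measurable_const)
        (auto intro!: borel_measurable_continuous_onI continuous_on_compose2[OF u] continuous_intros)
    have "(\<integral>\<^sup>+y. ennreal (?f y) \<partial>lborel)
        \<le> (\<integral>\<^sup>+y. ennreal K * ennreal (norm (x - y) powr (-\<alpha>) * (s + y \<bullet> y) powr (- m / 2)) \<partial>lborel)"
    proof (intro nn_integral_mono)
      fix y
      have "?f y \<le> norm (x - y) powr (- \<alpha>) * (K * (s + y \<bullet> y) powr (- m / 2))"
        by (intro mult_left_mono le) simp
      then show "ennreal (?f y) \<le> ennreal K * ennreal (norm (x - y) powr (-\<alpha>) * (s + y \<bullet> y) powr (- m / 2))"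
        using K by (simp add: ennreal_mult[symmetric] ennreal_leI mult_ac)
    qed
    also have "\<dots> = ennreal K * (\<integral>\<^sup>+y. ennreal (norm (x - y) powr (-\<alpha>) * (s + y \<bullet> y) powr (- m / 2)) \<partial>lborel)"
      by (rule nn_integral_cmult) measurable
    also have "\<dots> \<le> ennreal K * ennreal (C * (s + x \<bullet> x) powr ((DIM('a) - \<alpha> - m) / 2))"
      by (intro mult_left_mono C(2) s) simp
    finally have nn: "(\<integral>\<^sup>+y. ennreal (?f y) \<partial>lborel) \<le> ennreal ?b"
      using K C(1) by (simp add: ennreal_mult[symmetric] mult_ac)
    then have "integrable lborel ?f"
      by (intro integrableI_bounded) (auto simp: order_le_less_trans)
    moreover have "(LINT y|lborel. ?f y) \<le> ?b"
      using nn K C(1) by (intro integral_real_bounded) auto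
    ultimately show "riesz_conv_finite \<alpha> p u (x, t) \<and> riesz_conv \<alpha> p u (x, t) \<le> ?b"
      by (simp add: riesz_conv_finite_def riesz_conv_def integrable_completion integral_completion)
  qed
qed

section \<open>Explicit supersolutions\<close>

text \<open>\<open>quad \<delta>\<close> with \<open>\<delta> = 0\<close> is independent of time and serves the decaying solution of part (i);
  a small \<open>\<delta> > 0\<close> gives the solution of part (iii), which increases for \<open>t < 1\<close>.\<close>

definition quad :: "real \<Rightarrow> 'a::euclidean_space \<times> real \<Rightarrow> real" where
  "quad \<delta> z = 1 + fst z \<bullet> fst z + \<delta> * (snd z - 1)\<^sup>2"

lemma quad_ge_1: "\<delta> \<ge> 0 \<Longrightarrow> quad \<delta> z \<ge> 1"
  by (simp add: quad_def)

lemma smooth_fst_square: "smooth (\<lambda>z::'a::euclidean_space \<times> real. fst z \<bullet> fst z)"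
proof -
  have "(\<lambda>z::'a \<times> real. fst z \<bullet> fst z) = (\<lambda>z. \<Sum>b\<in>Basis. (z \<bullet> (b, 0)) * (z \<bullet> (b, 0)))"
    by (auto simp: fun_eq_iff euclidean_inner[of "x::'a" x for x])
  then show ?thesis
    by (simp add: smooth_sum smooth_mult smooth_inner)
qed

lemma smooth_fst_inner: "smooth (\<lambda>z::'a::euclidean_space \<times> real. fst z \<bullet> b)"
proof -
  have "(\<lambda>z::'a \<times> real. fst z \<bullet> b) = (\<lambda>z. z \<bullet> (b, 0))" by (auto simp: fun_eq_iff)
  then show ?thesis by (simp only: smooth_inner)
qed

lemma smooth_snd: "smooth (\<lambda>z::'a::euclidean_space \<times> real. snd z)"
proof -
  have "(\<lambda>z::'a \<times> real. snd z) = (\<lambda>z. z \<bullet> (0, 1))" by (auto simp: fun_eq_iff)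
  then show ?thesis by (simp only: smooth_inner)
qed

lemma smooth_quad: "smooth (quad \<delta>)"
  unfolding quad_def[abs_def] power2_eq_square
  by (intro smooth_add smooth_mult smooth_diff smooth_const smooth_fst_square smooth_snd)

lemma smooth_quad_powr: "\<delta> \<ge> 0 \<Longrightarrow> smooth (\<lambda>z. quad \<delta> z powr a)"
  by (intro smooth_powr smooth_quad less_le_trans[OF zero_less_one quad_ge_1])

lemma partial_deriv_quad:
  "partial_deriv (b, c) (quad \<delta>) z = 2 * (fst z \<bullet> b) + 2 * \<delta> * c * (snd z - 1)"
proof (rule partial_derivI)
  have "(\<lambda>s. quad \<delta> (z + s *\<^sub>R (b, c))) = (\<lambda>s. 1 + (fst z \<bullet> fst z + 2 * s * (fst z \<bullet> b) + s\<^sup>2 * (b \<bullet> b))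
      + \<delta> * (snd z + s * c - 1)\<^sup>2)"
    by (auto simp: fun_eq_iff quad_def inner_add_left inner_add_right inner_commute algebra_simps power2_eq_square)
  then show "((\<lambda>s. quad \<delta> (z + s *\<^sub>R (b, c))) has_real_derivative
      2 * (fst z \<bullet> b) + 2 * \<delta> * c * (snd z - 1)) (at 0)"
    by (auto intro!: derivative_eq_intros)
qed

lemma partial_deriv_quad_powr:
  assumes "\<delta> \<ge> 0"
  shows "partial_deriv (b, c) (\<lambda>z. quad \<delta> z powr a) z
    = a * quad \<delta> z powr (a - 1) * (2 * (fst z \<bullet> b) + 2 * \<delta> * c * (snd z - 1))"
proof -
  have "quad \<delta> z > 0" using quad_ge_1[OF assms, of z] by linarith
  then have "((\<lambda>x. x powr a) has_real_derivative a * quad \<delta> z powr (a - 1)) (at (quad \<delta> z))"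
    by (auto intro!: derivative_eq_intros)
  from partial_deriv_compose[OF smooth_differentiable[OF smooth_quad] this]
  show ?thesis by (simp add: partial_deriv_quad)
qed

lemma partial_deriv_linear:
  "partial_deriv v (\<lambda>z. 2 * (fst z \<bullet> b) + 2 * \<delta> * c * (snd z - 1)) z
    = 2 * (fst v \<bullet> b) + 2 * \<delta> * c * snd v"
  by (rule partial_derivI) (auto intro!: derivative_eq_intros simp: inner_add_left algebra_simps)

lemma second_partial_deriv_quad_powr:
  assumes "\<delta> \<ge> 0"
  shows "partial_deriv (b, c) (partial_deriv (b, c) (\<lambda>z. quad \<delta> z powr a)) z
    = a * (a - 1) * quad \<delta> z powr (a - 2) * (2 * (fst z \<bullet> b) + 2 * \<delta> * c * (snd z - 1))\<^sup>2
      + a * quad \<delta> z powr (a - 1) * (2 * (b \<bullet> b) + 2 * \<delta> * c\<^sup>2)"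
proof -
  let ?l = "\<lambda>z::'a \<times> real. 2 * (fst z \<bullet> b) + 2 * \<delta> * c * (snd z - 1)"
  have d: "?l differentiable (at z)"
    by (intro smooth_differentiable smooth_add smooth_mult smooth_const smooth_diff smooth_snd smooth_fst_inner)
  have "partial_deriv (b, c) (\<lambda>z. quad \<delta> z powr a) = (\<lambda>z. (a * quad \<delta> z powr (a - 1)) * ?l z)"
    by (intro ext partial_deriv_quad_powr assms)
  then have "partial_deriv (b, c) (partial_deriv (b, c) (\<lambda>z. quad \<delta> z powr a)) z
      = partial_deriv (b, c) (\<lambda>z. (a * quad \<delta> z powr (a - 1)) * ?l z) z"
    by (simp only:)
  also have "\<dots> = partial_deriv (b, c) (\<lambda>z. a * quad \<delta> z powr (a - 1)) z * ?l z
      + a * quad \<delta> z powr (a - 1) * (2 * (b \<bullet> b) + 2 * \<delta> * c * c)"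
    by (subst partial_deriv_mult[OF smooth_differentiable[OF smooth_mult[OF smooth_const smooth_quad_powr]] d])
      (use assms partial_deriv_linear[of "(b, c)" b \<delta> c z] in auto)
  also have "partial_deriv (b, c) (\<lambda>z. a * quad \<delta> z powr (a - 1)) z
      = a * ((a - 1) * quad \<delta> z powr (a - 2) * ?l z)"
    by (simp add: partial_deriv_cmult smooth_quad_powr partial_deriv_quad_powr assms)
  finally show ?thesis by (simp add: power2_eq_square algebra_simps)
qed

lemma laplacian_quad_powr:
  assumes "\<delta> \<ge> 0"
  shows "laplacian (\<lambda>z::'a::euclidean_space \<times> real. quad \<delta> z powr a) z
    = 4 * a * (a - 1) * quad \<delta> z powr (a - 2) * (fst z \<bullet> fst z) + 2 * a * DIM('a) * quad \<delta> z powr (a - 1)"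
proof -
  have "(\<Sum>b\<in>Basis. (fst z \<bullet> b)\<^sup>2) = fst z \<bullet> fst z"
    using euclidean_inner[of "fst z" "fst z"] by (simp add: power2_eq_square)
  then show ?thesis
    unfolding laplacian_def second_partial_deriv_quad_powr[OF assms]
    by (simp add: sum.distrib power_mult_distrib inner_same_Basis flip: sum_distrib_left)
qed

lemma wave_operator_quad_powr:
  fixes \<delta> k :: real
  assumes "\<delta> \<ge> 0"
  shows "wave_operator (\<lambda>z::'a::euclidean_space \<times> real. quad \<delta> z powr (-k)) z
    = 2 * k * quad \<delta> z powr (- k - 2) *
      ((DIM('a) - \<delta>) * quad \<delta> z + 2 * (k + 1) * (\<delta>\<^sup>2 * (snd z - 1)\<^sup>2 - fst z \<bullet> fst z))"
proof -
  have "quad \<delta> z > 0" using quad_ge_1[OF assms, of z] by linarith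
  then have "quad \<delta> z powr (- k - 1) = quad \<delta> z powr (- k - 2) * quad \<delta> z"
    using powr_add[of "quad \<delta> z" "- k - 2" 1] by (simp add: minus_diff_commute)
  then show ?thesis
    unfolding wave_operator_def time_deriv_def second_partial_deriv_quad_powr[OF assms] laplacian_quad_powr[OF assms]
    by (simp add: algebra_simps power2_eq_square)
qed

section \<open>The solutions of parts (i) and (iii)\<close>

lemma exists_decreasing_solution:
  fixes p q \<alpha> :: real
  assumes p: "p > 0" and q: "q \<ge> 1" and \<alpha>: "0 < \<alpha>" "\<alpha> < DIM('a::euclidean_space)"
  shows "\<exists>u0 u1 (u :: 'a \<times> real \<Rightarrow> real).
    weak_solution \<alpha> p q u0 u1 u \<and> classical_solution \<alpha> p q u0 u1 u \<and>
    (\<forall>z\<in>upper_half. u z > 0) \<and> (\<forall>x. u1 x < 0)"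
proof -
  define m where "m = DIM('a) - \<alpha> / 2"
  have m: "DIM('a) - \<alpha> < m" "m < DIM('a)" "m > 0" using \<alpha> by (auto simp: m_def)
  define k where "k = m / (2 * p)"
  have k: "k > 0" "k * p = m / 2" using m p by (auto simp: k_def)
  obtain C where C: "C > 0" "\<And>(u :: 'a \<times> real \<Rightarrow> real) p s K x t.
    continuous_on UNIV u \<Longrightarrow> s > 0 \<Longrightarrow> K \<ge> 0 \<Longrightarrow>
    (\<And>y. \<bar>u (y, t)\<bar> powr p \<le> K * (s + y \<bullet> y) powr (- m / 2)) \<Longrightarrow>
    riesz_conv_finite \<alpha> p u (x, t) \<and>
    riesz_conv \<alpha> p u (x, t) \<le> K * C * (s + x \<bullet> x) powr ((DIM('a) - \<alpha> - m) / 2)"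
    using riesz_conv_bound[where 'a = 'a, OF \<alpha> m(1,2)] by metis
  \<comment> \<open>The second time derivative is \<open>l\<^sup>2 * u\<close> and the Laplacian is
    at most \<open>4 * k * (k + 1) * u\<close>, so this choice leaves \<open>C * u\<close>. That
    dominates the nonlinear term, since the convolution is at most \<open>C\<close> and
    \<open>u powr q \<le> u\<close> for \<open>q \<ge> 1\<close> and
    \<open>u \<le> 1\<close>.\<close>
  define l where "l = sqrt (C + 4 * k * (k + 1))"
  have l: "l > 0" "l\<^sup>2 = C + 4 * k * (k + 1)"
    using C(1) k by (auto simp: l_def intro!: add_pos_nonneg)
  define E where "E z = exp (- l * snd z)" for z :: "'a \<times> real"
  define F where "F z = quad 0 z powr (-k)" for z :: "'a \<times> real"
  define u where "u z = E z * F z" for z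
  have E_smooth: "smooth E" and F_smooth: "smooth F"
    unfolding E_def[abs_def] F_def[abs_def]
    by (intro smooth_exp smooth_mult smooth_const smooth_snd smooth_quad_powr; simp)+
  then have u_smooth: "smooth u" unfolding u_def[abs_def] by (rule smooth_mult)
  have Q1: "quad 0 z \<ge> 1" for z :: "'a \<times> real" by (rule quad_ge_1) simp
  have F: "0 < F z" "F z \<le> 1" for z
    using Q1[of z] k powr_mono[of "-k" 0 "quad 0 z"] by (auto simp: F_def)
  have u_pos: "u z > 0" for z using F[of z] by (simp add: u_def E_def)
  have pE: "partial_deriv (b, c) E z = - l * c * E z" for b c z
    unfolding E_def by (rule partial_derivI) (auto intro!: derivative_eq_intros)
  have pF: "partial_deriv (0, c) F z = 0" for c z
    unfolding F_def[abs_def] by (simp add: partial_deriv_quad_powr)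
  note d = smooth_differentiable[OF E_smooth] smooth_differentiable[OF F_smooth]
    smooth_differentiable[OF smooth_partial[OF F_smooth Basis_pair(1)]]
  have time: "time_deriv u z = - l * u z" for z
    unfolding time_deriv_def u_def[abs_def] by (simp add: partial_deriv_mult d pE pF)
  have time2: "time_deriv (time_deriv u) z = l\<^sup>2 * u z" for z
  proof -
    have "time_deriv (time_deriv u) z = time_deriv (\<lambda>z. - l * u z) z"
      by (simp add: time[abs_def])
    also have "\<dots> = - l * time_deriv u z"
      unfolding time_deriv_def by (rule partial_deriv_cmult[OF u_smooth])
    finally show ?thesis by (simp add: time power2_eq_square)
  qed
  have lap: "laplacian u z = E z * laplacian F z" for z
  proof -
    have "partial_deriv (b, 0) (partial_deriv (b, 0) u) z = E z * partial_deriv (b, 0) (partial_deriv (b, 0) F) z"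
      if "b \<in> Basis" for b
    proof -
      have "partial_deriv (b, 0) u = (\<lambda>z. E z * partial_deriv (b, 0) F z)"
        unfolding u_def[abs_def] by (simp add: fun_eq_iff partial_deriv_mult d pE)
      then show ?thesis using that by (simp add: partial_deriv_mult d pE)
    qed
    then show ?thesis by (simp add: laplacian_def sum_distrib_left)
  qed
  have lapF: "laplacian F z \<le> 4 * k * (k + 1) * F z" for z
  proof -
    have Q: "quad 0 z > 0" using Q1[of z] by linarith
    \<comment> \<open>The dropped term \<open>- 2 * k * DIM('a) * quad 0 z powr (- k - 1)\<close> is
      negative.\<close>
    have "laplacian F z \<le> 4 * (-k) * (-k - 1) * (quad 0 z powr (-k - 2) * (fst z \<bullet> fst z))"
      using k(1) unfolding F_def[abs_def] by (subst laplacian_quad_powr) (auto simp: mult.assoc)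
    also have "\<dots> = 4 * k * (k + 1) * (quad 0 z powr (-k - 2) * (fst z \<bullet> fst z))"
      by (simp add: algebra_simps)
    also have "\<dots> \<le> 4 * k * (k + 1) * (quad 0 z powr (-k - 2) * quad 0 z powr 2)"
    proof (intro mult_left_mono)
      have "fst z \<bullet> fst z \<le> quad 0 z" by (simp add: quad_def)
      also have "\<dots> \<le> quad 0 z * quad 0 z" using Q1[of z] mult_left_mono[of 1 "quad 0 z" "quad 0 z"] by simp
      finally show "fst z \<bullet> fst z \<le> quad 0 z powr 2" using Q by (simp add: powr_numeral power2_eq_square)
    qed (use k in auto)
    also have "quad 0 z powr (-k - 2) * quad 0 z powr 2 = F z"
      using powr_add[of "quad 0 z" "- k - 2" 2] by (simp add: F_def)
    finally show ?thesis .
  qed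
  have wave: "C * u z \<le> wave_operator u z" for z
  proof -
    have "E z * laplacian F z \<le> E z * (4 * k * (k + 1) * F z)"
      by (intro mult_left_mono lapF) (simp add: E_def)
    then show ?thesis
      unfolding wave_operator_def time2 lap l(2) by (simp add: u_def algebra_simps)
  qed
  have conv: "riesz_conv_finite \<alpha> p u (x, t) \<and> riesz_conv \<alpha> p u (x, t) \<le> C" if t: "t \<ge> 0" for x t
  proof -
    have bound: "\<bar>u (y, t)\<bar> powr p \<le> 1 * (1 + y \<bullet> y) powr (- m / 2)" for y
    proof -
      have "E (y, t) \<le> 1" using t l(1) by (simp add: E_def)
      then have "\<bar>u (y, t)\<bar> \<le> F (y, t)"
        using F[of "(y, t)"] u_pos[of "(y, t)"] mult_right_mono[of "E (y, t)" 1 "F (y, t)"] by (simp add: u_def)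
      then have "\<bar>u (y, t)\<bar> powr p \<le> F (y, t) powr p" using p by (intro powr_mono2) auto
      also have "\<dots> = (1 + y \<bullet> y) powr (- m / 2)"
        by (simp add: F_def quad_def powr_powr k(2))
      finally show ?thesis by simp
    qed
    have "riesz_conv_finite \<alpha> p u (x, t) \<and>
        riesz_conv \<alpha> p u (x, t) \<le> 1 * C * (1 + x \<bullet> x) powr ((DIM('a) - \<alpha> - m) / 2)"
      by (rule C(2)[OF smooth_continuous[OF u_smooth] _ _ bound]) auto
    moreover have "(1 + x \<bullet> x) powr ((DIM('a) - \<alpha> - m) / 2) \<le> (1 + x \<bullet> x) powr 0"
      using m(1) by (intro powr_mono) auto
    then have "C * (1 + x \<bullet> x) powr ((DIM('a) - \<alpha> - m) / 2) \<le> C * 1"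
      using C(1) add_nonneg_pos[of "x \<bullet> x" 1] by (intro mult_left_mono) (auto simp: add.commute)
    ultimately show ?thesis by auto
  qed
  have ineq: "riesz_conv \<alpha> p u z * \<bar>u z\<bar> powr q \<le> wave_operator u z" and
    fin: "riesz_conv_finite \<alpha> p u z" if z: "z \<in> closed_upper_half" for z
  proof -
    have t: "snd z \<ge> 0" using z by (auto simp: closed_upper_half_def)
    have c: "riesz_conv_finite \<alpha> p u z" "riesz_conv \<alpha> p u z \<le> C"
      using conv[OF t, of "fst z"] by auto
    have "E z \<le> 1" using t l(1) by (simp add: E_def)
    then have "u z \<le> 1" using F[of z] by (auto simp: u_def E_def intro: mult_le_one)
    then have "\<bar>u z\<bar> powr q \<le> \<bar>u z\<bar> powr 1"
      using u_pos[of z] q by (intro powr_mono') auto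
    then have "riesz_conv \<alpha> p u z * \<bar>u z\<bar> powr q \<le> C * u z"
      using c u_pos[of z] C(1) by (intro mult_mono) auto
    then show "riesz_conv \<alpha> p u z * \<bar>u z\<bar> powr q \<le> wave_operator u z"
      using wave[of z] by linarith
    show "riesz_conv_finite \<alpha> p u z" by fact
  qed
  have "weak_solution \<alpha> p q (\<lambda>x. u (x, 0)) (\<lambda>x. time_deriv u (x, 0)) u"
    using p q by (intro smooth_weak_solution u_smooth fin ineq) auto
  moreover have "classical_solution \<alpha> p q (\<lambda>x. u (x, 0)) (\<lambda>x. time_deriv u (x, 0)) u"
    using upper_half_subset by (intro smooth_classical_solution u_smooth fin ineq) auto
  moreover have "time_deriv u (x, 0) < 0" for x
    using l(1) u_pos[of "(x, 0)"] by (simp add: time)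
  ultimately show ?thesis using u_pos by blast
qed

lemma exists_increasing_solution:
  fixes p q \<alpha> :: real
  assumes p: "p > 0" and q: "q > 0" and \<alpha>: "0 < \<alpha>" "\<alpha> < DIM('a::euclidean_space)"
    and N2: "DIM('a) > 2"
    and min: "min p q > (DIM('a) - \<alpha>) / (DIM('a) - 2)"
    and sum: "p + q > (2 * DIM('a) - \<alpha>) / (DIM('a) - 2)"
  shows "\<exists>u0 u1 (u :: 'a \<times> real \<Rightarrow> real).
    weak_solution \<alpha> p q u0 u1 u \<and> classical_solution \<alpha> p q u0 u1 u \<and>
    (\<forall>z\<in>upper_half. u z > 0) \<and> (\<forall>x. u1 x > 0)"
proof -
  define N where "N = real DIM('a)"
  have N: "N > 2" using N2 by (simp add: N_def)
  have \<alpha>N: "\<alpha> < N" using \<alpha> by (simp add: N_def)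
  have pM: "(N - 2) * p > N - \<alpha>" and qM: "(N - 2) * q > N - \<alpha>" and sM: "(N - 2) * (p + q) > 2 * N - \<alpha>"
    using min sum N by (auto simp: N_def field_simps)
  \<comment> \<open>Apart from \<open>0 < d\<close>, every condition is strict and continuous in
    \<open>d\<close>. At \<open>d = 0\<close> they reduce to \<open>N > 2\<close>,
    \<open>pM\<close>, \<open>qM\<close> and \<open>sM\<close>, so they persist for small
    \<open>d\<close>.\<close>
  have ev: "\<forall>\<^sub>F d in at_right 0. 0 < d \<and> 2 * d < N - 2 \<and> (N - 2 - 2 * d) * p > N - \<alpha> \<and>
      (N - 2 - 2 * d) * q + \<alpha> > (N - 2 - 2 * d) + 2 \<and>
      (N - 2 - 2 * d) * (p + q) > N - \<alpha> + (N - 2 - 2 * d) + 2"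
  proof (intro eventually_conj)
    have lt: "\<forall>\<^sub>F d in at_right 0. f d < g d" if "f 0 < g 0" "isCont f 0" "isCont g 0"
      for f g :: "real \<Rightarrow> real"
    proof -
      have "((\<lambda>d. g d - f d) \<longlongrightarrow> g 0 - f 0) (at_right 0)"
        using that by (intro tendsto_diff) (auto simp: isCont_def intro: tendsto_within_subset)
      then have "\<forall>\<^sub>F d in at_right 0. 0 < g d - f d" using that(1) by (intro order_tendstoD) auto
      then show ?thesis by eventually_elim simp
    qed
    show "\<forall>\<^sub>F d in at_right (0::real). 0 < d" by (simp add: eventually_at_right_less)
    show "\<forall>\<^sub>F d in at_right 0. 2 * d < N - 2" using N by (intro lt) auto
    show "\<forall>\<^sub>F d in at_right 0. N - \<alpha> < (N - 2 - 2 * d) * p" using pM by (intro lt) auto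
    show "\<forall>\<^sub>F d in at_right 0. (N - 2 - 2 * d) + 2 < (N - 2 - 2 * d) * q + \<alpha>" using qM by (intro lt) auto
    show "\<forall>\<^sub>F d in at_right 0. N - \<alpha> + (N - 2 - 2 * d) + 2 < (N - 2 - 2 * d) * (p + q)"
      using sM by (intro lt) auto
  qed
  obtain \<delta> where \<delta>': "0 < \<delta> \<and> 2 * \<delta> < N - 2 \<and> (N - 2 - 2 * \<delta>) * p > N - \<alpha> \<and>
      (N - 2 - 2 * \<delta>) * q + \<alpha> > (N - 2 - 2 * \<delta>) + 2 \<and>
      (N - 2 - 2 * \<delta>) * (p + q) > N - \<alpha> + (N - 2 - 2 * \<delta>) + 2"
    using eventually_happens'[OF _ ev] by auto
  define k where "k = (N - 2 - 2 * \<delta>) / 2"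
  then have K: "N - 2 - 2 * \<delta> = 2 * k" by simp
  have \<delta>: "\<delta> > 0" and k: "k > 0" using \<delta>' by (auto simp: k_def)
  from \<delta>' have kp: "2 * k * p > N - \<alpha>"
    and kq: "2 * k * q + \<alpha> > 2 * k + 2" and kpq: "2 * k * (p + q) > N - \<alpha> + 2 * k + 2"
    by (auto simp: K)
  \<comment> \<open>Three demands: \<open>m\<close> lies between \<open>N - \<alpha>\<close> and
    \<open>N\<close>; it is at most \<open>2 * k * p\<close>, so that the weight covers
    \<open>\<bar>u\<bar> powr p\<close>; it is at least
    \<open>N - (2 * k * q + \<alpha> - 2 * k - 2)\<close>, so that the nonlinear term decays at
    least like \<open>quad \<delta> z powr (- k - 1)\<close>. The inner \<open>min\<close> with
    \<open>\<alpha> / 2\<close> keeps \<open>m > N - \<alpha>\<close>, and \<open>kpq\<close> makes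
    the last two demands compatible.\<close>
  define m where "m = min (2 * k * p) (N - min (2 * k * q + \<alpha> - 2 * k - 2) (\<alpha> / 2))"
  have m: "N - \<alpha> < m" "m < N" "m \<le> 2 * k * p" "m - (N - \<alpha>) + 2 * k * q \<ge> 2 * k + 2"
    using kp kq kpq \<alpha>(1) by (auto simp: m_def min_def algebra_simps)
  obtain C where C: "C > 0" "\<And>(u :: 'a \<times> real \<Rightarrow> real) p s K x t.
    continuous_on UNIV u \<Longrightarrow> s > 0 \<Longrightarrow> K \<ge> 0 \<Longrightarrow>
    (\<And>y. \<bar>u (y, t)\<bar> powr p \<le> K * (s + y \<bullet> y) powr (- m / 2)) \<Longrightarrow>
    riesz_conv_finite \<alpha> p u (x, t) \<and>
    riesz_conv \<alpha> p u (x, t) \<le> K * C * (s + x \<bullet> x) powr ((N - \<alpha> - m) / 2)"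
    using riesz_conv_bound[where 'a = 'a, OF \<alpha>, of m] m by (auto simp: N_def)
  have pq: "p + q > 1"
  proof -
    have "(N - 2) * 1 < (N - 2) * (p + q)" using sM \<alpha>N by simp
    then show ?thesis using N by (simp only: mult_less_cancel_left_pos)
  qed
  define c where "c = 2 * k * \<delta>"
  have c: "c > 0" using k \<delta> by (simp add: c_def)
  \<comment> \<open>The nonlinear side scales like \<open>e powr (p + q)\<close> and the linear one
    like \<open>e\<close>; since \<open>p + q > 1\<close>, this value equates their constants, as
    recorded in \<open>e_eq\<close>.\<close>
  define e where "e = (c / C) powr (1 / (p + q - 1))"
  have e: "e > 0" using c C(1) by (simp add: e_def)
  have e_eq: "e powr (p + q) * C = e * c"
  proof -
    have "e powr (p + q - 1) = c / C" using pq c C(1) by (simp add: e_def powr_powr)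
    then have "e powr (p + q) = c / C * e" using powr_add[of e "p + q - 1" 1] e by simp
    then show ?thesis using C(1) by simp
  qed
  define F where "F z = quad \<delta> z powr (-k)" for z :: "'a \<times> real"
  define u where "u z = e * F z" for z
  have F_smooth: "smooth F"
    unfolding F_def[abs_def] using \<delta> by (intro smooth_quad_powr) simp
  then have u_smooth: "smooth u" unfolding u_def[abs_def] by (intro smooth_mult smooth_const)
  have Q1: "quad \<delta> z \<ge> 1" for z :: "'a \<times> real" using \<delta> by (intro quad_ge_1) simp
  have Q0: "quad \<delta> z > 0" for z :: "'a \<times> real" using Q1[of z] by linarith
  have u_pos: "u z > 0" for z using Q0[of z] e by (simp add: u_def F_def)
  have pu2: "partial_deriv v (partial_deriv v u) z = e * partial_deriv v (partial_deriv v F) z"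
    if "v \<in> Basis" for v z
  proof -
    have "partial_deriv v u = (\<lambda>z. e * partial_deriv v F z)"
      unfolding u_def[abs_def] by (intro ext partial_deriv_cmult F_smooth)
    then show ?thesis by (simp add: partial_deriv_cmult smooth_partial F_smooth that)
  qed
  have wave: "wave_operator u z \<ge> e * c * quad \<delta> z powr (- k - 1)" for z
  proof -
    have "c * quad \<delta> z powr (- k - 1) = 2 * k * quad \<delta> z powr (- k - 2) * (\<delta> * quad \<delta> z)"
      using powr_add[of "quad \<delta> z" "- k - 2" 1] Q0[of z] by (simp add: c_def minus_diff_commute)
    \<comment> \<open>Drop the time square and use
      \<open>fst z \<bullet> fst z \<le> quad \<delta> z\<close>. As
      \<open>2 * (k + 1) = N - 2 * \<delta>\<close>, the bracket is at least
      \<open>((N - \<delta>) - (N - 2 * \<delta>)) * quad \<delta> z\<close>, which is where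
      \<open>c = 2 * k * \<delta>\<close> comes from.\<close>
    also have "\<dots> \<le> 2 * k * quad \<delta> z powr (- k - 2) *
      ((N - \<delta>) * quad \<delta> z + 2 * (k + 1) * (\<delta>\<^sup>2 * (snd z - 1)\<^sup>2 - fst z \<bullet> fst z))"
    proof (intro mult_left_mono)
      have "(k + 1) * (fst z \<bullet> fst z) \<le> (k + 1) * quad \<delta> z"
        using k \<delta> by (intro mult_left_mono) (auto simp: quad_def)
      moreover have "2 * ((k + 1) * quad \<delta> z) = N * quad \<delta> z - 2 * (\<delta> * quad \<delta> z)"
      proof -
        have "2 * (k + 1) = N - 2 * \<delta>" using K by simp
        then have "2 * (k + 1) * quad \<delta> z = (N - 2 * \<delta>) * quad \<delta> z" by simp
        then show ?thesis by (simp only: left_diff_distrib mult.assoc)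
      qed
      moreover have "0 \<le> (k + 1) * (\<delta>\<^sup>2 * (snd z - 1)\<^sup>2)" using k by simp
      ultimately have "\<delta> * quad \<delta> z \<le> (N - \<delta>) * quad \<delta> z - 2 * ((k + 1) * (fst z \<bullet> fst z))
          + 2 * ((k + 1) * (\<delta>\<^sup>2 * (snd z - 1)\<^sup>2))"
        unfolding left_diff_distrib[of N] by linarith
      then show "\<delta> * quad \<delta> z \<le> (N - \<delta>) * quad \<delta> z + 2 * (k + 1) * (\<delta>\<^sup>2 * (snd z - 1)\<^sup>2 - fst z \<bullet> fst z)"
        by (simp add: algebra_simps)
    qed (use k in auto)
    also have "\<dots> = wave_operator F z"
      unfolding F_def[abs_def] N_def using \<delta> by (intro wave_operator_quad_powr[symmetric]) simp
    finally have "e * (c * quad \<delta> z powr (- k - 1)) \<le> e * wave_operator F z"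
      using e by (intro mult_left_mono) auto
    also have "\<dots> = wave_operator u z"
      by (simp add: wave_operator_def time_deriv_def laplacian_def pu2 Basis_pair sum_distrib_left right_diff_distrib)
    finally show ?thesis by (simp add: mult.assoc)
  qed
  have conv: "riesz_conv_finite \<alpha> p u z \<and>
      riesz_conv \<alpha> p u z \<le> e powr p * C * quad \<delta> z powr ((N - \<alpha> - m) / 2)" for z
  proof -
    obtain x t where z: "z = (x, t)" by (cases z)
    \<comment> \<open>At a fixed time \<open>quad\<close> is the weight
      \<open>s + y \<bullet> y\<close> of \<open>riesz_conv_bound\<close>.\<close>
    define s where "s = 1 + \<delta> * (t - 1)\<^sup>2"
    have s: "s > 0" using \<delta> by (simp add: s_def add_pos_nonneg)
    have qs: "quad \<delta> (y, t) = s + y \<bullet> y" for y :: 'a by (simp add: quad_def s_def)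
    have bound: "\<bar>u (y, t)\<bar> powr p \<le> e powr p * (s + y \<bullet> y) powr (- m / 2)" for y
    proof -
      have "\<bar>u (y, t)\<bar> powr p = e powr p * quad \<delta> (y, t) powr (- k * p)"
        using e Q0[of "(y, t)"] by (simp add: u_def F_def abs_mult powr_mult powr_powr)
      also have "\<dots> \<le> e powr p * quad \<delta> (y, t) powr (- m / 2)"
        using m(3) Q1[of "(y, t)"] by (intro mult_left_mono powr_mono) auto
      finally show ?thesis by (simp add: qs)
    qed
    show ?thesis
      unfolding z qs by (rule C(2)[OF smooth_continuous[OF u_smooth] s _ bound]) auto
  qed
  have ineq: "riesz_conv \<alpha> p u z * \<bar>u z\<bar> powr q \<le> wave_operator u z" for z
  proof -
    have uq: "\<bar>u z\<bar> powr q = e powr q * quad \<delta> z powr (- k * q)"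
      using e Q0[of z] by (simp add: u_def F_def abs_mult powr_mult powr_powr)
    have "riesz_conv \<alpha> p u z * \<bar>u z\<bar> powr q
        \<le> (e powr p * C * quad \<delta> z powr ((N - \<alpha> - m) / 2)) * (e powr q * quad \<delta> z powr (- k * q))"
      unfolding uq using conv[of z] by (intro mult_right_mono) auto
    also have "\<dots> = (e powr (p + q) * C) * quad \<delta> z powr ((N - \<alpha> - m) / 2 - k * q)"
    proof -
      have "quad \<delta> z powr ((N - \<alpha> - m) / 2 - k * q) = quad \<delta> z powr ((N - \<alpha> - m) / 2) * quad \<delta> z powr (- k * q)"
        using powr_add[of "quad \<delta> z" "(N - \<alpha> - m) / 2" "- k * q"] by simp
      then show ?thesis by (simp only: powr_add[of e p q] mult_ac)
    qed
    also have "\<dots> = e * c * quad \<delta> z powr ((N - \<alpha> - m) / 2 - k * q)"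
      by (simp only: e_eq)
    also have "\<dots> \<le> e * c * quad \<delta> z powr (- k - 1)"
      using m(4) e c Q1[of z] by (intro mult_left_mono powr_mono) (auto simp: field_simps)
    also have "\<dots> \<le> wave_operator u z" by (rule wave)
    finally show ?thesis .
  qed
  have "weak_solution \<alpha> p q (\<lambda>x. u (x, 0)) (\<lambda>x. time_deriv u (x, 0)) u"
    using p q conv by (intro smooth_weak_solution u_smooth ineq) auto
  moreover have "classical_solution \<alpha> p q (\<lambda>x. u (x, 0)) (\<lambda>x. time_deriv u (x, 0)) u"
    using conv by (intro smooth_classical_solution u_smooth ineq) auto
  moreover have "time_deriv u (x, 0) > 0" for x
  proof -
    have "time_deriv u (x, 0) = e * partial_deriv (0, 1) F (x, 0)"
      unfolding time_deriv_def u_def[abs_def] by (rule partial_deriv_cmult[OF F_smooth])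
    also have "partial_deriv (0, 1) F (x, 0) = 2 * k * \<delta> * quad \<delta> (x, 0) powr (- k - 1)"
      unfolding F_def[abs_def] using \<delta> by (subst partial_deriv_quad_powr) auto
    finally show ?thesis using \<delta> k e Q0[of "(x, 0)"] by simp
  qed
  ultimately show ?thesis using u_pos by blast
qed

section \<open>A smooth cutoff\<close>

text \<open>Each step of Horner's scheme costs a factor \<open>y\<close>, which half of the
  exponential rate absorbs; hence \<open>c\<close> is generalized in the induction.\<close>

lemma poly_exp_bound:
  fixes p :: "real poly"
  shows "c > 0 \<Longrightarrow> \<exists>C\<ge>0. \<forall>y\<ge>0. \<bar>poly p y\<bar> \<le> C * exp (c * y)"
proof (induction p arbitrary: c rule: pCons_induct)
  case (pCons a p)
  from pCons.IH[of "c / 2"] pCons.prems obtain C where C: "C \<ge> 0"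
    "\<And>y. y \<ge> 0 \<Longrightarrow> \<bar>poly p y\<bar> \<le> C * exp (c / 2 * y)" by auto
  have "\<bar>poly (pCons a p) y\<bar> \<le> (\<bar>a\<bar> + 2 / c * C) * exp (c * y)" if y: "y \<ge> 0" for y
  proof -
    have "c / 2 * y \<le> exp (c / 2 * y)" using exp_ge_add_one_self[of "c / 2 * y"] by linarith
    then have "y \<le> 2 / c * exp (c / 2 * y)" using pCons.prems by (simp add: field_simps)
    then have "y * \<bar>poly p y\<bar> \<le> (2 / c * exp (c / 2 * y)) * (C * exp (c / 2 * y))"
      using y C pCons.prems by (intro mult_mono) auto
    also have "\<dots> = 2 / c * C * exp (c * y)" by (simp add: mult_ac flip: exp_add)
    finally have "y * \<bar>poly p y\<bar> \<le> 2 / c * C * exp (c * y)" .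
    moreover have "\<bar>a\<bar> \<le> \<bar>a\<bar> * exp (c * y)"
      using y pCons.prems mult_left_mono[of 1 "exp (c * y)" "\<bar>a\<bar>"] by simp
    moreover have "\<bar>poly (pCons a p) y\<bar> \<le> \<bar>a\<bar> + y * \<bar>poly p y\<bar>"
      using y abs_triangle_ineq[of a "y * poly p y"] by (simp add: abs_mult)
    ultimately show ?thesis by (simp add: distrib_right)
  qed
  then show ?case using C(1) pCons.prems by (intro exI[of _ "\<bar>a\<bar> + 2 / c * C"]) auto
qed auto

text \<open>\<open>flat 1\<close> is the classical function \<open>exp (- 1 / s)\<close> extended by
  zero. The polynomials in \<open>1 / s\<close> are the factors created by differentiation, so the
  whole family is closed in the sense of \<open>smooth_compose\<close>.\<close>

definition flat :: "real poly \<Rightarrow> real \<Rightarrow> real" where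
  "flat p s = (if s > 0 then poly p (1 / s) * exp (- (1 / s)) else 0)"

text \<open>Multiplication by \<open>[:0, 0, 1:]\<close> stands for the factor
  \<open>1 / s\<^sup>2\<close> from the inner derivative of \<open>1 / s\<close>.\<close>

abbreviation flat_deriv :: "real poly \<Rightarrow> real poly" where
  "flat_deriv p \<equiv> [:0, 0, 1:] * (p - pderiv p)"

text \<open>A polynomial in \<open>1 / s\<close> grows more slowly than
  \<open>exp ((1 - \<theta>) / s)\<close>, so a derivative of \<open>flat 1\<close> costs only an
  arbitrarily small part of its exponent. The test function uses this with
  \<open>\<theta> = 1 / r\<close>.\<close>

lemma flat_bound:
  assumes "\<theta> < 1"
  shows "\<exists>C\<ge>0. \<forall>s. \<bar>flat p s\<bar> \<le> C * flat 1 s powr \<theta>"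
proof -
  obtain C where C: "C \<ge> 0" "\<And>y. y \<ge> 0 \<Longrightarrow> \<bar>poly p y\<bar> \<le> C * exp ((1 - \<theta>) * y)"
    using poly_exp_bound[of "1 - \<theta>" p] assms by auto
  have "\<bar>flat p s\<bar> \<le> C * flat 1 s powr \<theta>" for s
  proof (cases "s > 0")
    case True
    have "\<bar>flat p s\<bar> = \<bar>poly p (1 / s)\<bar> * exp (- (1 / s))"
      using True by (simp add: flat_def abs_mult)
    also have "\<dots> \<le> C * exp ((1 - \<theta>) * (1 / s)) * exp (- (1 / s))"
      using True by (intro mult_right_mono C) auto
    also have "exp ((1 - \<theta>) * (1 / s)) * exp (- (1 / s)) = exp (- \<theta> * (1 / s))"
      by (simp add: algebra_simps diff_divide_distrib flip: exp_add)
    then have "C * exp ((1 - \<theta>) * (1 / s)) * exp (- (1 / s)) = C * flat 1 s powr \<theta>"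
      using True by (simp add: flat_def powr_def mult.assoc)
    finally show ?thesis .
  qed (simp add: flat_def)
  with C(1) show ?thesis by blast
qed

lemma flat_has_derivative: "(flat p has_real_derivative flat (flat_deriv p) s) (at s)"
proof (cases s "0::real" rule: linorder_cases)
  case less
  have "((\<lambda>s. 0) has_real_derivative flat (flat_deriv p) s) (at s)"
    using less by (simp add: flat_def)
  then show ?thesis
    by (rule has_field_derivative_transform_within_open[where S = "{..<0}"]) (use less in \<open>auto simp: flat_def\<close>)
next
  case greater
  have "((\<lambda>s. poly p (1 / s) * exp (- (1 / s))) has_real_derivative flat (flat_deriv p) s) (at s)"
  proof -
    have inv: "((\<lambda>s. 1 / s) has_real_derivative - (1 / s\<^sup>2)) (at s)"
      using greater by (auto intro!: derivative_eq_intros simp: power2_eq_square)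
    have "((\<lambda>s. poly p (1 / s)) has_real_derivative poly (pderiv p) (1 / s) * (- (1 / s\<^sup>2))) (at s)"
      by (rule DERIV_chain2[OF poly_DERIV inv])
    from DERIV_mult[OF this DERIV_fun_exp[OF DERIV_minus[OF inv]]]
    have "((\<lambda>s. poly p (1 / s) * exp (- (1 / s))) has_real_derivative
        (1 / s\<^sup>2) * (poly p (1 / s) - poly (pderiv p) (1 / s)) * exp (- (1 / s))) (at s)"
      by (rule DERIV_cong) (simp add: algebra_simps)
    moreover have "flat (flat_deriv p) s = (1 / s\<^sup>2) * (poly p (1 / s) - poly (pderiv p) (1 / s)) * exp (- (1 / s))"
      using greater by (simp add: flat_def power2_eq_square)
    ultimately show ?thesis by simp
  qed
  then show ?thesis
    by (rule has_field_derivative_transform_within_open[where S = "{0<..}"]) (use greater in \<open>auto simp: flat_def\<close>)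
next
  case equal
  \<comment> \<open>With \<open>\<theta> = 0\<close> this bounds \<open>flat p h / h\<^sup>2\<close>
    for \<open>h > 0\<close>, and the difference quotient at 0 therefore tends to 0.\<close>
  from flat_bound[of 0 "[:0, 0, 1:] * p"] obtain C where C: "C \<ge> 0"
    "\<And>s. \<bar>flat ([:0, 0, 1:] * p) s\<bar> \<le> C * flat 1 s powr 0" by auto
  have sq: "\<bar>flat p h\<bar> \<le> C * h\<^sup>2" for h
  proof (cases "h > 0")
    case True
    have "flat p h = h\<^sup>2 * flat ([:0, 0, 1:] * p) h"
      using True by (simp add: flat_def power2_eq_square)
    then have "\<bar>flat p h\<bar> = h\<^sup>2 * \<bar>flat ([:0, 0, 1:] * p) h\<bar>" by (simp add: abs_mult)
    also have "\<bar>flat ([:0, 0, 1:] * p) h\<bar> \<le> C"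
      by (rule order_trans[OF C(2)]) (use C(1) in \<open>simp add: powr_def\<close>)
    finally show ?thesis by (simp add: mult.commute[of C] mult_left_mono)
  qed (use C in \<open>simp add: flat_def\<close>)
  have "((\<lambda>h. flat p h / h) \<longlongrightarrow> 0) (at 0)"
  proof (rule Lim_null_comparison)
    have "norm (flat p h / h) \<le> C * \<bar>h\<bar>" if "h \<noteq> 0" for h
    proof -
      have "\<bar>flat p h\<bar> \<le> (C * \<bar>h\<bar>) * \<bar>h\<bar>" using sq[of h] by (simp add: power2_eq_square mult.assoc flip: abs_mult)
      then show ?thesis using that by (simp add: abs_divide pos_divide_le_eq)
    qed
    then show "\<forall>\<^sub>F h in at 0. norm (flat p h / h) \<le> C * \<bar>h\<bar>"
      by (auto simp: eventually_at_filter)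
    show "((\<lambda>h. C * \<bar>h\<bar>) \<longlongrightarrow> 0) (at 0)" by (auto intro!: tendsto_eq_intros)
  qed
  then show ?thesis unfolding equal DERIV_def by (simp add: flat_def)
qed

lemma smooth_flat: "smooth Q \<Longrightarrow> smooth (\<lambda>z. flat p (Q z))"
  by (rule smooth_compose[where F = "range flat"]) (auto intro: flat_has_derivative)

lemma partial_deriv_flat:
  "smooth Q \<Longrightarrow> partial_deriv v (\<lambda>z. flat p (Q z)) z = flat (flat_deriv p) (Q z) * partial_deriv v Q z"
  by (intro partial_deriv_compose flat_has_derivative smooth_differentiable)

lemma flat_1_nonneg: "flat 1 s \<ge> 0"
  by (simp add: flat_def)

lemma flat_1_le: "s \<le> 1 \<Longrightarrow> flat 1 s \<le> exp (-1)"
  by (simp add: flat_def)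

lemma flat_1_ge: "s \<ge> 1 \<Longrightarrow> flat 1 s \<ge> exp (-1)"
  by (simp add: flat_def)

section \<open>The cutoff function and its wave operator\<close>

lemma smooth_norm_square: "smooth (\<lambda>z. z \<bullet> z)"
proof -
  have "(\<lambda>z::'a. z \<bullet> z) = (\<lambda>z. \<Sum>b\<in>Basis. (z \<bullet> b) * (z \<bullet> b))"
    by (auto simp: fun_eq_iff euclidean_inner[of "x::'a" x for x])
  then show ?thesis by (simp add: smooth_sum smooth_mult smooth_inner)
qed

text \<open>Composing two flat functions gives a plateau without a quotient of smooth functions.\<close>

definition cutoff_arg :: "'a::euclidean_space \<Rightarrow> real" where
  "cutoff_arg z = 1 - exp 1 * flat 1 (z \<bullet> z - 1)"

text \<open>The factors \<open>exp 1\<close> normalize \<open>flat 1 1 = exp (-1)\<close>. The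
  argument is 1 on the unit ball, where the inner function vanishes, and at most 0 as soon as
  \<open>z \<bullet> z \<ge> 2\<close>.\<close>

definition cutoff :: "'a::euclidean_space \<Rightarrow> real" where
  "cutoff z = exp 1 * flat 1 (cutoff_arg z)"

lemma smooth_cutoff_arg: "smooth cutoff_arg"
  unfolding cutoff_arg_def[abs_def]
  by (intro smooth_diff smooth_mult smooth_const smooth_flat smooth_norm_square)

lemma smooth_cutoff: "smooth cutoff"
  unfolding cutoff_def[abs_def] by (intro smooth_mult smooth_const smooth_flat smooth_cutoff_arg)

lemma cutoff_nonneg: "cutoff z \<ge> 0"
  by (simp add: cutoff_def flat_1_nonneg)

lemma cutoff_le_1: "cutoff z \<le> 1"
proof -
  have "cutoff z \<le> exp 1 * exp (-1)"
    unfolding cutoff_def using flat_1_nonneg[of "z \<bullet> z - 1"]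
    by (intro mult_left_mono flat_1_le) (auto simp: cutoff_arg_def)
  then show ?thesis by (simp flip: exp_add)
qed

lemma cutoff_eq_1: "norm z \<le> 1 \<Longrightarrow> cutoff z = 1"
  using abs_square_le_1[of "norm z"]
  by (simp add: cutoff_def cutoff_arg_def flat_def dot_square_norm flip: exp_add)

lemma cutoff_eq_0: "norm z \<ge> 2 \<Longrightarrow> cutoff z = 0"
proof -
  assume "norm z \<ge> 2"
  then have "z \<bullet> z - 1 \<ge> 1" using power_mono[of 2 "norm z" 2] by (simp add: dot_square_norm)
  then have "exp 1 * exp (-1) \<le> exp 1 * flat 1 (z \<bullet> z - 1)" by (intro mult_left_mono flat_1_ge) auto
  then have "cutoff_arg z \<le> 0" by (simp add: cutoff_arg_def flip: exp_add)
  then show ?thesis by (simp add: cutoff_def flat_def)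
qed

text \<open>The cutoff depends on \<open>z \<bullet> z\<close> only, whose time derivative vanishes
  at \<open>t = 0\<close>. This removes \<open>u0\<close> from the weak inequality.\<close>

lemma time_deriv_cutoff: "time_deriv cutoff (x, 0) = 0"
proof -
  have "partial_deriv (0, 1) (\<lambda>z::'a \<times> real. z \<bullet> z) (x, 0) = 0"
    by (rule partial_derivI) (auto intro!: derivative_eq_intros)
  then have "partial_deriv (0, 1) (\<lambda>z::'a \<times> real. z \<bullet> z - 1) (x, 0) = 0"
    by (subst partial_deriv_diff) (auto intro!: smooth_differentiable smooth_norm_square)
  then have "partial_deriv (0, 1) (\<lambda>z::'a \<times> real. flat 1 (z \<bullet> z - 1)) (x, 0) = 0"
    by (subst partial_deriv_flat) (auto intro!: smooth_diff smooth_const smooth_norm_square)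
  moreover have "smooth (\<lambda>z::'a \<times> real. flat 1 (z \<bullet> z - 1))"
    by (intro smooth_flat smooth_diff smooth_const smooth_norm_square)
  ultimately have "partial_deriv (0, 1) (cutoff_arg :: 'a \<times> real \<Rightarrow> real) (x, 0) = 0"
    unfolding cutoff_arg_def[abs_def]
    by (subst partial_deriv_diff)
      (auto intro!: smooth_differentiable smooth_mult smooth_const simp: partial_deriv_cmult)
  then show ?thesis
    by (simp add: time_deriv_def cutoff_def[abs_def] partial_deriv_cmult smooth_flat
        smooth_cutoff_arg partial_deriv_flat)
qed

lemma wave_operator_cutoff_plateau:
  assumes "norm z < 1"
  shows "wave_operator cutoff z = 0"
proof -
  have "partial_deriv v cutoff w = 0" if "w \<in> ball 0 1" for v w
    by (rule partial_deriv_locally_const[OF open_ball that]) (auto intro: cutoff_eq_1)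
  then have "partial_deriv v (partial_deriv v cutoff) z = 0" for v
    using assms by (intro partial_deriv_locally_const[where S = "ball 0 1"]) auto
  then show ?thesis by (simp add: wave_operator_def time_deriv_def laplacian_def)
qed

lemma bounded_on_cball:
  assumes "continuous_on UNIV (f :: 'a::euclidean_space \<Rightarrow> real)"
  obtains B where "B \<ge> 0" "\<And>z. norm z \<le> r \<Longrightarrow> \<bar>f z\<bar> \<le> B"
proof -
  have "bounded (f ` cball 0 r)"
    by (intro compact_imp_bounded compact_continuous_image continuous_on_subset[OF assms]) auto
  then obtain B where B: "\<forall>z\<in>cball 0 r. \<bar>f z\<bar> \<le> B" by (auto simp: bounded_iff)
  show ?thesis by (rule that[of "max B 0"]) (use B in \<open>auto intro: max.coboundedI1\<close>)
qed

text \<open>Each term of the second derivative contains a member of the \<open>flat\<close> family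
  at \<open>cutoff_arg z\<close>, to which \<open>flat_bound\<close> applies. The remaining factors
  are continuous, hence bounded on the ball of radius 2, and outside that ball everything
  vanishes.\<close>

lemma second_partial_deriv_cutoff_bound:
  fixes b :: "'a::euclidean_space"
  assumes b: "b \<in> Basis" and \<theta>: "\<theta> < 1"
  shows "\<exists>C\<ge>0. \<forall>z. \<bar>partial_deriv b (partial_deriv b cutoff) z\<bar> \<le> C * cutoff z powr \<theta>"
proof -
  let ?Q = "cutoff_arg :: 'a \<Rightarrow> real"
  let ?p1 = "flat_deriv 1" and ?p2 = "flat_deriv (flat_deriv 1)"
  note Q = smooth_cutoff_arg[where 'a = 'a]
  obtain C1 where C1: "C1 \<ge> 0" "\<And>s. \<bar>flat ?p1 s\<bar> \<le> C1 * flat 1 s powr \<theta>"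
    using flat_bound[OF \<theta>, of ?p1] by blast
  obtain C2 where C2: "C2 \<ge> 0" "\<And>s. \<bar>flat ?p2 s\<bar> \<le> C2 * flat 1 s powr \<theta>"
    using flat_bound[OF \<theta>, of ?p2] by blast
  obtain B1 where B1: "B1 \<ge> 0" "\<And>z. norm z \<le> 2 \<Longrightarrow> \<bar>partial_deriv b ?Q z\<bar> \<le> B1"
    using bounded_on_cball[OF smooth_continuous[OF smooth_partial[OF Q b]], of 2] by metis
  obtain B2 where B2: "B2 \<ge> 0" "\<And>z. norm z \<le> 2 \<Longrightarrow> \<bar>partial_deriv b (partial_deriv b ?Q) z\<bar> \<le> B2"
    using bounded_on_cball[OF smooth_continuous[OF smooth_partial[OF smooth_partial[OF Q b] b]], of 2] by metis
  \<comment> \<open>Dividing by \<open>exp \<theta>\<close> compensates for \<open>cutoff z powr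
    \<theta> = exp \<theta> * flat 1 (cutoff_arg z) powr \<theta>\<close>.\<close>
  define C where "C = exp 1 * (C2 * (B1 * B1) + C1 * B2) / exp \<theta>"
  have d1: "partial_deriv b cutoff = (\<lambda>z. exp 1 * (flat ?p1 (?Q z) * partial_deriv b ?Q z))"
  proof
    fix z
    show "partial_deriv b cutoff z = exp 1 * (flat ?p1 (?Q z) * partial_deriv b ?Q z)"
      unfolding cutoff_def[abs_def] partial_deriv_cmult[OF smooth_flat[OF Q]] partial_deriv_flat[OF Q] ..
  qed
  have d2: "partial_deriv b (partial_deriv b cutoff) z = exp 1 * (flat ?p2 (?Q z) * partial_deriv b ?Q z * partial_deriv b ?Q z
      + flat ?p1 (?Q z) * partial_deriv b (partial_deriv b ?Q) z)" for z
    unfolding d1 partial_deriv_cmult[OF smooth_mult[OF smooth_flat[OF Q] smooth_partial[OF Q b]]]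
      partial_deriv_mult[OF smooth_differentiable[OF smooth_flat[OF Q]] smooth_differentiable[OF smooth_partial[OF Q b]]]
      partial_deriv_flat[OF Q] ..
  have "\<bar>partial_deriv b (partial_deriv b cutoff) z\<bar> \<le> C * cutoff z powr \<theta>" for z :: 'a
  proof (cases "norm z \<le> 2")
    case True
    have "\<bar>flat ?p2 (?Q z) * partial_deriv b ?Q z * partial_deriv b ?Q z\<bar> \<le> C2 * flat 1 (?Q z) powr \<theta> * (B1 * B1)"
    proof -
      have "\<bar>partial_deriv b ?Q z\<bar> * \<bar>partial_deriv b ?Q z\<bar> \<le> B1 * B1"
        using True B1 by (intro mult_mono) auto
      then have "\<bar>flat ?p2 (?Q z)\<bar> * (\<bar>partial_deriv b ?Q z\<bar> * \<bar>partial_deriv b ?Q z\<bar>)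
          \<le> C2 * flat 1 (?Q z) powr \<theta> * (B1 * B1)"
        using C2(1) by (intro mult_mono[OF C2(2)]) auto
      then show ?thesis by (simp only: abs_mult mult.assoc)
    qed
    moreover have "\<bar>flat ?p1 (?Q z) * partial_deriv b (partial_deriv b ?Q) z\<bar> \<le> C1 * flat 1 (?Q z) powr \<theta> * B2"
      unfolding abs_mult using True C1 B2 by (intro mult_mono) auto
    ultimately have "\<bar>partial_deriv b (partial_deriv b cutoff) z\<bar>
        \<le> exp 1 * (C2 * flat 1 (?Q z) powr \<theta> * (B1 * B1) + C1 * flat 1 (?Q z) powr \<theta> * B2)"
      unfolding d2 abs_mult[of "exp 1"] abs_exp_cancel
      by (intro mult_left_mono order_trans[OF abs_triangle_ineq] add_mono) auto
    also have "\<dots> = C * (exp 1 powr \<theta> * flat 1 (?Q z) powr \<theta>)"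
      by (simp add: C_def powr_def field_simps)
    also have "exp 1 powr \<theta> * flat 1 (?Q z) powr \<theta> = cutoff z powr \<theta>"
      unfolding cutoff_def using flat_1_nonneg[of "?Q z"] by (simp add: powr_mult)
    finally show ?thesis .
  next
    case False
    then have "partial_deriv b (partial_deriv b cutoff) z = 0"
      by (intro partial_deriv_zero[where r = 2]) (auto intro: cutoff_eq_0)
    then show ?thesis using C1 C2 B1 B2 by (simp add: C_def)
  qed
  moreover have "C \<ge> 0" using C1 C2 B1 B2 by (simp add: C_def)
  ultimately show ?thesis by blast
qed

text \<open>With \<open>\<theta> = 1 / r\<close>, the \<open>r\<close>-th power of \<open>w\<close>
  times this bound is proportional to \<open>w powr r * cutoff\<close>, the density of the
  energy.\<close>

lemma wave_operator_cutoff_bound: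
  assumes \<theta>: "\<theta> < 1"
  shows "\<exists>C>0. \<forall>z::'a::euclidean_space \<times> real. \<bar>wave_operator cutoff z\<bar> \<le> C * cutoff z powr \<theta>"
proof -
  have "\<forall>b\<in>Basis. \<exists>C\<ge>0. \<forall>z::'a \<times> real. \<bar>partial_deriv b (partial_deriv b cutoff) z\<bar> \<le> C * cutoff z powr \<theta>"
    using second_partial_deriv_cutoff_bound[OF _ \<theta>] by blast
  from bchoice[OF this] obtain C where C: "\<And>b. b \<in> Basis \<Longrightarrow> C b \<ge> 0"
    "\<And>b z. b \<in> Basis \<Longrightarrow> \<bar>partial_deriv b (partial_deriv b cutoff) (z::'a \<times> real)\<bar> \<le> C b * cutoff z powr \<theta>"
    by blast
  let ?C = "C (0, 1) + (\<Sum>b\<in>Basis. C (b, 0))"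
  have C_nonneg: "?C \<ge> 0" by (intro add_nonneg_nonneg sum_nonneg C Basis_pair)
  \<comment> \<open>The added 1 makes the constant positive, as the later choice of parameters
    divides by it.\<close>
  have "\<bar>wave_operator cutoff z\<bar> \<le> (?C + 1) * cutoff z powr \<theta>" for z :: "'a \<times> real"
  proof -
    have "\<bar>wave_operator cutoff z\<bar> \<le> \<bar>time_deriv (time_deriv cutoff) z\<bar>
        + (\<Sum>b\<in>Basis. \<bar>partial_deriv (b, 0) (partial_deriv (b, 0) cutoff) z\<bar>)"
      unfolding wave_operator_def laplacian_def by (rule order_trans[OF abs_triangle_ineq4]) (simp add: sum_abs)
    also have "\<dots> \<le> C (0, 1) * cutoff z powr \<theta> + (\<Sum>b\<in>Basis. C (b, 0) * cutoff z powr \<theta>)"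
      unfolding time_deriv_def by (intro add_mono sum_mono C Basis_pair)
    also have "\<dots> \<le> (?C + 1) * cutoff z powr \<theta>"
      by (simp add: distrib_right sum_distrib_right)
    finally show ?thesis .
  qed
  then show ?thesis using C_nonneg by (intro exI[of _ "?C + 1"]) auto
qed

lemma test_function_cutoff:
  assumes R: "R > 0"
  shows "test_function (\<lambda>z::'a::euclidean_space. cutoff ((1 / R) *\<^sub>R z))"
  unfolding test_function_def smooth_def[symmetric]
proof
  show "smooth (\<lambda>z::'a. cutoff ((1 / R) *\<^sub>R z))" by (rule smooth_scale(1)[OF smooth_cutoff])
  have "{z::'a. cutoff ((1 / R) *\<^sub>R z) \<noteq> 0} \<subseteq> cball 0 (2 * R)"
  proof
    fix z :: 'a assume "z \<in> {z. cutoff ((1 / R) *\<^sub>R z) \<noteq> 0}"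
    then have "\<not> norm ((1 / R) *\<^sub>R z) \<ge> 2" using cutoff_eq_0 by blast
    then show "z \<in> cball 0 (2 * R)" using R by (simp add: field_simps)
  qed
  then show "compact (closure {z::'a. cutoff ((1 / R) *\<^sub>R z) \<noteq> 0})"
    by (meson bounded_cball bounded_subset compact_closure)
qed

lemma wave_operator_scale:
  fixes f :: "'a::euclidean_space \<times> real \<Rightarrow> real"
  assumes f: "smooth f"
  shows "wave_operator (\<lambda>z. f (c *\<^sub>R z)) z = c\<^sup>2 * wave_operator f (c *\<^sub>R z)"
    and "time_deriv (\<lambda>z. f (c *\<^sub>R z)) z = c * time_deriv f (c *\<^sub>R z)"
proof -
  have "partial_deriv v (partial_deriv v (\<lambda>z. f (c *\<^sub>R z))) z = c\<^sup>2 * partial_deriv v (partial_deriv v f) (c *\<^sub>R z)"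
    if v: "v \<in> Basis" for v
  proof -
    have "partial_deriv v (\<lambda>z. c * partial_deriv v f (c *\<^sub>R z)) z
        = c * partial_deriv v (\<lambda>z. partial_deriv v f (c *\<^sub>R z)) z"
      by (intro partial_deriv_cmult smooth_scale(1) smooth_partial f v)
    also have "\<dots> = c * (c * partial_deriv v (partial_deriv v f) (c *\<^sub>R z))"
      by (simp only: smooth_scale(2)[OF smooth_partial[OF f v]])
    finally show ?thesis by (simp add: smooth_scale(2)[OF f] power2_eq_square)
  qed
  then show "wave_operator (\<lambda>z. f (c *\<^sub>R z)) z = c\<^sup>2 * wave_operator f (c *\<^sub>R z)"
    by (simp add: wave_operator_def time_deriv_def laplacian_def Basis_pair right_diff_distrib sum_distrib_left)
  show "time_deriv (\<lambda>z. f (c *\<^sub>R z)) z = c * time_deriv f (c *\<^sub>R z)"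
    by (simp add: time_deriv_def smooth_scale(2)[OF f])
qed

section \<open>Nonexistence\<close>

lemma measurable_slice:
  assumes "f \<in> borel_measurable (borel :: ('a::euclidean_space \<times> real) measure)"
  shows "(\<lambda>x. f (x, t)) \<in> borel_measurable borel"
  by (rule measurable_compose[OF _ assms])
    (auto intro!: borel_measurable_continuous_onI continuous_intros)

lemma nn_integral_time_space:
  fixes f :: "'a::euclidean_space \<times> real \<Rightarrow> ennreal"
  assumes f: "f \<in> borel_measurable borel"
  shows "(\<integral>\<^sup>+z. f z \<partial>lborel) = (\<integral>\<^sup>+t. (\<integral>\<^sup>+x. f (x, t) \<partial>lborel) \<partial>lborel)"
    and "(\<lambda>t. \<integral>\<^sup>+x. f (x, t) \<partial>lborel) \<in> borel_measurable borel"
proof -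
  have f': "f \<in> borel_measurable (lborel \<Otimes>\<^sub>M lborel)" using f by (simp add: lborel_prod)
  show "(\<integral>\<^sup>+z. f z \<partial>lborel) = (\<integral>\<^sup>+t. (\<integral>\<^sup>+x. f (x, t) \<partial>lborel) \<partial>lborel)"
    using lborel_pair.nn_integral_snd[OF f'] by (simp add: lborel_prod)
  show "(\<lambda>t. \<integral>\<^sup>+x. f (x, t) \<partial>lborel) \<in> borel_measurable borel"
    using lborel.borel_measurable_nn_integral[of "\<lambda>t x. f (x, t)" borel] measurable_pair_swap[OF f']
      measurable_cong_sets[OF sets_pair_measure_cong[OF sets_lborel refl] refl]
    by (simp add: split_beta')
qed

lemma AE_time_space:
  assumes "AE z in lborel. P (z :: 'a::euclidean_space \<times> real)"
  shows "AE t in lborel. AE x in lborel. P (x, t)"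
proof -
  \<comment> \<open>Exchanging the two quantifiers requires a measurable exceptional set, so
    \<open>P\<close> is replaced by the avoidance of a Borel null set.\<close>
  obtain N where N: "{z \<in> space lborel. \<not> P z} \<subseteq> N" "N \<in> null_sets lborel"
    using assms by (auto elim!: AE_E simp: null_sets_def)
  have Nb: "N \<in> sets (lborel \<Otimes>\<^sub>M lborel)" using N(2) unfolding lborel_prod by blast
  have "AE z in lborel \<Otimes>\<^sub>M lborel. z \<notin> N" unfolding lborel_prod by (rule AE_not_in[OF N(2)])
  then have "AE x in lborel. AE t in lborel. (x, t) \<notin> N" by (rule lborel_pair.AE_pair)
  moreover have "{z \<in> space (lborel \<Otimes>\<^sub>M lborel). (fst z, snd z) \<notin> N} = space (lborel \<Otimes>\<^sub>M lborel) - N"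
    by auto
  then have "{z \<in> space (lborel \<Otimes>\<^sub>M lborel). (fst z, snd z) \<notin> N} \<in> sets (lborel \<Otimes>\<^sub>M lborel)"
    using sets.compl_sets[OF Nb] by (simp only:)
  ultimately have "AE t in lborel. AE x in lborel. (x, t) \<notin> N"
    using lborel_pair.AE_commute[of "\<lambda>x t. (x, t) \<notin> N"] by simp
  then show ?thesis
    using N(1) by (auto elim!: eventually_mono simp: subset_iff)
qed

text \<open>In \<open>ennreal\<close> a divergent convolution is infinite instead of 0, so it can be
  estimated from below before its finiteness is known. It is meant for \<open>w \<ge> 0\<close>,
  hence without absolute value.\<close>

definition riesz_nn :: "real \<Rightarrow> real \<Rightarrow> ('a::euclidean_space \<times> real \<Rightarrow> real) \<Rightarrow> 'a \<times> real \<Rightarrow> ennreal" where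
  "riesz_nn \<alpha> p w z = (\<integral>\<^sup>+y. ennreal (norm (fst z - y) powr (-\<alpha>) * w (y, snd z) powr p) \<partial>lborel)"

lemma riesz_nn_measurable:
  fixes w :: "'a::euclidean_space \<times> real \<Rightarrow> real"
  assumes w: "w \<in> borel_measurable borel"
  shows "riesz_nn \<alpha> p w \<in> borel_measurable borel"
proof -
  have "(\<lambda>v. w (snd v, snd (fst v))) \<in> borel_measurable ((borel :: ('a \<times> real) measure) \<Otimes>\<^sub>M (borel :: 'a measure))"
    unfolding borel_prod
    by (rule measurable_compose[OF _ w]) (auto intro!: borel_measurable_continuous_onI continuous_intros)
  moreover have "(\<lambda>v. norm (fst (fst v) - snd v)) \<in> borel_measurable ((borel :: ('a \<times> real) measure) \<Otimes>\<^sub>M (borel :: 'a measure))"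
    unfolding borel_prod by (auto intro!: borel_measurable_continuous_onI continuous_intros)
  ultimately have "(\<lambda>v. ennreal (norm (fst (fst v) - snd v) powr (-\<alpha>) * w (snd v, snd (fst v)) powr p))
      \<in> borel_measurable ((borel :: ('a \<times> real) measure) \<Otimes>\<^sub>M (borel :: 'a measure))"
    by (intro measurable_compose[OF _ measurable_ennreal] borel_measurable_times powr_real_measurable borel_measurable_const)
  also have "borel_measurable ((borel :: ('a \<times> real) measure) \<Otimes>\<^sub>M (borel :: 'a measure))
      = borel_measurable ((borel :: ('a \<times> real) measure) \<Otimes>\<^sub>M lborel)"
    by (intro measurable_cong_sets sets_pair_measure_cong) auto
  finally show ?thesis
    unfolding riesz_nn_def[abs_def]
    by (intro lborel.borel_measurable_nn_integral) (simp add: split_beta')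
qed

text \<open>On the support of \<open>\<phi>\<close> the Riesz kernel is at least \<open>(4R)\<^bsup>-\<alpha>\<^esup>\<close>; the two remaining factors are
  combined by the Cauchy--Schwarz inequality in space.\<close>

lemma riesz_energy_lower_bound:
  fixes w \<phi> :: "'a::euclidean_space \<times> real \<Rightarrow> real"
  assumes w: "w \<in> borel_measurable borel" "\<And>z. w z \<ge> 0"
    and \<phi>: "\<phi> \<in> borel_measurable borel" "\<And>z. \<phi> z \<ge> 0" "\<And>z. \<phi> z \<le> 1"
    and supp: "\<And>x t. \<phi> (x, t) \<noteq> 0 \<Longrightarrow> norm x \<le> 2 * R"
    and R: "R > 0" and \<alpha>: "\<alpha> > 0"
  shows "ennreal ((4 * R) powr (-\<alpha>)) * (\<integral>\<^sup>+t. (\<integral>\<^sup>+x. ennreal (w (x, t) powr ((p + q) / 2) * \<phi> (x, t)) \<partial>lborel)\<^sup>2 \<partial>lborel)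
    \<le> (\<integral>\<^sup>+z. riesz_nn \<alpha> p w z * ennreal (w z powr q * \<phi> z) \<partial>lborel)"
proof -
  let ?c = "(4 * R) powr (-\<alpha>)"
  let ?J = "\<lambda>t. \<integral>\<^sup>+x. ennreal (w (x, t) powr ((p + q) / 2) * \<phi> (x, t)) \<partial>lborel"
  note [measurable] = w(1) \<phi>(1) riesz_nn_measurable[OF w(1)] measurable_slice[OF w(1)] measurable_slice[OF \<phi>(1)]
    measurable_slice[OF riesz_nn_measurable[OF w(1)]]
  have slice: "ennreal ?c * (?J t)\<^sup>2 \<le> (\<integral>\<^sup>+x. riesz_nn \<alpha> p w (x, t) * ennreal (w (x, t) powr q * \<phi> (x, t)) \<partial>lborel)" for t
  proof -
    define P where "P = (\<integral>\<^sup>+x. ennreal (w (x, t) powr p * \<phi> (x, t)) \<partial>lborel)"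
    define Q where "Q = (\<integral>\<^sup>+x. ennreal (w (x, t) powr q * \<phi> (x, t)) \<partial>lborel)"
    \<comment> \<open>The weight is split evenly as \<open>sqrt \<phi>\<close> times
      \<open>sqrt \<phi>\<close>: the squares of \<open>f p\<close> and \<open>f q\<close> have
      integrals \<open>P\<close> and \<open>Q\<close>, and their product has integral
      \<open>?J t\<close>.\<close>
    define f where "f s x = ennreal (w (x, t) powr (s / 2) * sqrt (\<phi> (x, t)))" for s x
    have f2: "f s x ^ 2 = ennreal (w (x, t) powr s * \<phi> (x, t))" for s x
    proof -
      have "(w (x, t) powr (s / 2) * sqrt (\<phi> (x, t)))\<^sup>2 = w (x, t) powr s * \<phi> (x, t)"
      proof -
        have "(w (x, t) powr (s / 2))\<^sup>2 = w (x, t) powr s"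
          by (simp add: power2_eq_square powr_add[symmetric])
        then show ?thesis using \<phi>(2)[of "(x, t)"] by (simp add: power_mult_distrib)
      qed
      then show ?thesis using \<phi>(2)[of "(x, t)"] by (simp add: f_def ennreal_power)
    qed
    have fg: "f p x * f q x = ennreal (w (x, t) powr ((p + q) / 2) * \<phi> (x, t))" for x
    proof -
      have "w (x, t) powr (p / 2) * sqrt (\<phi> (x, t)) * (w (x, t) powr (q / 2) * sqrt (\<phi> (x, t)))
          = (w (x, t) powr (p / 2) * w (x, t) powr (q / 2)) * (sqrt (\<phi> (x, t)) * sqrt (\<phi> (x, t)))"
        by (simp only: mult_ac)
      also have "\<dots> = w (x, t) powr ((p + q) / 2) * \<phi> (x, t)"
        using \<phi>(2)[of "(x, t)"] by (simp add: powr_add[symmetric] add_divide_distrib)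
      finally show ?thesis using \<phi>(2)[of "(x, t)"] by (simp add: f_def ennreal_mult[symmetric])
    qed
    have f_meas: "f s \<in> borel_measurable lborel" for s unfolding f_def by measurable
    have "(?J t)\<^sup>2 \<le> P * Q"
      using Cauchy_Schwarz_nn_integral[OF f_meas[of p] f_meas[of q]] by (simp add: f2 fg P_def Q_def)
    then have "ennreal ?c * (?J t)\<^sup>2 \<le> ennreal ?c * P * Q"
      by (simp add: mult.assoc mult_left_mono)
    also have "\<dots> = (\<integral>\<^sup>+x. ennreal ?c * P * ennreal (w (x, t) powr q * \<phi> (x, t)) \<partial>lborel)"
      unfolding Q_def by (rule nn_integral_cmult[symmetric]) measurable
    also have "\<dots> \<le> (\<integral>\<^sup>+x. riesz_nn \<alpha> p w (x, t) * ennreal (w (x, t) powr q * \<phi> (x, t)) \<partial>lborel)"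
    proof (rule nn_integral_mono)
      fix x
      show "ennreal ?c * P * ennreal (w (x, t) powr q * \<phi> (x, t)) \<le> riesz_nn \<alpha> p w (x, t) * ennreal (w (x, t) powr q * \<phi> (x, t))"
      proof (cases "\<phi> (x, t) = 0")
        case False
        have "ennreal ?c * P = (\<integral>\<^sup>+y. ennreal ?c * ennreal (w (y, t) powr p * \<phi> (y, t)) \<partial>lborel)"
          unfolding P_def by (rule nn_integral_cmult[symmetric]) measurable
        also have "\<dots> \<le> riesz_nn \<alpha> p w (x, t)"
          unfolding riesz_nn_def fst_conv snd_conv
        proof (rule nn_integral_mono_AE)
          \<comment> \<open>At \<open>y = x\<close> the kernel is
            \<open>0 powr (- \<alpha>) = 0\<close> and the lower bound may fail.\<close>
          show "AE y in lborel. ennreal ?c * ennreal (w (y, t) powr p * \<phi> (y, t))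
              \<le> ennreal (norm (x - y) powr (-\<alpha>) * w (y, t) powr p)"
            using AE_lborel_singleton[of x]
          proof eventually_elim
            case (elim y)
            have "?c * (w (y, t) powr p * \<phi> (y, t)) \<le> norm (x - y) powr (-\<alpha>) * w (y, t) powr p"
            proof (cases "\<phi> (y, t) = 0")
              case y: False
              have "norm (x - y) \<le> 4 * R"
                using supp[OF False] supp[OF y] norm_triangle_ineq4[of x y] by linarith
              then have "?c \<le> norm (x - y) powr (-\<alpha>)"
                using elim \<alpha> by (intro powr_mono2') auto
              moreover have "w (y, t) powr p * \<phi> (y, t) \<le> w (y, t) powr p * 1"
                by (intro mult_left_mono \<phi>) simp
              ultimately show ?thesis using \<phi>(2)[of "(y, t)"] by (intro mult_mono) auto
            qed simp
            then show ?case by (simp add: ennreal_mult'[symmetric] ennreal_leI)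
          qed
        qed
        finally show ?thesis by (rule mult_right_mono) simp
      qed simp
    qed
    finally show ?thesis .
  qed
  have "ennreal ?c * (\<integral>\<^sup>+t. (?J t)\<^sup>2 \<partial>lborel) = (\<integral>\<^sup>+t. ennreal ?c * (?J t)\<^sup>2 \<partial>lborel)"
  proof (rule nn_integral_cmult[symmetric])
    have "?J \<in> borel_measurable borel"
      by (rule nn_integral_time_space(2)) measurable
    then show "(\<lambda>t. (?J t)\<^sup>2) \<in> borel_measurable lborel" by measurable
  qed
  also have "\<dots> \<le> (\<integral>\<^sup>+t. (\<integral>\<^sup>+x. riesz_nn \<alpha> p w (x, t) * ennreal (w (x, t) powr q * \<phi> (x, t)) \<partial>lborel) \<partial>lborel)"
    by (intro nn_integral_mono slice)
  also have "\<dots> = (\<integral>\<^sup>+z. riesz_nn \<alpha> p w z * ennreal (w z powr q * \<phi> z) \<partial>lborel)"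
    by (rule nn_integral_time_space(1)[symmetric]) measurable
  finally show ?thesis .
qed

text \<open>Either \<open>y \<le> 1 / \<kappa>\<close>, or
  \<open>(\<kappa> * y) powr (r - 1) \<ge> 1\<close> and \<open>y\<close> may be multiplied by it.
  The scaling in \<open>\<kappa>\<close> is that of Young's inequality, with simpler
  constants.\<close>

lemma young_truncated:
  fixes \<kappa> r y :: real
  assumes "\<kappa> > 0" "r \<ge> 1" "y \<ge> 0"
  shows "y \<le> \<kappa> powr (r - 1) * y powr r + 1 / \<kappa>"
proof (cases "\<kappa> * y \<le> 1")
  case True
  then have "y \<le> 1 / \<kappa>" using assms by (simp add: field_simps)
  then show ?thesis by (simp add: add_increasing)
next
  case False
  then have y: "y > 0" using assms by (cases "y = 0") auto
  have "(\<kappa> * y) powr 1 \<le> (\<kappa> * y) powr r" using False assms by (intro powr_mono) auto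
  then have "\<kappa> * y \<le> \<kappa> * (\<kappa> powr (r - 1) * y powr r)"
    using assms y by (simp add: powr_mult powr_diff)
  then have "y \<le> \<kappa> powr (r - 1) * y powr r" using assms(1) by simp
  then show ?thesis using assms(1) by (simp add: add_increasing2)
qed

text \<open>The previous inequality for \<open>r = 2\<close>, extended to infinite \<open>j\<close>
  because slice integrals may diverge.\<close>

lemma linear_le_square_ennreal:
  fixes j :: ennreal
  assumes "\<mu> > 0"
  shows "j \<le> ennreal \<mu> * j\<^sup>2 + ennreal (1 / \<mu>)"
proof (cases j)
  case (real c)
  have "c \<le> \<mu> powr (2 - 1) * c powr 2 + 1 / \<mu>"
    using assms real by (intro young_truncated) auto
  then have "c \<le> \<mu> * c\<^sup>2 + 1 / \<mu>"
    using assms real(1) by (cases "c = 0") (auto simp: powr_numeral)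
  then have "ennreal c \<le> ennreal (\<mu> * c\<^sup>2 + 1 / \<mu>)"
    by (rule ennreal_leI)
  also have "\<dots> = ennreal \<mu> * (ennreal c)\<^sup>2 + ennreal (1 / \<mu>)"
    using assms real(1) by (subst ennreal_plus) (auto simp: ennreal_mult ennreal_power)
  finally show ?thesis using real by simp
next
  case top
  then show ?thesis using assms by (simp add: power2_eq_square ennreal_mult_top)
qed

text \<open>In space, Young's inequality turns \<open>w * \<psi>\<close> into
  \<open>w powr r * \<phi>\<close> at the cost of \<open>1 / \<kappa>\<close> on a ball of radius
  \<open>2 * R\<close>. In time, it turns the slice integral into its square at the cost of
  \<open>1 / \<mu>\<close> on an interval of length \<open>2 * R\<close>. These costs form the last
  summand.\<close>

lemma linear_term_upper_bound:
  fixes w \<phi> \<psi> :: "'a::euclidean_space \<times> real \<Rightarrow> real"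
  assumes w: "w \<in> borel_measurable borel" "\<And>z. w z \<ge> 0" "\<And>x t. t \<le> 0 \<Longrightarrow> w (x, t) = 0"
    and \<phi>: "\<phi> \<in> borel_measurable borel" "\<And>z. \<phi> z \<ge> 0"
    and supp: "\<And>z. norm z > 2 * R \<Longrightarrow> \<phi> z = 0"
    and \<psi>: "\<And>z. \<psi> z \<le> c * \<phi> z powr (1 / r)" "\<And>z. norm z < R \<Longrightarrow> \<psi> z = 0"
    and pos: "R > 0" "c > 0" "r > 1" "\<kappa> > 0" "\<mu> > 0"
  shows "(\<integral>\<^sup>+z. ennreal (w z * \<psi> z) \<partial>lborel)
    \<le> ennreal (c * \<kappa> powr (r - 1) * \<mu>) *
        (\<integral>\<^sup>+t. (\<integral>\<^sup>+x. ennreal (indicator {z. norm z \<ge> R} (x, t) * (w (x, t) powr r * \<phi> (x, t))) \<partial>lborel)\<^sup>2 \<partial>lborel)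
      + ennreal (c * (2 * R) * (\<kappa> powr (r - 1) / \<mu> + unit_ball_vol DIM('a) * (2 * R) ^ DIM('a) / \<kappa>))"
proof -
  let ?H = "\<lambda>z. indicator {z. norm z \<ge> R} z * (w z powr r * \<phi> z)"
  define J where "J t = (\<integral>\<^sup>+x. ennreal (?H (x, t)) \<partial>lborel)" for t
  let ?V = "unit_ball_vol DIM('a) * (2 * R) ^ DIM('a)"
  let ?c1 = "c * \<kappa> powr (r - 1)"
  note [measurable] = w(1) \<phi>(1)
  have Hm [measurable]: "(\<lambda>z. ennreal (?H z)) \<in> borel_measurable borel"
  proof -
    have [measurable]: "{z::'a \<times> real. norm z \<ge> R} \<in> sets borel"
      by (intro borel_closed closed_Collect_le continuous_intros)
    show ?thesis by measurable
  qed
  have J_meas [measurable]: "J \<in> borel_measurable borel"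
    unfolding J_def[abs_def] by (rule nn_integral_time_space(2)[OF Hm])
  have ball_meas [measurable]: "cball (0::'a) (2 * R) \<in> sets borel" by (intro borel_closed closed_cball)
  have H_nonneg: "?H z \<ge> 0" for z using \<phi>(2)[of z] by simp
  have pt: "ennreal (w (x, t) * \<psi> (x, t)) \<le> ennreal ?c1 * ennreal (?H (x, t))
      + ennreal (c / \<kappa>) * indicator {0..2 * R} t * indicator (cball 0 (2 * R)) x" for x t
  proof (cases "\<phi> (x, t) = 0 \<or> norm (x, t) < R \<or> w (x, t) = 0")
    case True
    \<comment> \<open>Only an upper bound on \<open>\<psi>\<close> is given; a nonpositive product
      is truncated to 0 by \<open>ennreal\<close>.\<close>
    have "w (x, t) * \<psi> (x, t) \<le> 0"
      using True \<psi>(1)[of "(x, t)"] \<psi>(2)[of "(x, t)"] w(2)[of "(x, t)"] by (auto simp: mult_nonneg_nonpos)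
    then show ?thesis by (simp add: ennreal_neg)
  next
    case False
    have "\<not> norm (x, t) > 2 * R" "\<not> t \<le> 0" using False supp w(3) by blast+
    with False have n: "norm (x, t) \<le> 2 * R" "norm (x, t) \<ge> R" and t: "t > 0"
      by auto
    have x: "norm x \<le> 2 * R" "t \<le> 2 * R"
      using n(1) norm_fst_le[of x t] norm_snd_le[of t x] t by auto
    have "w (x, t) * \<psi> (x, t) \<le> w (x, t) * (c * \<phi> (x, t) powr (1 / r))"
      by (intro mult_left_mono \<psi> w)
    also have "\<dots> = c * (w (x, t) * \<phi> (x, t) powr (1 / r))" by simp
    also have "\<dots> \<le> c * (\<kappa> powr (r - 1) * (w (x, t) * \<phi> (x, t) powr (1 / r)) powr r + 1 / \<kappa>)"
      using pos w(2)[of "(x, t)"] by (intro mult_left_mono young_truncated) auto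
    also have "(w (x, t) * \<phi> (x, t) powr (1 / r)) powr r = ?H (x, t)"
      using pos w(2)[of "(x, t)"] \<phi>(2)[of "(x, t)"] n by (simp add: powr_mult powr_powr)
    finally have "ennreal (w (x, t) * \<psi> (x, t)) \<le> ennreal (?c1 * ?H (x, t) + c / \<kappa>)"
      by (intro ennreal_leI) (simp add: distrib_left mult.assoc)
    also have "\<dots> = ennreal ?c1 * ennreal (?H (x, t)) + ennreal (c / \<kappa>)"
      using pos H_nonneg[of "(x, t)"] by (subst ennreal_plus) (auto simp: ennreal_mult)
    finally show ?thesis using x t by simp
  qed
  have J0: "J t = 0" if "t \<notin> {0..2 * R}" for t
  proof -
    have H0: "?H (x, t) = 0" for x
    proof (cases "t \<le> 0")
      case False
      then have "norm (x, t) > 2 * R" using that norm_snd_le[of t x] by auto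
      then show ?thesis by (simp add: supp)
    qed (simp add: w(3))
    show ?thesis unfolding J_def by (simp only: H0 ennreal_0 nn_integral_const mult_zero_left)
  qed
  \<comment> \<open>Keeping the error on \<open>{0..2 * R}\<close> only, outside of which
    \<open>J\<close> vanishes, makes its time integral finite.\<close>
  have J_le: "J t \<le> ennreal \<mu> * (J t)\<^sup>2 + ennreal (1 / \<mu>) * indicator {0..2 * R} t" for t
    using linear_le_square_ennreal[OF pos(5), of "J t"] J0[of t] by (cases "t \<in> {0..2 * R}") auto
  have "(\<integral>\<^sup>+z. ennreal (w z * \<psi> z) \<partial>lborel)
      \<le> (\<integral>\<^sup>+z. ennreal ?c1 * ennreal (?H z) + ennreal (c / \<kappa>) * indicator {0..2 * R} (snd z) * indicator (cball 0 (2 * R)) (fst z) \<partial>lborel)"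
    by (intro nn_integral_mono) (use pt in \<open>auto simp: split_paired_all\<close>)
  also have "\<dots> = (\<integral>\<^sup>+t. (\<integral>\<^sup>+x. ennreal ?c1 * ennreal (?H (x, t)) + ennreal (c / \<kappa>) * indicator {0..2 * R} t * indicator (cball 0 (2 * R)) x \<partial>lborel) \<partial>lborel)"
  proof (subst nn_integral_time_space(1))
    have [measurable]: "(snd :: 'a \<times> real \<Rightarrow> real) \<in> borel_measurable borel"
      "(fst :: 'a \<times> real \<Rightarrow> 'a) \<in> borel_measurable borel"
      by (auto intro!: borel_measurable_continuous_onI continuous_intros)
    have "(\<lambda>z::'a \<times> real. indicator {0..2 * R} (snd z) :: ennreal) \<in> borel_measurable borel"
      "(\<lambda>z::'a \<times> real. indicator (cball 0 (2 * R)) (fst z) :: ennreal) \<in> borel_measurable borel"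
      by measurable
    then show "(\<lambda>z. ennreal ?c1 * ennreal (?H z) + ennreal (c / \<kappa>) * indicator {0..2 * R} (snd z) * indicator (cball 0 (2 * R)) (fst z)) \<in> borel_measurable borel"
      using Hm by measurable
  qed simp
  also have "\<dots> = (\<integral>\<^sup>+t. ennreal ?c1 * J t + ennreal (c / \<kappa>) * indicator {0..2 * R} t * ennreal ?V \<partial>lborel)"
  proof (rule nn_integral_cong)
    fix t :: real
    have [measurable]: "(\<lambda>x. ennreal (?H (x, t))) \<in> borel_measurable borel" by (rule measurable_slice[OF Hm])
    have "(\<integral>\<^sup>+x. ennreal ?c1 * ennreal (?H (x, t)) + ennreal (c / \<kappa>) * indicator {0..2 * R} t * indicator (cball 0 (2 * R)) x \<partial>lborel)
      = (\<integral>\<^sup>+x. ennreal ?c1 * ennreal (?H (x, t)) \<partial>lborel) + (\<integral>\<^sup>+x. ennreal (c / \<kappa>) * indicator {0..2 * R} t * indicator (cball (0::'a) (2 * R)) x \<partial>lborel)"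
      by (rule nn_integral_add) measurable
    also have "(\<integral>\<^sup>+x. ennreal ?c1 * ennreal (?H (x, t)) \<partial>lborel) = ennreal ?c1 * J t"
      unfolding J_def by (rule nn_integral_cmult) measurable
    also have "(\<integral>\<^sup>+x. ennreal (c / \<kappa>) * indicator {0..2 * R} t * indicator (cball (0::'a) (2 * R)) x \<partial>lborel)
        = ennreal (c / \<kappa>) * indicator {0..2 * R} t * ennreal ?V"
      using pos by (subst nn_integral_cmult_indicator) (auto simp: emeasure_cball)
    finally show "(\<integral>\<^sup>+x. ennreal ?c1 * ennreal (?H (x, t)) + ennreal (c / \<kappa>) * indicator {0..2 * R} t * indicator (cball 0 (2 * R)) x \<partial>lborel)
        = ennreal ?c1 * J t + ennreal (c / \<kappa>) * indicator {0..2 * R} t * ennreal ?V" .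
  qed
  also have "\<dots> \<le> (\<integral>\<^sup>+t. ennreal (?c1 * \<mu>) * (J t)\<^sup>2 + ennreal (?c1 / \<mu> + c / \<kappa> * ?V) * indicator {0..2 * R} t \<partial>lborel)"
  proof (rule nn_integral_mono)
    fix t
    have "ennreal ?c1 * J t + ennreal (c / \<kappa>) * indicator {0..2 * R} t * ennreal ?V
        \<le> ennreal ?c1 * (ennreal \<mu> * (J t)\<^sup>2 + ennreal (1 / \<mu>) * indicator {0..2 * R} t) + ennreal (c / \<kappa>) * indicator {0..2 * R} t * ennreal ?V"
      by (intro add_mono mult_left_mono J_le) auto
    also have "\<dots> = (ennreal ?c1 * ennreal \<mu>) * (J t)\<^sup>2 + (ennreal ?c1 * ennreal (1 / \<mu>) + ennreal (c / \<kappa>) * ennreal ?V) * indicator {0..2 * R} t"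
      by (simp only: distrib_left distrib_right mult_ac add_ac)
    also have "ennreal ?c1 * ennreal \<mu> = ennreal (?c1 * \<mu>)"
      using pos by (simp add: ennreal_mult)
    also have "ennreal ?c1 * ennreal (1 / \<mu>) + ennreal (c / \<kappa>) * ennreal ?V = ennreal (?c1 / \<mu> + c / \<kappa> * ?V)"
      using pos by (subst ennreal_plus) (auto simp flip: ennreal_mult)
    finally show "ennreal ?c1 * J t + ennreal (c / \<kappa>) * indicator {0..2 * R} t * ennreal ?V
        \<le> ennreal (?c1 * \<mu>) * (J t)\<^sup>2 + ennreal (?c1 / \<mu> + c / \<kappa> * ?V) * indicator {0..2 * R} t" .
  qed
  also have "\<dots> = ennreal (?c1 * \<mu>) * (\<integral>\<^sup>+t. (J t)\<^sup>2 \<partial>lborel) + ennreal (?c1 / \<mu> + c / \<kappa> * ?V) * ennreal (2 * R)"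
    using pos by (subst nn_integral_add) (auto simp: nn_integral_cmult nn_integral_cmult_indicator)
  also have "ennreal (?c1 / \<mu> + c / \<kappa> * ?V) * ennreal (2 * R) = ennreal (c * (2 * R) * (\<kappa> powr (r - 1) / \<mu> + ?V / \<kappa>))"
    using pos by (subst ennreal_mult[symmetric]) (auto simp: algebra_simps)
  finally show ?thesis by (simp add: J_def)
qed

text \<open>The choice of \<open>\<kappa>\<close> and \<open>\<mu>\<close> balances the two error terms; the exponent condition is exactly what
  makes the resulting power of \<open>R\<close> nonpositive.\<close>

lemma scaling_parameters:
  fixes N \<alpha> r V C :: real
  assumes r: "r > 1" and V: "V > 0" and C: "C > 0" and crit: "2 * r * (N + \<alpha> - 1) \<le> 2 * N + 1"
  obtains D where "D > 0" "\<And>\<eta> R. \<eta> > 0 \<Longrightarrow> R \<ge> 1 \<Longrightarrow> \<exists>\<kappa>>0. \<exists>\<mu>>0.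
      (4 * R) powr \<alpha> * (C / R\<^sup>2 * \<kappa> powr (r - 1) * \<mu>) = \<eta> \<and>
      (4 * R) powr \<alpha> * (C / R\<^sup>2 * (2 * R) * (\<kappa> powr (r - 1) / \<mu> + V * R powr N / \<kappa>)) \<le> D * \<eta> powr (- (1 / (2 * r - 1)))"
proof -
  define s where "s = 1 / (2 * r - 1)"
  have s: "s > 0" "s * (2 * r - 1) = 1" using r by (auto simp: s_def)
  define B where "B = V / (C * 4 powr \<alpha>)"
  have B: "B > 0" using V C by (simp add: B_def)
  \<comment> \<open>The factor 4 is one 2 from \<open>2 * R\<close> and one from the two error terms
    being equal for the \<open>\<mu>\<close> chosen below.\<close>
  define D where "D = 4 * C * V * 4 powr \<alpha> * B powr (-s)"
  have "D > 0" using V C B by (simp add: D_def)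
  moreover have "\<exists>\<kappa>>0. \<exists>\<mu>>0. (4 * R) powr \<alpha> * (C / R\<^sup>2 * \<kappa> powr (r - 1) * \<mu>) = \<eta> \<and>
      (4 * R) powr \<alpha> * (C / R\<^sup>2 * (2 * R) * (\<kappa> powr (r - 1) / \<mu> + V * R powr N / \<kappa>)) \<le> D * \<eta> powr (-s)"
    if \<eta>: "\<eta> > 0" and R: "R \<ge> 1" for \<eta> R
  proof -
    \<comment> \<open>\<open>\<mu>\<close> equates the two errors. The first equation then becomes
      \<open>\<kappa> powr (2 * r - 1) = \<eta> * B * R powr (N + 2 - \<alpha>)\<close>, which
      \<open>\<kappa>\<close> solves.\<close>
    define \<kappa> where "\<kappa> = (\<eta> * B * R powr (N + 2 - \<alpha>)) powr s"
    define \<mu> where "\<mu> = \<kappa> powr r / (V * R powr N)"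
    have \<kappa>: "\<kappa> > 0" using \<eta> B R by (simp add: \<kappa>_def)
    then have \<mu>: "\<mu> > 0" using V R by (simp add: \<mu>_def)
    have R2: "R powr (N + 2 - \<alpha>) = R powr N * R\<^sup>2 / R powr \<alpha>"
      using R by (simp add: powr_add powr_diff powr_numeral)
    have R4: "(4 * R) powr \<alpha> = 4 powr \<alpha> * R powr \<alpha>" using R by (simp add: powr_mult)
    have pos: "V * R powr N > 0" "R > 0" "4 powr \<alpha> > (0::real)" "R powr \<alpha> > 0" using V R by auto
    have "\<kappa> powr (r - 1) * \<mu> = \<kappa> powr (r - 1) * \<kappa> powr r / (V * R powr N)"
      by (simp add: \<mu>_def)
    also have "\<kappa> powr (r - 1) * \<kappa> powr r = \<kappa> powr (2 * r - 1)"
      by (simp add: powr_add[symmetric])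
    also have "\<dots> = \<eta> * B * R powr (N + 2 - \<alpha>)"
      using s \<eta> B R by (simp add: \<kappa>_def powr_powr)
    finally have km: "\<kappa> powr (r - 1) * \<mu> = \<eta> * B * R powr (N + 2 - \<alpha>) / (V * R powr N)" .
    have "(4 * R) powr \<alpha> * (C / R\<^sup>2 * \<kappa> powr (r - 1) * \<mu>) = (4 * R) powr \<alpha> * (C / R\<^sup>2 * (\<kappa> powr (r - 1) * \<mu>))"
      by simp
    also have "\<dots> = \<eta>"
      unfolding km R2 R4 B_def using pos C V by (simp add: field_simps)
    finally have 1: "(4 * R) powr \<alpha> * (C / R\<^sup>2 * \<kappa> powr (r - 1) * \<mu>) = \<eta>" .
    have "\<kappa> powr (r - 1) / \<mu> = V * R powr N / \<kappa>"
      using \<kappa> pos by (simp add: \<mu>_def powr_diff)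
    then have "(4 * R) powr \<alpha> * (C / R\<^sup>2 * (2 * R) * (\<kappa> powr (r - 1) / \<mu> + V * R powr N / \<kappa>))
        = 4 * C * V * 4 powr \<alpha> * (R powr \<alpha> * R powr N / R) / \<kappa>"
      unfolding R4 using pos \<kappa> by (simp add: field_simps power2_eq_square)
    also have "R powr \<alpha> * R powr N / R = R powr (\<alpha> + N - 1)"
      using pos by (simp add: powr_add powr_diff)
    also have "4 * C * V * 4 powr \<alpha> * R powr (\<alpha> + N - 1) / \<kappa>
        = D * \<eta> powr (-s) * R powr (\<alpha> + N - 1 - (N + 2 - \<alpha>) * s)"
    proof -
      have k: "\<kappa> = \<eta> powr s * B powr s * R powr ((N + 2 - \<alpha>) * s)"
        using \<eta> B R by (simp add: \<kappa>_def powr_mult powr_powr)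
      show ?thesis
        unfolding k D_def powr_diff[of R "\<alpha> + N - 1"] powr_minus using pos \<eta> B by (simp add: field_simps)
    qed
    also have "\<dots> \<le> D * \<eta> powr (-s) * R powr 0"
    proof (intro mult_left_mono powr_mono)
      \<comment> \<open>This is \<open>crit\<close> rearranged, as \<open>2 * N + 1\<close> is the
        sum of \<open>N + \<alpha> - 1\<close> and \<open>N + 2 - \<alpha>\<close>.\<close>
      have "(\<alpha> + N - 1) * (2 * r - 1) \<le> N + 2 - \<alpha>" using crit by (simp add: algebra_simps)
      then have "s * ((\<alpha> + N - 1) * (2 * r - 1)) \<le> s * (N + 2 - \<alpha>)" using s by (intro mult_left_mono) auto
      moreover have "s * ((\<alpha> + N - 1) * (2 * r - 1)) = (s * (2 * r - 1)) * (\<alpha> + N - 1)" by (simp only: mult_ac)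
      ultimately have "1 * (\<alpha> + N - 1) \<le> s * (N + 2 - \<alpha>)" by (simp only: s(2))
      then show "\<alpha> + N - 1 - (N + 2 - \<alpha>) * s \<le> 0" by (simp add: mult.commute)
    qed (use R \<open>D > 0\<close> in auto)
    finally have 2: "(4 * R) powr \<alpha> * (C / R\<^sup>2 * (2 * R) * (\<kappa> powr (r - 1) / \<mu> + V * R powr N / \<kappa>)) \<le> D * \<eta> powr (-s)"
      using R by simp
    show ?thesis using \<kappa> \<mu> 1 2 by blast
  qed
  ultimately show ?thesis using that by (simp add: s_def)
qed

text \<open>For nonnegative \<open>f\<close> this is the squared norm of L^2 in time with values in
  L^1 in space. It is \<open>ennreal\<close>-valued because finiteness is part of what has to be
  shown.\<close>

definition energy :: "('a::euclidean_space \<times> real \<Rightarrow> real) \<Rightarrow> ennreal" where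
  "energy f = (\<integral>\<^sup>+t. (\<integral>\<^sup>+x. ennreal (f (x, t)) \<partial>lborel)\<^sup>2 \<partial>lborel)"

lemma energy_mono: "(\<And>z. f z \<le> g z) \<Longrightarrow> energy f \<le> energy g"
  unfolding energy_def by (intro nn_integral_mono power_mono ennreal_leI) auto

lemma energy_inner_measurable:
  fixes f :: "'a::euclidean_space \<times> real \<Rightarrow> real"
  shows "f \<in> borel_measurable borel \<Longrightarrow> (\<lambda>t. \<integral>\<^sup>+x. ennreal (f (x, t)) \<partial>lborel) \<in> borel_measurable borel"
  using nn_integral_time_space(2)[of "\<lambda>z. ennreal (f z)"] by simp

lemma energy_eq_0:
  fixes f :: "'a::euclidean_space \<times> real \<Rightarrow> real"
  assumes f: "f \<in> borel_measurable borel" "\<And>z. f z \<ge> 0" and 0: "energy f = 0"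
  shows "AE z in lborel. f z = 0"
proof -
  let ?J = "\<lambda>t. \<integral>\<^sup>+x. ennreal (f (x, t)) \<partial>lborel"
  note [measurable] = energy_inner_measurable[OF f(1)]
  have "AE t in lborel. (?J t)\<^sup>2 = 0"
    using 0 by (subst (asm) energy_def, subst (asm) nn_integral_0_iff_AE) auto
  then have "(\<integral>\<^sup>+t. ?J t \<partial>lborel) = 0"
    by (subst nn_integral_0_iff_AE) (auto elim!: eventually_mono)
  then have "(\<integral>\<^sup>+z. ennreal (f z) \<partial>lborel) = 0"
    using nn_integral_time_space(1)[of "\<lambda>z. ennreal (f z)"] f(1) by simp
  then show ?thesis
    using f by (subst (asm) nn_integral_0_iff_AE) (auto elim!: eventually_mono simp: antisym)
qed

lemma tendsto_square_ennreal:
  fixes f :: "_ \<Rightarrow> ennreal"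
  shows "(f \<longlongrightarrow> l) F \<Longrightarrow> ((\<lambda>x. (f x)\<^sup>2) \<longlongrightarrow> l\<^sup>2) F"
  unfolding power2_eq_square by (rule tendsto_mult_ennreal) auto

text \<open>Monotone convergence, first in space and then in time.\<close>

lemma energy_ball_tendsto:
  fixes g :: "'a::euclidean_space \<times> real \<Rightarrow> real"
  assumes g: "g \<in> borel_measurable borel" "\<And>z. g z \<ge> 0"
  shows "(\<lambda>n. energy (\<lambda>z. indicator (cball 0 (real n)) z * g z)) \<longlonglongrightarrow> energy g"
proof -
  let ?f = "\<lambda>n z. indicator (cball 0 (real n)) z * g z"
  have fm: "?f n \<in> borel_measurable borel" for n
    using g(1) by (intro borel_measurable_times borel_measurable_indicator borel_closed closed_cball)
  have mono: "?f m z \<le> ?f n z" if "m \<le> n" for m n z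
    using that g(2)[of z] by (auto simp: indicator_def)
  have lim: "(\<lambda>n. ennreal (?f n z)) \<longlonglongrightarrow> ennreal (g z)" for z
  proof (rule tendsto_eventually)
    obtain m where "norm z \<le> real m" using real_arch_simple by blast
    then show "\<forall>\<^sub>F n in sequentially. ennreal (?f n z) = ennreal (g z)"
      by (auto intro!: eventually_sequentiallyI[of m])
  qed
  have inner: "(\<lambda>n. \<integral>\<^sup>+x. ennreal (?f n (x, t)) \<partial>lborel) \<longlonglongrightarrow> (\<integral>\<^sup>+x. ennreal (g (x, t)) \<partial>lborel)" for t
    by (rule nn_integral_LIMSEQ)
      (use measurable_slice[OF fm] in \<open>auto intro!: incseq_SucI le_funI ennreal_leI mono lim simp del: ennreal_le_iff\<close>)
  show ?thesis
    unfolding energy_def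
  proof (rule nn_integral_LIMSEQ)
    show "incseq (\<lambda>n t. (\<integral>\<^sup>+x. ennreal (?f n (x, t)) \<partial>lborel)\<^sup>2)"
      by (intro incseq_SucI le_funI power_mono nn_integral_mono ennreal_leI mono) auto
    show "(\<lambda>t. (\<integral>\<^sup>+x. ennreal (?f n (x, t)) \<partial>lborel)\<^sup>2) \<in> borel_measurable lborel" for n
      using energy_inner_measurable[OF fm[of n]] by measurable
  qed (intro tendsto_square_ennreal inner)
qed

text \<open>Dominated convergence, first in space and then in time. Finite energy makes the
  dominating slice integral finite for almost every time.\<close>

lemma energy_tail_tendsto:
  fixes g :: "'a::euclidean_space \<times> real \<Rightarrow> real"
  assumes g: "g \<in> borel_measurable borel" "\<And>z. g z \<ge> 0" and fin: "energy g < \<infinity>"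
  shows "(\<lambda>n. energy (\<lambda>z. indicator {z. norm z \<ge> real n} z * g z)) \<longlonglongrightarrow> 0"
proof -
  let ?f = "\<lambda>n z. indicator {z. norm z \<ge> real n} z * g z"
  let ?G = "\<lambda>t. \<integral>\<^sup>+x. ennreal (g (x, t)) \<partial>lborel"
  have fm: "?f n \<in> borel_measurable borel" for n
    using g(1) by (intro borel_measurable_times borel_measurable_indicator borel_closed closed_Collect_le continuous_intros)
  have le: "?f n z \<le> g z" for n z using g(2)[of z] by (auto simp: indicator_def)
  have lim: "(\<lambda>n. ennreal (?f n z)) \<longlonglongrightarrow> 0" for z
  proof (rule tendsto_eventually)
    obtain m where "norm z < real m" using reals_Archimedean2 by blast
    then show "\<forall>\<^sub>F n in sequentially. ennreal (?f n z) = 0"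
      by (auto intro!: eventually_sequentiallyI[of m])
  qed
  have Gm [measurable]: "?G \<in> borel_measurable borel" by (rule energy_inner_measurable[OF g(1)])
  have "AE t in lborel. (?G t)\<^sup>2 \<noteq> \<infinity>"
    using fin by (intro nn_integral_PInf_AE) (auto simp: energy_def)
  then have inner: "AE t in lborel. (\<lambda>n. \<integral>\<^sup>+x. ennreal (?f n (x, t)) \<partial>lborel) \<longlonglongrightarrow> 0"
  proof eventually_elim
    case (elim t)
    then have "?G t < \<infinity>" by (auto simp: top.not_eq_extremum power2_eq_square ennreal_mult_eq_top_iff)
    then have "(\<lambda>n. \<integral>\<^sup>+x. ennreal (?f n (x, t)) \<partial>lborel) \<longlonglongrightarrow> (\<integral>\<^sup>+x. 0 \<partial>(lborel :: 'a measure))"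
      by (intro nn_integral_dominated_convergence[where w = "\<lambda>x. ennreal (g (x, t))"])
        (use measurable_slice[OF fm] measurable_slice[OF g(1)] lim le in \<open>auto intro!: ennreal_leI simp del: ennreal_le_iff\<close>)
    then show ?case by simp
  qed
  have "(\<lambda>n. energy (?f n)) \<longlonglongrightarrow> (\<integral>\<^sup>+t. 0 \<partial>(lborel :: real measure))"
    unfolding energy_def
  proof (rule nn_integral_dominated_convergence[where w = "\<lambda>t. (?G t)\<^sup>2" and u' = "\<lambda>t. 0"])
    show "(\<lambda>t. (\<integral>\<^sup>+x. ennreal (?f n (x, t)) \<partial>lborel)\<^sup>2) \<in> borel_measurable lborel" for n
      using energy_inner_measurable[OF fm[of n]] by measurable
    show "AE t in lborel. (\<integral>\<^sup>+x. ennreal (?f n (x, t)) \<partial>lborel)\<^sup>2 \<le> (?G t)\<^sup>2" for n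
      by (intro AE_I2 power_mono nn_integral_mono ennreal_leI le) auto
    show "(\<integral>\<^sup>+t. (?G t)\<^sup>2 \<partial>lborel) < \<infinity>" using fin by (simp add: energy_def)
    show "AE t in lborel. (\<lambda>n. (\<integral>\<^sup>+x. ennreal (?f n (x, t)) \<partial>lborel)\<^sup>2) \<longlonglongrightarrow> 0"
      using inner
    proof eventually_elim
      case (elim t)
      from tendsto_square_ennreal[OF this] show ?case by simp
    qed
  qed auto
  then show ?thesis by simp
qed

text \<open>With \<open>\<eta> = 1/2\<close> the inequality bounds the energy uniformly in \<open>n\<close>. Hence the energy of the tail
  tends to zero, and letting first \<open>n\<close> and then \<open>\<eta>\<close> tend to infinity shows that the energy vanishes.\<close>

lemma vanishing_from_energy_inequality:
  fixes g :: "'a::euclidean_space \<times> real \<Rightarrow> real" and \<phi> :: "nat \<Rightarrow> 'a \<times> real \<Rightarrow> real"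
  assumes g: "g \<in> borel_measurable borel" "\<And>z. g z \<ge> 0"
    and \<phi>: "\<And>n z. \<phi> n z \<ge> 0" "\<And>n z. \<phi> n z \<le> 1"
    and plateau: "\<And>n z. n > 0 \<Longrightarrow> norm z \<le> real n \<Longrightarrow> \<phi> n z = 1"
    and s: "s > 0" and D: "D > 0"
    and fin: "\<And>n. n \<ge> n0 \<Longrightarrow> energy (\<lambda>z. g z * \<phi> n z) < \<infinity>"
    and ineq: "\<And>n \<eta>. n \<ge> n0 \<Longrightarrow> \<eta> > 0 \<Longrightarrow> energy (\<lambda>z. g z * \<phi> n z)
      \<le> ennreal \<eta> * energy (\<lambda>z. indicator {z. norm z \<ge> real n} z * (g z * \<phi> n z)) + ennreal (D * \<eta> powr (-s))"
  shows "AE z in lborel. g z = 0"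
proof -
  let ?K = "\<lambda>n. energy (\<lambda>z. g z * \<phi> n z)"
  let ?T = "\<lambda>n. energy (\<lambda>z. indicator {z. norm z \<ge> real n} z * (g z * \<phi> n z))"
  let ?L = "\<lambda>n. energy (\<lambda>z. indicator (cball 0 (real n)) z * g z)"
  let ?M = "\<lambda>n. energy (\<lambda>z. indicator {z. norm z \<ge> real n} z * g z)"
  define d where "d = D * (1 / 2) powr (-s)"
  have d: "d > 0" using D by (simp add: d_def)
  have g\<phi>: "0 \<le> g z * \<phi> n z" "g z * \<phi> n z \<le> g z" for n z
    using g(2)[of z] \<phi>[where z = z and n = n] by (auto simp: mult_left_le)
  have TK: "?T n \<le> ?K n" for n
    using g\<phi>(1)[of _ n] by (intro energy_mono) (auto simp: indicator_def)
  have TM: "?T n \<le> ?M n" for n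
    using g\<phi>(2)[of _ n] by (intro energy_mono) (auto simp: indicator_def)
  have LK: "?L m \<le> ?K n" if "m \<le> n" "n > 0" for m n
  proof (intro energy_mono)
    fix z
    show "indicator (cball 0 (real m)) z * g z \<le> g z * \<phi> n z"
      using plateau[OF that(2), of z] that(1) g\<phi>(1)[of z n] by (auto simp: indicator_def)
  qed
  have K_le: "?K n \<le> ennreal (2 * d)" if n: "n \<ge> n0" for n
  proof -
    \<comment> \<open>Absorbing half of \<open>?K n\<close> into the left side requires it to be
      finite.\<close>
    obtain k where k: "?K n = ennreal k" "k \<ge> 0" using fin[OF n] by (cases "?K n") auto
    have "?K n \<le> ennreal (1 / 2) * ?K n + ennreal d"
      using ineq[OF n, of "1 / 2"] by (rule order_trans) (auto simp: d_def intro!: add_mono mult_left_mono TK)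
    moreover have "ennreal (1 / 2) * ennreal k + ennreal d = ennreal (1 / 2 * k + d)"
      using k d ennreal_mult[of "1 / 2" k] by (subst ennreal_plus) auto
    ultimately have "ennreal k \<le> ennreal (1 / 2 * k + d)" unfolding k(1) by (simp only:)
    then have "k \<le> 1 / 2 * k + d" using k(2) d by (subst (asm) ennreal_le_iff) auto
    then show ?thesis using k by (simp add: ennreal_leI)
  qed
  have "energy g \<le> ennreal (2 * d)"
    using energy_ball_tendsto[OF g]
    by (rule LIMSEQ_le_const2) (intro exI[of _ "Suc n0"] allI impI order_trans[OF LK[OF order_refl] K_le]; simp)
  then have "energy g < \<infinity>" by (auto simp: order_le_less_trans)
  then have M_lim: "?M \<longlonglongrightarrow> 0" by (rule energy_tail_tendsto[OF g])
  have L_le: "?L m \<le> ennreal (D * \<eta> powr (-s))" if \<eta>: "\<eta> > 0" for m \<eta>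
  proof -
    have "(\<lambda>n. ennreal \<eta> * ?M n + ennreal (D * \<eta> powr (-s))) \<longlonglongrightarrow> ennreal \<eta> * 0 + ennreal (D * \<eta> powr (-s))"
      by (intro tendsto_add ennreal_tendsto_cmult M_lim tendsto_const) simp
    then have "(\<lambda>n. ennreal \<eta> * ?M n + ennreal (D * \<eta> powr (-s))) \<longlonglongrightarrow> ennreal (D * \<eta> powr (-s))" by simp
    then show ?thesis
    proof (rule LIMSEQ_le_const, intro exI[of _ "Suc (max m n0)"] allI impI)
      fix n assume n: "Suc (max m n0) \<le> n"
      have "?L m \<le> ?K n" using n by (intro LK) auto
      also have "\<dots> \<le> ennreal \<eta> * ?T n + ennreal (D * \<eta> powr (-s))" using n \<eta> by (intro ineq) auto
      also have "\<dots> \<le> ennreal \<eta> * ?M n + ennreal (D * \<eta> powr (-s))" by (intro add_mono mult_left_mono TM) auto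
      finally show "?L m \<le> ennreal \<eta> * ?M n + ennreal (D * \<eta> powr (-s))" .
    qed
  qed
  have L0: "?L m = 0" for m
  proof (rule ccontr)
    assume ne: "?L m \<noteq> 0"
    obtain l where l: "?L m = ennreal l" "l \<ge> 0" using L_le[of 1 m] by (cases "?L m") (auto simp: top_unique)
    with ne have l0: "l > 0" by (cases "l = 0") auto
    \<comment> \<open>Chosen so that the error term equals \<open>l / 2\<close>, half of the
      quantity it is supposed to dominate.\<close>
    define \<eta> where "\<eta> = (l / (2 * D)) powr (- (1 / s))"
    have "\<eta> > 0" using l0 D by (simp add: \<eta>_def)
    moreover have "\<eta> powr (-s) = l / (2 * D)" using l0 D s by (simp add: \<eta>_def powr_powr)
    ultimately have "ennreal l \<le> ennreal (l / 2)" using L_le[of \<eta> m] l D by simp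
    then show False using l0 by (subst (asm) ennreal_le_iff) auto
  qed
  have "AE z in lborel. indicator (cball 0 (real m)) z * g z = 0" for m
  proof (rule energy_eq_0[OF _ _ L0])
    show "(\<lambda>z. indicator (cball 0 (real m)) z * g z) \<in> borel_measurable borel"
      using g(1) by (intro borel_measurable_times borel_measurable_indicator borel_closed closed_cball)
  qed (use g in auto)
  then have "AE z in lborel. \<forall>m. indicator (cball 0 (real m)) z * g z = 0"
    unfolding AE_all_countable by blast
  then show ?thesis
  proof eventually_elim
    case (elim z)
    obtain m where "norm z \<le> real m" using real_arch_simple by blast
    with elim[rule_format, of m] show ?case by simp
  qed
qed

section \<open>From weak solutions to the energy inequality\<close>

lemma AE_time_imp_AE:
  assumes "AE t in lborel. Q t"
  shows "AE z in (lborel :: ('a::euclidean_space \<times> real) measure). Q (snd z)"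
proof -
  obtain N where N: "{t \<in> space lborel. \<not> Q t} \<subseteq> N" "N \<in> null_sets lborel"
    using assms by (auto elim!: AE_E simp: null_sets_def)
  have "emeasure (lborel \<Otimes>\<^sub>M lborel) ((UNIV :: 'a set) \<times> N) = emeasure lborel (UNIV :: 'a set) * emeasure lborel N"
    using N(2) by (intro lborel.emeasure_pair_measure_Times) auto
  also have "\<dots> = 0" using N(2) by auto
  finally have "(UNIV :: 'a set) \<times> N \<in> null_sets (lborel \<Otimes>\<^sub>M lborel)"
    using N(2) by (intro null_setsI pair_measureI) auto
  then have "(UNIV :: 'a set) \<times> N \<in> null_sets lborel" unfolding lborel_prod .
  then have "AE z in lborel. z \<notin> (UNIV :: 'a set) \<times> N" by (rule AE_not_in)
  then show ?thesis by eventually_elim (use N(1) in auto)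
qed

text \<open>A Borel representative \<open>w\<close> of \<open>\<bar>u\<bar>\<close>, extended by zero, makes Fubini's theorem available; almost
  every time slice of \<open>w\<close> agrees almost everywhere with that of \<open>\<bar>u\<bar>\<close>, hence so do the convolutions.\<close>

lemma borel_representative:
  fixes u :: "'a::euclidean_space \<times> real \<Rightarrow> real"
  assumes u: "u \<in> borel_measurable (lebesgue_on closed_upper_half)"
    and fin: "AE z in lebesgue. z \<in> upper_half \<longrightarrow> riesz_conv_finite \<alpha> p u z"
  obtains w where "w \<in> borel_measurable borel" "\<And>z. w z \<ge> 0" "\<And>x t. t \<le> 0 \<Longrightarrow> w (x, t) = 0"
    "AE z in lborel. z \<in> upper_half \<longrightarrow> w z = \<bar>u z\<bar>"
    "AE z in lborel. z \<in> upper_half \<longrightarrow> riesz_nn \<alpha> p w z = ennreal (riesz_conv \<alpha> p u z)"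
proof -
  have "(\<lambda>z. indicator closed_upper_half z *\<^sub>R u z) \<in> borel_measurable lebesgue"
    using u by (subst (asm) borel_measurable_restrict_space_iff) auto
  then obtain v where v: "v \<in> borel_measurable lborel"
    "AE z in lborel. indicator closed_upper_half z *\<^sub>R u z = v z"
    using completion_ex_borel_measurable_real by blast
  \<comment> \<open>Restricting to the open half-space makes \<open>w\<close> vanish at
    \<open>t = 0\<close> as well.\<close>
  define w where "w z = indicator upper_half z * \<bar>v z\<bar>" for z
  have w_meas: "w \<in> borel_measurable borel"
    unfolding w_def[abs_def] using v(1) by measurable
  have wu: "AE z in lborel. z \<in> upper_half \<longrightarrow> w z = \<bar>u z\<bar>"
    using v(2) upper_half_subset[where 'a = 'a] by (auto elim!: eventually_mono simp: w_def indicator_def)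
  have "AE t in lborel. AE y in lborel. (y, t) \<in> upper_half \<longrightarrow> w (y, t) = \<bar>u (y, t)\<bar>"
    by (rule AE_time_space[OF wu])
  \<comment> \<open>The statement about almost every time is lifted back to points of space-time,
    where it can be combined with the almost everywhere finiteness of the convolution.\<close>
  then have slices: "AE z in (lborel :: ('a \<times> real) measure). AE y in lborel. (y, snd z) \<in> upper_half \<longrightarrow> w (y, snd z) = \<bar>u (y, snd z)\<bar>"
    by (rule AE_time_imp_AE)
  have fin': "AE z in lborel. z \<in> upper_half \<longrightarrow> riesz_conv_finite \<alpha> p u z"
    using fin by (simp add: AE_completion_iff)
  have conv: "AE z in lborel. z \<in> upper_half \<longrightarrow> riesz_nn \<alpha> p w z = ennreal (riesz_conv \<alpha> p u z)"
    using slices fin'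
  proof eventually_elim
    case (elim z)
    show ?case
    proof
      assume z: "z \<in> upper_half"
      obtain x t where xt: "z = (x, t)" by (cases z)
      let ?f = "\<lambda>y. norm (x - y) powr (- \<alpha>) * \<bar>u (y, t)\<bar> powr p"
      have t: "(y, t) \<in> upper_half" for y using z by (simp add: xt upper_half_def)
      have "riesz_nn \<alpha> p w z = (\<integral>\<^sup>+y. ennreal (?f y) \<partial>lborel)"
        unfolding riesz_nn_def xt fst_conv snd_conv
        by (rule nn_integral_cong_AE) (use elim(1) t in \<open>auto elim!: eventually_mono simp: xt\<close>)
      also have "\<dots> = (\<integral>\<^sup>+y. ennreal (?f y) \<partial>lebesgue)" by (simp add: nn_integral_completion)
      also have "\<dots> = ennreal (LINT y|lebesgue. ?f y)"
        using elim(2) z by (intro nn_integral_eq_integral) (auto simp: riesz_conv_finite_def xt)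
      finally show "riesz_nn \<alpha> p w z = ennreal (riesz_conv \<alpha> p u z)" by (simp add: riesz_conv_def xt)
    qed
  qed
  show ?thesis
    by (rule that[OF w_meas _ _ wu conv]) (auto simp: w_def upper_half_def)
qed

lemma set_lebesgue_integral_upper_half_nn:
  fixes f g :: "'a::euclidean_space \<times> real \<Rightarrow> real"
  assumes int: "set_integrable lebesgue upper_half f" and nonneg: "\<And>z. f z \<ge> 0"
    and eq: "AE z in lborel. z \<in> upper_half \<longrightarrow> ennreal (f z) = h z"
    and zero: "\<And>z. z \<notin> upper_half \<Longrightarrow> h z = 0"
  shows "ennreal (LINT z:upper_half|lebesgue. f z) = (\<integral>\<^sup>+z. h z \<partial>lborel)"
proof -
  have "ennreal (LINT z:upper_half|lebesgue. f z) = (\<integral>\<^sup>+z. ennreal (indicator upper_half z *\<^sub>R f z) \<partial>lebesgue)"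
    unfolding set_lebesgue_integral_def using int nonneg
    by (intro nn_integral_eq_integral[symmetric]) (auto simp: set_integrable_def)
  also have "\<dots> = (\<integral>\<^sup>+z. ennreal (indicator upper_half z *\<^sub>R f z) \<partial>lborel)"
    by (simp add: nn_integral_completion)
  also have "\<dots> = (\<integral>\<^sup>+z. h z \<partial>lborel)"
    using eq by (intro nn_integral_cong_AE) (auto elim!: eventually_mono simp: zero indicator_def)
  finally show ?thesis .
qed

text \<open>This lets the initial velocity term be discarded from the weak inequality at large
  scales. In the integrable case dominated convergence carries the strict positivity of the full
  integral over to the truncated ones.\<close>

lemma nonneg_initial_velocity_eventually:
  fixes u1 :: "'a::euclidean_space \<Rightarrow> real" and \<theta> :: "nat \<Rightarrow> 'a \<Rightarrow> real"
  assumes u1: "(AE x in lebesgue. u1 x \<ge> 0) \<or> (integrable lebesgue u1 \<and> (LINT x|lebesgue. u1 x) > 0)"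
    and \<theta>: "\<And>n x. 0 \<le> \<theta> n x" "\<And>n x. \<theta> n x \<le> 1" "\<And>n x. n > 0 \<Longrightarrow> norm x \<le> real n \<Longrightarrow> \<theta> n x = 1"
    and int: "\<And>n. n > 0 \<Longrightarrow> integrable lebesgue (\<lambda>x. u1 x * \<theta> n x)"
  shows "\<exists>n0>0. \<forall>n\<ge>n0. (LINT x|lebesgue. u1 x * \<theta> n x) \<ge> 0"
  using u1
proof
  assume nonneg: "AE x in lebesgue. u1 x \<ge> 0"
  have "(LINT x|lebesgue. u1 x * \<theta> n x) \<ge> 0" for n
    using nonneg \<theta>(1)[of n] by (intro integral_nonneg_AE) (auto elim!: eventually_mono)
  then show ?thesis by (intro exI[of _ 1]) auto
next
  assume pos: "integrable lebesgue u1 \<and> (LINT x|lebesgue. u1 x) > 0"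
  \<comment> \<open>The index is shifted because the plateau and the integrability are assumed for
    positive scales only.\<close>
  have "(\<lambda>n. LINT x|lebesgue. u1 x * \<theta> (Suc n) x) \<longlonglongrightarrow> (LINT x|lebesgue. u1 x)"
  proof (rule integral_dominated_convergence[where w = "\<lambda>x. \<bar>u1 x\<bar>"])
    show "u1 \<in> borel_measurable lebesgue" "integrable lebesgue (\<lambda>x. \<bar>u1 x\<bar>)" using pos by auto
    show "(\<lambda>x. u1 x * \<theta> (Suc n) x) \<in> borel_measurable lebesgue" for n using int[of "Suc n"] by auto
    show "AE x in lebesgue. (\<lambda>n. u1 x * \<theta> (Suc n) x) \<longlonglongrightarrow> u1 x"
    proof (intro AE_I2 tendsto_eventually)
      fix x :: 'a
      obtain m where "norm x \<le> real m" using real_arch_simple by blast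
      then show "\<forall>\<^sub>F n in sequentially. u1 x * \<theta> (Suc n) x = u1 x"
        by (auto intro!: eventually_sequentiallyI[of m] simp: \<theta>(3))
    qed
    show "AE x in lebesgue. norm (u1 x * \<theta> (Suc n) x) \<le> \<bar>u1 x\<bar>" for n
      using \<theta>(1,2)[of "Suc n"] by (intro AE_I2) (simp add: abs_mult mult_left_le)
  qed
  then have "\<forall>\<^sub>F n in sequentially. (LINT x|lebesgue. u1 x * \<theta> (Suc n) x) > 0"
    using pos by (auto dest: order_tendstoD(1))
  then obtain m where m: "\<And>n. n \<ge> m \<Longrightarrow> (LINT x|lebesgue. u1 x * \<theta> (Suc n) x) > 0"
    by (auto simp: eventually_sequentially)
  have "(LINT x|lebesgue. u1 x * \<theta> n x) \<ge> 0" if "n \<ge> Suc m" for n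
    using m[of "n - 1"] that by (cases n) auto
  then show ?thesis by (intro exI[of _ "Suc m"]) auto
qed

text \<open>\<open>?A n\<close> is the tested nonlinear term at the integer scale \<open>n\<close>.
  The weak inequality bounds it above by the linear term, and the kernel estimate bounds it below by
  the energy of \<open>w powr r * \<phi> n\<close>; cancelling the kernel constant gives the
  inequality that forces \<open>w powr r\<close> to vanish.\<close>

lemma weak_solution_trivial:
  fixes p q \<alpha> :: real and u :: "'a::euclidean_space \<times> real \<Rightarrow> real"
  assumes p: "p > 0" and q: "q > 0" and \<alpha>: "\<alpha> > 0"
    and pq: "2 < p + q" "p + q \<le> (2 * real DIM('a) + 1) / (real DIM('a) + \<alpha> - 1)"
    and weak: "weak_solution \<alpha> p q u0 u1 u"
    and u1: "(AE x in lebesgue. u1 x \<ge> 0) \<or> (integrable lebesgue u1 \<and> (LINT x|lebesgue. u1 x) > 0)"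
  shows "AE z in lebesgue. z \<in> upper_half \<longrightarrow> u z = 0"
proof -
  define N where "N = real DIM('a)"
  have N: "N \<ge> 1" by (simp add: N_def DIM_ge_Suc0)
  define r where "r = (p + q) / 2"
  have r: "r > 1" using pq by (simp add: r_def)
  have "0 < N + \<alpha> - 1" using N \<alpha> by linarith
  then have "(p + q) * (N + \<alpha> - 1) \<le> 2 * N + 1"
    using pq(2) unfolding N_def[symmetric] by (simp only: pos_le_divide_eq)
  moreover have "2 * r = p + q" by (simp add: r_def)
  ultimately have crit: "2 * r * (N + \<alpha> - 1) \<le> 2 * N + 1" by (simp only:)
  have um: "u \<in> borel_measurable (lebesgue_on closed_upper_half)"
    and fin: "AE z in lebesgue. z \<in> upper_half \<longrightarrow> riesz_conv_finite \<alpha> p u z"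
    using weak by (auto simp: weak_solution_def Lp_loc_on_def)
  obtain w where w: "w \<in> borel_measurable borel" "\<And>z. w z \<ge> 0" "\<And>x t. t \<le> 0 \<Longrightarrow> w (x, t) = 0"
    and wu: "AE z in lborel. z \<in> upper_half \<longrightarrow> w z = \<bar>u z\<bar>"
    and conv: "AE z in lborel. z \<in> upper_half \<longrightarrow> riesz_nn \<alpha> p w z = ennreal (riesz_conv \<alpha> p u z)"
    by (rule borel_representative[OF um fin]) (rule that)
  have w0: "w z = 0" if "z \<notin> upper_half" for z
    using that w(3)[of "snd z" "fst z"] by (cases z) (auto simp: upper_half_def)
  define \<phi> where "\<phi> n z = cutoff ((1 / real n) *\<^sub>R z)" for n and z :: "'a \<times> real"
  have \<phi>01: "0 \<le> \<phi> n z" "\<phi> n z \<le> 1" for n z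
    by (simp_all add: \<phi>_def cutoff_nonneg cutoff_le_1)
  have \<phi>_test: "test_function (\<phi> n)" if "n > 0" for n
    unfolding \<phi>_def[abs_def] using that by (intro test_function_cutoff) simp
  have \<phi>_smooth: "smooth (\<phi> n)" for n
    unfolding \<phi>_def[abs_def] by (rule smooth_scale(1)[OF smooth_cutoff])
  have \<phi>_meas: "\<phi> n \<in> borel_measurable borel" for n
    by (intro borel_measurable_continuous_onI smooth_continuous \<phi>_smooth)
  have \<phi>_1: "\<phi> n z = 1" if "n > 0" "norm z \<le> real n" for n z
    using that unfolding \<phi>_def by (intro cutoff_eq_1) simp
  have \<phi>_0: "\<phi> n z = 0" if "n > 0" "norm z > 2 * real n" for n z
    using that unfolding \<phi>_def by (intro cutoff_eq_0) (simp add: field_simps)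
  have \<phi>_t: "time_deriv (\<phi> n) (x, 0) = 0" for n x
    unfolding \<phi>_def[abs_def] by (simp add: wave_operator_scale(2)[OF smooth_cutoff] time_deriv_cutoff)
  obtain C where C: "C > 0" "\<And>z::'a \<times> real. \<bar>wave_operator cutoff z\<bar> \<le> C * cutoff z powr (1 / r)"
    using wave_operator_cutoff_bound[where 'a = 'a, of "1 / r"] r by auto
  have wave: "wave_operator (\<phi> n) z = (1 / real n)\<^sup>2 * wave_operator cutoff ((1 / real n) *\<^sub>R z)" for n z
    unfolding \<phi>_def[abs_def] by (rule wave_operator_scale(1)[OF smooth_cutoff])
  have wave_bound: "\<bar>wave_operator (\<phi> n) z\<bar> \<le> C / (real n)\<^sup>2 * \<phi> n z powr (1 / r)" if "n > 0" for n z
  proof -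
    have "\<bar>wave_operator (\<phi> n) z\<bar> = (1 / real n)\<^sup>2 * \<bar>wave_operator cutoff ((1 / real n) *\<^sub>R z)\<bar>"
      by (simp add: wave abs_mult)
    also have "\<dots> \<le> (1 / real n)\<^sup>2 * (C * \<phi> n z powr (1 / r))"
      unfolding \<phi>_def by (intro mult_left_mono C) auto
    finally show ?thesis by (simp add: power_divide)
  qed
  have wave_0: "wave_operator (\<phi> n) z = 0" if "n > 0" "norm z < real n" for n z
  proof -
    have "norm ((1 / real n) *\<^sub>R z) < 1" using that by simp
    then show ?thesis by (simp add: wave wave_operator_cutoff_plateau)
  qed
  have wk: "integrable lebesgue (\<lambda>x. u1 x * \<phi> n (x, 0))"
    "set_integrable lebesgue upper_half (\<lambda>z. u z * wave_operator (\<phi> n) z)"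
    "set_integrable lebesgue upper_half (\<lambda>z. riesz_conv \<alpha> p u z * \<bar>u z\<bar> powr q * \<phi> n z)"
    "(LINT z:upper_half|lebesgue. riesz_conv \<alpha> p u z * \<bar>u z\<bar> powr q * \<phi> n z)
      \<le> - (LINT x|lebesgue. u1 x * \<phi> n (x, 0)) + (LINT z:upper_half|lebesgue. u z * wave_operator (\<phi> n) z)"
    if "n > 0" for n
    using weak \<phi>_test[OF that] \<phi>01(1)[of n] unfolding weak_solution_def by (auto simp: \<phi>_t)
  obtain n0 where n0: "n0 > 0" "\<And>n. n \<ge> n0 \<Longrightarrow> (LINT x|lebesgue. u1 x * \<phi> n (x, 0)) \<ge> 0"
  proof -
    have "\<exists>n0>0. \<forall>n\<ge>n0. (LINT x|lebesgue. u1 x * \<phi> n (x, 0)) \<ge> 0"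
      by (rule nonneg_initial_velocity_eventually[OF u1, of "\<lambda>n x. \<phi> n (x, 0)"])
        (auto simp: \<phi>01 \<phi>_1 wk(1))
    then show ?thesis using that by blast
  qed
  let ?A = "\<lambda>n. \<integral>\<^sup>+z. riesz_nn \<alpha> p w z * ennreal (w z powr q * \<phi> n z) \<partial>lborel"
  have A_eq: "ennreal (LINT z:upper_half|lebesgue. riesz_conv \<alpha> p u z * \<bar>u z\<bar> powr q * \<phi> n z) = ?A n"
    if "n > 0" for n
  proof (rule set_lebesgue_integral_upper_half_nn[OF wk(3)[OF that]])
    show "0 \<le> riesz_conv \<alpha> p u z * \<bar>u z\<bar> powr q * \<phi> n z" for z
      by (simp add: riesz_conv_nonneg \<phi>01)
    show "AE z in lborel. z \<in> upper_half \<longrightarrow> ennreal (riesz_conv \<alpha> p u z * \<bar>u z\<bar> powr q * \<phi> n z)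
        = riesz_nn \<alpha> p w z * ennreal (w z powr q * \<phi> n z)"
      using wu conv by eventually_elim (simp add: ennreal_mult[symmetric] riesz_conv_nonneg \<phi>01 mult.assoc)
  qed (simp add: w0)
  \<comment> \<open>The integral is the \<open>ennreal\<close> image of a real number, by the
    integrability demanded of a weak solution. This supplies the finite energy for the
    absorption.\<close>
  have A_fin: "?A n < \<infinity>" if "n > 0" for n
    using A_eq[OF that, symmetric] by simp
  have A_le: "?A n \<le> (\<integral>\<^sup>+z. ennreal (w z * \<bar>wave_operator (\<phi> n) z\<bar>) \<partial>lborel)" if n: "n \<ge> n0" for n
  proof -
    have n': "n > 0" using n n0(1) by simp
    have abs_int: "set_integrable lebesgue upper_half (\<lambda>z. \<bar>u z * wave_operator (\<phi> n) z\<bar>)"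
      using set_integrable_abs[OF wk(2)[OF n']] .
    have "(LINT z:upper_half|lebesgue. riesz_conv \<alpha> p u z * \<bar>u z\<bar> powr q * \<phi> n z)
        \<le> (LINT z:upper_half|lebesgue. u z * wave_operator (\<phi> n) z)"
      using wk(4)[OF n'] n0(2)[OF n] by linarith
    \<comment> \<open>\<open>u\<close> may change sign, whereas the estimates concern
      \<open>\<bar>u\<bar>\<close> through \<open>w\<close>.\<close>
    also have "\<dots> \<le> (LINT z:upper_half|lebesgue. \<bar>u z * wave_operator (\<phi> n) z\<bar>)"
      by (intro set_integral_mono wk(2)[OF n'] abs_int) simp
    finally have "?A n \<le> ennreal (LINT z:upper_half|lebesgue. \<bar>u z * wave_operator (\<phi> n) z\<bar>)"
      unfolding A_eq[OF n', symmetric] by (rule ennreal_leI)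
    also have "\<dots> = (\<integral>\<^sup>+z. ennreal (w z * \<bar>wave_operator (\<phi> n) z\<bar>) \<partial>lborel)"
    proof (rule set_lebesgue_integral_upper_half_nn[OF abs_int])
      show "AE z in lborel. z \<in> upper_half \<longrightarrow> ennreal \<bar>u z * wave_operator (\<phi> n) z\<bar> = ennreal (w z * \<bar>wave_operator (\<phi> n) z\<bar>)"
        using wu by eventually_elim (simp add: abs_mult)
    qed (auto simp: w0)
    finally show ?thesis .
  qed
  define g where "g z = w z powr r" for z
  have g: "g \<in> borel_measurable borel" "\<And>z. g z \<ge> 0"
    using w(1) by (auto simp: g_def[abs_def])
  have lower: "ennreal ((4 * real n) powr (-\<alpha>)) * energy (\<lambda>z. g z * \<phi> n z) \<le> ?A n" if n: "n > 0" for n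
  proof -
    have "norm x \<le> 2 * real n" if "\<phi> n (x, t) \<noteq> 0" for x t
      using \<phi>_0[OF n, of "(x, t)"] that norm_fst_le[of x t] by linarith
    from riesz_energy_lower_bound[OF w(1,2) \<phi>_meas[of n] \<phi>01 this _ \<alpha>, where p = p and q = q]
    show ?thesis using n by (simp add: energy_def g_def r_def)
  qed
  have cancel: "ennreal ((4 * real n) powr \<alpha>) * ennreal ((4 * real n) powr (-\<alpha>)) = 1" if "n > 0" for n
    using that by (simp add: ennreal_mult[symmetric] powr_minus)
  have fin: "energy (\<lambda>z. g z * \<phi> n z) < \<infinity>" if "n \<ge> n0" for n
  proof -
    have n: "n > 0" using that n0(1) by simp
    have "ennreal ((4 * real n) powr (-\<alpha>)) * energy (\<lambda>z. g z * \<phi> n z) < \<infinity>"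
      using lower[OF n] A_fin[OF n] by (rule order_le_less_trans)
    then show ?thesis using n by (auto simp: ennreal_mult_less_top)
  qed
  \<comment> \<open>\<open>?V * real n powr N\<close> is the volume of the ball of radius
    \<open>2 * n\<close>.\<close>
  let ?V = "unit_ball_vol DIM('a) * 2 ^ DIM('a)"
  obtain D where D: "D > 0" "\<And>\<eta> R. \<eta> > 0 \<Longrightarrow> R \<ge> 1 \<Longrightarrow> \<exists>\<kappa>>0. \<exists>\<mu>>0.
      (4 * R) powr \<alpha> * (C / R\<^sup>2 * \<kappa> powr (r - 1) * \<mu>) = \<eta> \<and>
      (4 * R) powr \<alpha> * (C / R\<^sup>2 * (2 * R) * (\<kappa> powr (r - 1) / \<mu> + ?V * R powr N / \<kappa>)) \<le> D * \<eta> powr (- (1 / (2 * r - 1)))"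
    using scaling_parameters[OF r _ C(1) crit, of ?V] by auto
  have ineq: "energy (\<lambda>z. g z * \<phi> n z) \<le> ennreal \<eta> * energy (\<lambda>z. indicator {z. norm z \<ge> real n} z * (g z * \<phi> n z))
      + ennreal (D * \<eta> powr (- (1 / (2 * r - 1))))" if nn: "n \<ge> n0" and \<eta>: "\<eta> > 0" for n \<eta>
  proof -
    have n: "n > 0" using nn n0(1) by simp
    obtain \<kappa> \<mu> where \<kappa>\<mu>: "\<kappa> > 0" "\<mu> > 0"
      and 1: "(4 * real n) powr \<alpha> * (C / (real n)\<^sup>2 * \<kappa> powr (r - 1) * \<mu>) = \<eta>"
      and 2: "(4 * real n) powr \<alpha> * (C / (real n)\<^sup>2 * (2 * real n) * (\<kappa> powr (r - 1) / \<mu> + ?V * real n powr N / \<kappa>)) \<le> D * \<eta> powr (- (1 / (2 * r - 1)))"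
      using D(2)[OF \<eta>, of "real n"] n by auto
    let ?a = "C / (real n)\<^sup>2 * \<kappa> powr (r - 1) * \<mu>"
    let ?b = "C / (real n)\<^sup>2 * (2 * real n) * (\<kappa> powr (r - 1) / \<mu> + ?V * real n powr N / \<kappa>)"
    let ?T = "energy (\<lambda>z. indicator {z. norm z \<ge> real n} z * (g z * \<phi> n z))"
    have vol: "unit_ball_vol DIM('a) * (2 * real n) ^ DIM('a) = ?V * real n powr N"
      using n by (simp add: N_def powr_realpow power_mult_distrib)
    have "?A n \<le> (\<integral>\<^sup>+z. ennreal (w z * \<bar>wave_operator (\<phi> n) z\<bar>) \<partial>lborel)" by (rule A_le[OF nn])
    also have "\<dots> \<le> ennreal ?a * ?T + ennreal ?b"
      unfolding energy_def g_def vol[symmetric]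
      by (rule linear_term_upper_bound[OF w \<phi>_meas \<phi>01(1) \<phi>_0[OF n] wave_bound[OF n]])
        (use n C(1) r \<kappa>\<mu> wave_0[OF n] in auto)
    finally have "ennreal ((4 * real n) powr (-\<alpha>)) * energy (\<lambda>z. g z * \<phi> n z) \<le> ennreal ?a * ?T + ennreal ?b"
      using lower[OF n] by (rule order_trans[rotated])
    then have "ennreal ((4 * real n) powr \<alpha>) * (ennreal ((4 * real n) powr (-\<alpha>)) * energy (\<lambda>z. g z * \<phi> n z))
        \<le> ennreal ((4 * real n) powr \<alpha>) * (ennreal ?a * ?T + ennreal ?b)"
      by (rule mult_left_mono) simp
    also have "\<dots> = ennreal ((4 * real n) powr \<alpha> * ?a) * ?T + ennreal ((4 * real n) powr \<alpha> * ?b)"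
      by (simp only: ennreal_mult'[OF powr_ge_zero, of _ _ ?a] ennreal_mult'[OF powr_ge_zero, of _ _ ?b]
          distrib_left[of "ennreal ((4 * real n) powr \<alpha>)"] mult.assoc[of "ennreal ((4 * real n) powr \<alpha>)"])
    also have "\<dots> \<le> ennreal \<eta> * ?T + ennreal (D * \<eta> powr (- (1 / (2 * r - 1))))"
      unfolding 1 by (intro add_left_mono ennreal_leI 2)
    finally show ?thesis by (simp only: mult.assoc[symmetric] cancel[OF n] mult_1_left)
  qed
  have "AE z in lborel. g z = 0"
    by (rule vanishing_from_energy_inequality[OF g \<phi>01 \<phi>_1 _ D(1) fin ineq]) (use r in auto)
  then have "AE z in lborel. z \<in> upper_half \<longrightarrow> u z = 0"
    using wu by eventually_elim (auto simp: g_def)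
  then show ?thesis by (simp add: AE_completion_iff)
qed

theorem corollary1p3:
  fixes N :: nat and p q \<alpha> :: real
  assumes "N = CARD('n::finite)" and "p > 0" and "q > 0" and "0 < \<alpha>" and "\<alpha> < real N"
  shows
    "(q \<ge> 1 \<longrightarrow>
       (\<exists>u0 u1 (u :: (real ^ 'n) \<times> real \<Rightarrow> real).
          weak_solution \<alpha> p q u0 u1 u \<and> classical_solution \<alpha> p q u0 u1 u \<and>
          (\<forall>z\<in>upper_half. u z > 0) \<and> (\<forall>x. u1 x < 0)))
     \<and>
     (\<alpha> < min (real N) (3 / 2) \<and> 2 < p + q \<and> p + q \<le> (2 * real N + 1) / (real N + \<alpha> - 1) \<longrightarrow>
       \<not> (\<exists>u0 u1 (u :: (real ^ 'n) \<times> real \<Rightarrow> real).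
            weak_solution \<alpha> p q u0 u1 u \<and>
            \<not> (AE z in lebesgue. z \<in> upper_half \<longrightarrow> u z = 0) \<and>
            ((AE x in lebesgue. u1 x \<ge> 0) \<or>
             (integrable lebesgue u1 \<and> (LINT x|lebesgue. u1 x) > 0))))
     \<and>
     (N > 2 \<and> min p q > (real N - \<alpha>) / (real N - 2) \<and> p + q > (2 * real N - \<alpha>) / (real N - 2) \<longrightarrow>
       (\<exists>u0 u1 (u :: (real ^ 'n) \<times> real \<Rightarrow> real).
          weak_solution \<alpha> p q u0 u1 u \<and> classical_solution \<alpha> p q u0 u1 u \<and>
          (\<forall>z\<in>upper_half. u z > 0) \<and> (\<forall>x. u1 x > 0)))"
proof -
  have N: "DIM(real ^ 'n) = N" using assms(1) by simp
  have \<alpha>: "\<alpha> < DIM(real ^ 'n)" using assms(5) unfolding N .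
  show ?thesis
  proof (intro conjI impI notI)
    assume "q \<ge> 1"
    from exists_decreasing_solution[where 'a = "real ^ 'n", OF assms(2) this assms(4) \<alpha>]
    show "\<exists>u0 u1 (u :: (real ^ 'n) \<times> real \<Rightarrow> real).
          weak_solution \<alpha> p q u0 u1 u \<and> classical_solution \<alpha> p q u0 u1 u \<and>
          (\<forall>z\<in>upper_half. u z > 0) \<and> (\<forall>x. u1 x < 0)" .
  next
    assume pq: "\<alpha> < min (real N) (3 / 2) \<and> 2 < p + q \<and> p + q \<le> (2 * real N + 1) / (real N + \<alpha> - 1)"
    assume "\<exists>u0 u1 (u :: (real ^ 'n) \<times> real \<Rightarrow> real).
            weak_solution \<alpha> p q u0 u1 u \<and>
            \<not> (AE z in lebesgue. z \<in> upper_half \<longrightarrow> u z = 0) \<and>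
            ((AE x in lebesgue. u1 x \<ge> 0) \<or>
             (integrable lebesgue u1 \<and> (LINT x|lebesgue. u1 x) > 0))"
    then obtain u0 u1 and u :: "(real ^ 'n) \<times> real \<Rightarrow> real" where
      "weak_solution \<alpha> p q u0 u1 u" "\<not> (AE z in lebesgue. z \<in> upper_half \<longrightarrow> u z = 0)"
      "(AE x in lebesgue. u1 x \<ge> 0) \<or> (integrable lebesgue u1 \<and> (LINT x|lebesgue. u1 x) > 0)"
      by blast
    moreover have "p + q \<le> (2 * real DIM(real ^ 'n) + 1) / (real DIM(real ^ 'n) + \<alpha> - 1)"
      using pq unfolding N by blast
    ultimately show False
      using weak_solution_trivial[OF assms(2-4), where u = u] pq by blast
  next
    assume pq: "N > 2 \<and> min p q > (real N - \<alpha>) / (real N - 2) \<and> p + q > (2 * real N - \<alpha>) / (real N - 2)"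
    show "\<exists>u0 u1 (u :: (real ^ 'n) \<times> real \<Rightarrow> real).
          weak_solution \<alpha> p q u0 u1 u \<and> classical_solution \<alpha> p q u0 u1 u \<and>
          (\<forall>z\<in>upper_half. u z > 0) \<and> (\<forall>x. u1 x > 0)"
      by (rule exists_increasing_solution[where 'a = "real ^ 'n", OF assms(2-4) \<alpha>]; unfold N) (use pq in auto)
  qed
qed

end
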